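(* Let $\mathscr{P}$ be one of the non-compact symmetric spaces $\mathscr{P}_n(\mathbb{R})=GL_n(\mathbb{R})/O_n$, $\mathscr{P}_n(\mathbb{C})=GL_n(\mathbb{C})/U_n$, $\mathscr{P}_n(\mathbb{H})=GL_n(\mathbb{H})/Sp_n$, $\mathscr{P}_3(\mathbb{O})=GL_3(\mathbb{O})/F_4$. There exists an isometric immersion of a flat torus being a totally geodesic submanifold of $\mathscr{P}$. It carries the structure of a Frobenius manifold; all geodesics of $\mathscr{P}$ lie in that subspace. The homogeneous Cartan--Hadamard space $\mathscr{P}$ has negative sectional curvature and carries a pre-Frobenius structure.
   Context: $\mathscr{P}_n(\mathbb{K})$ is the open cone of $n\times n$ positive definite symmetric (resp. self-adjoint) matrices over $\mathbb{K}$, with a $G$-invariant Riemannian metric; $GL_3(\mathbb{O})$ denotes the automorphism group of $\mathscr{P}_3(\mathbb{O})$, with Lie algebra $\mathfrak{e}_{6(-26)}\oplus\mathbb{R}$. "Torus" is used in the sense of an algebraic torus, of the form $\exp$ of a Cartan subalgebra (diagonal matrices). A (potential) pre-Frobenius structure on a manifold $M$: (i) a Riemannian structure and a flat torsionless affine connection $\nabla^0$; (ii) a non-degenerate symmetric bilinear form $g$ on $\mathcal{T}_M$ compatible with $\nabla^0$ (understood as $(\nabla^0_Xg)(Y,Z)=(\nabla^0_Yg)(X,Z)$); (iii) a symmetric rank three tensor $A$ with $A_{abc}=\partial_a\partial_b\partial_c\Phi$ in local flat coordinates, $\Phi$ a real potential; (iv) a composition law $\partial_a\circ\partial_b=\sum_{c,e}A_{abe}g^{ec}\partial_c$;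 (v) $A(X,Y,Z)=g(X\circ Y,Z)=g(X,Y\circ Z)$ for flat $X,Y,Z$. A Frobenius manifold is a potential pre-Frobenius manifold for which $(\mathcal{T}_M,\circ)$ is a Frobenius algebra (finite-dimensional, unital, commutative, associative, with a non-degenerate symmetric bilinear form satisfying $\langle x\circ y,z\rangle=\langle x,y\circ z\rangle$).
   Formalization: "All geodesics lie in that subspace" is proved as: every geodesic lies in a G-translate of the flat torus (one flat cannot contain all geodesics for n≥2); "negative sectional curvature" is proved as sectional curvature ≤ 0 (it vanishes on the flat torus for n≥2). *)

theory Defs
  imports "HOL-Analysis.Analysis"
begin

section \<open>Real, complex, quaternionic and octonionic scalars\<close>

text \<open>
  Quaternions and octonions are obtained from the complex numbers by Cayley--Dickson doubling.
  The class below is purely syntactic on top of Euclidean spaces; in its four instances of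
  interest the inner product is the one of the composition algebra, so that
  \<open>x \<bullet> y\<close> is the real part of \<open>star x * y\<close>.
\<close>

class star_algebra = euclidean_space + times + one +
  fixes star :: "'a \<Rightarrow> 'a"

class comm_star_algebra = star_algebra + comm_ring_1 +
  assumes star_add: "star (x + y) = star x + star y"
    and star_mult: "star (x * y) = star x * star y"
    and star_star: "star (star x) = x"

instantiation real :: comm_star_algebra
begin
definition "star (x::real) = x"
instance by standard (simp_all add: star_real_def)
end

instantiation complex :: comm_star_algebra
begin
definition "star (z::complex) = cnj z"
instance by standard (simp_all add: star_complex_def)
end

datatype 'a cd = CD (cd1: 'a) (cd2: 'a)

instantiation cd :: (real_inner) real_inner
begin

definition "0 = CD 0 0"
definition "x + y = CD (cd1 x + cd1 y) (cd2 x + cd2 y)"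
definition "- x = CD (- cd1 x) (- cd2 x)"
definition "x - y = CD (cd1 x - cd1 y) (cd2 x - cd2 y)"
definition "r *\<^sub>R x = CD (r *\<^sub>R cd1 x) (r *\<^sub>R cd2 x)"
definition "x \<bullet> y = cd1 x \<bullet> cd1 y + cd2 x \<bullet> cd2 y"
definition "norm (x::'a cd) = sqrt (x \<bullet> x)"
definition "sgn (x::'a cd) = inverse (norm x) *\<^sub>R x"
definition "dist (x::'a cd) y = norm (x - y)"
definition "(uniformity :: ('a cd \<times> 'a cd) filter) = (INF e\<in>{0<..}. principal {(x, y). dist x y < e})"
definition "open (U :: 'a cd set) \<longleftrightarrow> (\<forall>x\<in>U. eventually (\<lambda>(x', y). x' = x \<longrightarrow> y \<in> U) uniformity)"

instance
proof
  fix x y z :: "'a cd" and r s :: real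
  show "0 \<le> x \<bullet> x" by (simp add: inner_cd_def)
  show "(x \<bullet> x = 0) = (x = 0)"
    by (cases x) (auto simp: inner_cd_def zero_cd_def add_nonneg_eq_0_iff)
qed (auto simp: zero_cd_def plus_cd_def uminus_cd_def minus_cd_def scaleR_cd_def inner_cd_def
      norm_cd_def sgn_cd_def dist_cd_def uniformity_cd_def open_cd_def
      algebra_simps inner_simps inner_commute)

end

instantiation cd :: (euclidean_space) euclidean_space
begin

definition "Basis = (\<lambda>b. CD b 0) ` Basis \<union> (\<lambda>b. CD 0 b) ` Basis"

instance
proof
  fix x y :: "'a cd"
  show "(Basis :: 'a cd set) \<noteq> {}" "finite (Basis :: 'a cd set)"
    by (simp_all add: Basis_cd_def)
  show "x \<bullet> y = (if x = y then 1 else 0)" if "x \<in> Basis" "y \<in> Basis"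
    using that by (auto simp: Basis_cd_def inner_cd_def inner_Basis split: if_splits)
  show "(\<forall>u\<in>Basis. x \<bullet> u = 0) \<longleftrightarrow> x = 0"
    by (cases x) (auto simp: Basis_cd_def inner_cd_def zero_cd_def ball_Un euclidean_all_zero_iff)
qed

end

instantiation cd :: (star_algebra) star_algebra
begin

definition "1 = CD 1 0"
definition "x * y = CD (cd1 x * cd1 y - star (cd2 y) * cd2 x) (cd2 y * cd1 x + cd2 x * star (cd1 y))"
definition "star x = CD (star (cd1 x)) (- cd2 x)"

instance ..

end

lemma star_zero [simp]: "star 0 = (0::'a::comm_star_algebra)"
  using star_add[of 0 "0::'a"] by simp

lemma star_minus: "star (- x) = - star (x::'a::comm_star_algebra)"
  by (metis add.right_inverse add_eq_0_iff star_add star_zero)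

lemma star_diff: "star (x - y) = star x - star (y::'a::comm_star_algebra)"
  by (metis diff_conv_add_uminus star_add star_minus)

lemma star_one [simp]: "star 1 = (1::'a::comm_star_algebra)"
  by (metis mult.right_neutral mult.commute star_mult star_star)

instance cd :: (comm_star_algebra) ring_1
  by standard
    (auto simp: zero_cd_def one_cd_def times_cd_def plus_cd_def star_add star_mult star_star
      star_diff algebra_simps)

type_synonym quaternion = "complex cd"
type_synonym octonion = "quaternion cd"


section \<open>The cones of positive definite matrices and their groups\<close>

definition adjoint_mat :: "'k::star_algebra^'n^'m \<Rightarrow> 'k^'m^'n" where
  "adjoint_mat x = (\<chi> i j. star (x $ j $ i))"

definition selfadjoint :: "('k::star_algebra^'n^'n) set" where
  "selfadjoint = {x. adjoint_mat x = x}"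

text \<open>
  For self-adjoint \<open>x\<close> over the reals, complex numbers or quaternions the scalar \<open>\<xi>\<^sup>* x \<xi>\<close> is real
  and equals \<open>\<xi> \<bullet> (x *v \<xi>)\<close>.
\<close>

definition posdef :: "('k::{star_algebra,ring_1}^'n^'n) set" where
  "posdef = {x \<in> selfadjoint. \<forall>\<xi>. \<xi> \<noteq> 0 \<longrightarrow> \<xi> \<bullet> (x *v \<xi>) > 0}"

definition congruences :: "('k::{star_algebra,ring_1}^'n^'n \<Rightarrow> 'k^'n^'n) set" where
  "congruences = {(\<lambda>x. a ** x ** adjoint_mat a) | a. invertible a}"

text \<open>
  The library product \<open>**\<close> needs associative scalars; \<open>mat_times\<close> is the same formula
  for arbitrary ones.
\<close>

definition mat_times :: "'k::star_algebra^'n^'n \<Rightarrow> 'k^'n^'n \<Rightarrow> 'k^'n^'n" where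
  "mat_times x y = (\<chi> i j. \<Sum>k\<in>UNIV. x $ i $ k * y $ k $ j)"

definition jordan :: "'k::star_algebra^'n^'n \<Rightarrow> 'k^'n^'n \<Rightarrow> 'k^'n^'n" where
  "jordan x y = (1/2) *\<^sub>R (mat_times x y + mat_times y x)"

text \<open>
  Over the octonions \<open>\<xi>\<^sup>* x \<xi>\<close> is not the right notion of positivity, as it ignores
  non-associativity and cuts out a different cone. Positive definiteness of a matrix in the Albert
  algebra means that Jordan multiplication by it is a positive definite operator for the
  trace form \<open>(y, z) \<mapsto> Re tr (y z)\<close>, which on self-adjoint matrices is \<open>y \<bullet> z\<close>. The resulting
  set is the symmetric cone of the Albert algebra, i.e. the interior of its set of squares.
\<close>

definition posdef_oct :: "(octonion^3^3) set" where
  "posdef_oct = {x \<in> selfadjoint. \<forall>y\<in>selfadjoint. y \<noteq> 0 \<longrightarrow> jordan x y \<bullet> y > 0}"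

text \<open>The linear automorphisms of the cone; only their values on \<open>selfadjoint\<close> matter.\<close>

definition cone_automorphisms :: "(octonion^3^3 \<Rightarrow> octonion^3^3) set" where
  "cone_automorphisms = {k. linear k \<and> k ` posdef_oct = posdef_oct}"

definition cartan :: "('k::star_algebra^'n^'n) set" where
  "cartan = {(\<chi> i j. if i = j then a $ i *\<^sub>R 1 else 0) | a :: real^'n. True}"

text \<open>
  Jordan powers agree with the usual powers when the scalars are associative, so \<open>mat_exp\<close> is then
  the usual matrix exponential.
\<close>

primrec jordan_power :: "'k::star_algebra^'n^'n \<Rightarrow> nat \<Rightarrow> 'k^'n^'n" where
  "jordan_power x 0 = mat 1"
| "jordan_power x (Suc m) = jordan x (jordan_power x m)"

definition mat_exp :: "'k::star_algebra^'n^'n \<Rightarrow> 'k^'n^'n" where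
  "mat_exp x = (\<Sum>m. (1 / fact m) *\<^sub>R jordan_power x m)"

definition torus :: "('k::star_algebra^'n^'n) set" where
  "torus = mat_exp ` cartan"


section \<open>Differential geometry on open subsets of a vector space\<close>

text \<open>
  All manifolds below are nonempty relatively open subsets \<open>U\<close> of a linear subspace \<open>V\<close> of an
  ambient Euclidean space, with \<open>V\<close> as tangent space at every point. The cones are open in the
  space of self-adjoint matrices, and the torus (diagonal matrices with positive
  entries) is open in the space of real diagonal matrices. A vector field is a map \<open>U \<rightarrow> V\<close>; a tensor
  field takes the base point as its first argument.
\<close>

definition dir_deriv :: "('e::real_normed_vector \<Rightarrow> 'f::real_normed_vector) \<Rightarrow> 'e \<Rightarrow> 'e \<Rightarrow> 'f" where
  "dir_deriv f v x = vector_derivative (\<lambda>t. f (x + t *\<^sub>R v)) (at 0)"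

text \<open>On an open set, \<open>C\<^sup>k\<close> means that all iterated directional derivatives exist and are continuous.\<close>

primrec C_k :: "nat \<Rightarrow> 'e::real_normed_vector set \<Rightarrow> 'e set \<Rightarrow> ('e \<Rightarrow> 'f::real_normed_vector) \<Rightarrow> bool" where
  "C_k 0 V U f \<longleftrightarrow> continuous_on U f"
| "C_k (Suc k) V U f \<longleftrightarrow> continuous_on U f \<and>
     (\<forall>v\<in>V. (\<forall>x\<in>U. (\<lambda>t::real. f (x + t *\<^sub>R v)) differentiable (at 0)) \<and> C_k k V U (dir_deriv f v))"

definition smooth :: "'e::real_normed_vector set \<Rightarrow> 'e set \<Rightarrow> ('e \<Rightarrow> 'f::real_normed_vector) \<Rightarrow> bool" where
  "smooth V U f \<longleftrightarrow> (\<forall>k. C_k k V U f)"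

definition domain_in :: "'e::euclidean_space set \<Rightarrow> 'e set \<Rightarrow> bool" where
  "domain_in V U \<longleftrightarrow> subspace V \<and> openin (top_of_set V) U \<and> U \<noteq> {}"

type_synonym 'e form_field = "'e \<Rightarrow> 'e \<Rightarrow> 'e \<Rightarrow> real"
type_synonym 'e product_field = "'e \<Rightarrow> 'e \<Rightarrow> 'e \<Rightarrow> 'e"

definition symmetric_form_field :: "'e::euclidean_space set \<Rightarrow> 'e set \<Rightarrow> 'e form_field \<Rightarrow> bool" where
  "symmetric_form_field V U g \<longleftrightarrow>
     (\<forall>x\<in>U. \<forall>u\<in>V. \<forall>v\<in>V. \<forall>w\<in>V. \<forall>a b.
        g x (a *\<^sub>R u + b *\<^sub>R v) w = a * g x u w + b * g x v w) \<and>
     (\<forall>x\<in>U. \<forall>u\<in>V. \<forall>v\<in>V. g x u v = g x v u) \<and>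
     (\<forall>u\<in>V. \<forall>v\<in>V. smooth V U (\<lambda>x. g x u v))"

definition nondegenerate :: "'e::euclidean_space set \<Rightarrow> 'e set \<Rightarrow> 'e form_field \<Rightarrow> bool" where
  "nondegenerate V U g \<longleftrightarrow> (\<forall>x\<in>U. \<forall>u\<in>V. (\<forall>v\<in>V. g x u v = 0) \<longrightarrow> u = 0)"

definition riemannian :: "'e::euclidean_space set \<Rightarrow> 'e set \<Rightarrow> 'e form_field \<Rightarrow> bool" where
  "riemannian V U g \<longleftrightarrow> domain_in V U \<and> symmetric_form_field V U g \<and>
     (\<forall>x\<in>U. \<forall>u\<in>V. u \<noteq> 0 \<longrightarrow> g x u u > 0)"

text \<open>The elements of \<open>G\<close> are linear in all uses, hence equal to their own differentials.\<close>

definition invariant_metric ::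
  "'e::euclidean_space set \<Rightarrow> 'e set \<Rightarrow> ('e \<Rightarrow> 'e) set \<Rightarrow> 'e form_field \<Rightarrow> bool" where
  "invariant_metric V U G g \<longleftrightarrow> riemannian V U g \<and>
     (\<forall>k\<in>G. \<forall>x\<in>U. \<forall>u\<in>V. \<forall>v\<in>V. g (k x) (k u) (k v) = g x u v)"

definition homogeneous :: "'e set \<Rightarrow> ('e \<Rightarrow> 'e) set \<Rightarrow> bool" where
  "homogeneous U G \<longleftrightarrow> (\<forall>k\<in>G. k ` U = U) \<and> (\<forall>x\<in>U. \<forall>y\<in>U. \<exists>k\<in>G. k x = y)"

text \<open>
  An affine connection is written \<open>\<nabla>\<^sub>X Y = D\<^sub>X Y + \<Gamma>(X, Y)\<close> with \<open>D\<close> the directional derivative in \<open>V\<close>,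
  and is represented by the field \<open>\<Gamma>\<close>.
\<close>

definition affine_connection :: "'e::euclidean_space set \<Rightarrow> 'e set \<Rightarrow> 'e product_field \<Rightarrow> bool" where
  "affine_connection V U \<Gamma> \<longleftrightarrow>
     (\<forall>x\<in>U. \<forall>u\<in>V. \<forall>v\<in>V. \<Gamma> x u v \<in> V) \<and>
     (\<forall>x\<in>U. \<forall>u\<in>V. \<forall>v\<in>V. \<forall>w\<in>V. \<forall>a b.
        \<Gamma> x (a *\<^sub>R u + b *\<^sub>R v) w = a *\<^sub>R \<Gamma> x u w + b *\<^sub>R \<Gamma> x v w \<and>
        \<Gamma> x w (a *\<^sub>R u + b *\<^sub>R v) = a *\<^sub>R \<Gamma> x w u + b *\<^sub>R \<Gamma> x w v) \<and>
     (\<forall>u\<in>V. \<forall>v\<in>V. smooth V U (\<lambda>x. \<Gamma> x u v))"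

text \<open>For constant \<open>X, Y\<close>, whose Lie bracket vanishes, the torsion is \<open>\<Gamma>(X, Y) - \<Gamma>(Y, X)\<close>.\<close>

definition torsionless :: "'e set \<Rightarrow> 'e set \<Rightarrow> 'e product_field \<Rightarrow> bool" where
  "torsionless V U \<Gamma> \<longleftrightarrow> (\<forall>x\<in>U. \<forall>u\<in>V. \<forall>v\<in>V. \<Gamma> x u v = \<Gamma> x v u)"

text \<open>\<open>R(u, v) w = \<nabla>\<^sub>u \<nabla>\<^sub>v w - \<nabla>\<^sub>v \<nabla>\<^sub>u w\<close> for constant vector fields.\<close>

definition curvature :: "'e::euclidean_space product_field \<Rightarrow> 'e \<Rightarrow> 'e \<Rightarrow> 'e \<Rightarrow> 'e \<Rightarrow> 'e" where
  "curvature \<Gamma> x u v w =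
     (dir_deriv (\<lambda>y. \<Gamma> y v w) u x + \<Gamma> x u (\<Gamma> x v w)) -
     (dir_deriv (\<lambda>y. \<Gamma> y u w) v x + \<Gamma> x v (\<Gamma> x u w))"

definition flat :: "'e::euclidean_space set \<Rightarrow> 'e set \<Rightarrow> 'e product_field \<Rightarrow> bool" where
  "flat V U \<Gamma> \<longleftrightarrow> (\<forall>x\<in>U. \<forall>u\<in>V. \<forall>v\<in>V. \<forall>w\<in>V. curvature \<Gamma> x u v w = 0)"

text \<open>The Koszul formula for constant vector fields.\<close>

definition levi_civita :: "'e::euclidean_space set \<Rightarrow> 'e form_field \<Rightarrow> 'e product_field" where
  "levi_civita V g x u v = (THE c. c \<in> V \<and> (\<forall>w\<in>V.
     2 * g x c w = dir_deriv (\<lambda>y. g y v w) u x + dir_deriv (\<lambda>y. g y u w) v x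
                   - dir_deriv (\<lambda>y. g y u v) w x))"

definition sectional :: "'e::euclidean_space set \<Rightarrow> 'e form_field \<Rightarrow> 'e \<Rightarrow> 'e \<Rightarrow> 'e \<Rightarrow> real" where
  "sectional V g x u v =
     g x (curvature (levi_civita V g) x u v v) u / (g x u u * g x v v - (g x u v)\<^sup>2)"

definition geodesic ::
  "'e::euclidean_space set \<Rightarrow> 'e set \<Rightarrow> 'e form_field \<Rightarrow> real set \<Rightarrow> (real \<Rightarrow> 'e) \<Rightarrow> bool" where
  "geodesic V U g J \<gamma> \<longleftrightarrow> open J \<and> is_interval J \<and> \<gamma> ` J \<subseteq> U \<and>
     (\<exists>\<gamma>' \<gamma>''. \<forall>t\<in>J.
        (\<gamma> has_vector_derivative \<gamma>' t) (at t) \<and> (\<gamma>' has_vector_derivative \<gamma>'' t) (at t) \<and>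
        \<gamma>'' t + levi_civita V g (\<gamma> t) (\<gamma>' t) (\<gamma>' t) = 0)"

definition geodesically_complete :: "'e::euclidean_space set \<Rightarrow> 'e set \<Rightarrow> 'e form_field \<Rightarrow> bool" where
  "geodesically_complete V U g \<longleftrightarrow>
     (\<forall>x\<in>U. \<forall>v\<in>V. \<exists>\<gamma>. geodesic V U g UNIV \<gamma> \<and> \<gamma> 0 = x \<and> (\<gamma> has_vector_derivative v) (at 0))"

text \<open>
  "Negative" curvature has to be read as \<open>\<le> 0\<close>, the convention in the notion of a Cartan--Hadamard
  manifold: the cones contain flat subspaces, on whose tangent planes the sectional curvature is \<open>0\<close>.
\<close>

definition nonpositive_curvature :: "'e::euclidean_space set \<Rightarrow> 'e set \<Rightarrow> 'e form_field \<Rightarrow> bool" where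
  "nonpositive_curvature V U g \<longleftrightarrow>
     (\<forall>x\<in>U. \<forall>u\<in>V. \<forall>v\<in>V. u \<noteq> v \<longrightarrow> independent {u, v} \<longrightarrow> sectional V g x u v \<le> 0)"

definition cartan_hadamard :: "'e::euclidean_space set \<Rightarrow> 'e set \<Rightarrow> 'e form_field \<Rightarrow> bool" where
  "cartan_hadamard V U g \<longleftrightarrow> riemannian V U g \<and> simply_connected U \<and>
     geodesically_complete V U g \<and> nonpositive_curvature V U g"

text \<open>The differential is injective automatically, since \<open>h\<close> is positive definite.\<close>

definition isometric_immersion ::
  "'e::euclidean_space set \<Rightarrow> 'e set \<Rightarrow> 'e form_field \<Rightarrow>
   'f::euclidean_space set \<Rightarrow> 'f set \<Rightarrow> 'f form_field \<Rightarrow> ('e \<Rightarrow> 'f) \<Rightarrow> bool" where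
  "isometric_immersion W T h V U g \<iota> \<longleftrightarrow> riemannian W T h \<and> riemannian V U g \<and>
     smooth W T \<iota> \<and> \<iota> ` T \<subseteq> U \<and>
     (\<forall>x\<in>T. \<forall>u\<in>W. \<forall>v\<in>W. g (\<iota> x) (dir_deriv \<iota> u x) (dir_deriv \<iota> v x) = h x u v)"

definition totally_geodesic_submanifold ::
  "'e::euclidean_space set \<Rightarrow> 'e set \<Rightarrow> 'e form_field \<Rightarrow>
   'f::euclidean_space set \<Rightarrow> 'f set \<Rightarrow> 'f form_field \<Rightarrow> ('e \<Rightarrow> 'f) \<Rightarrow> bool" where
  "totally_geodesic_submanifold W T h V U g \<iota> \<longleftrightarrow>
     isometric_immersion W T h V U g \<iota> \<and> (\<exists>\<kappa>. homeomorphism T (\<iota> ` T) \<iota> \<kappa>) \<and>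
     (\<forall>J \<gamma>. geodesic W T h J \<gamma> \<longrightarrow> geodesic V U g J (\<iota> \<circ> \<gamma>))"


section \<open>Pre-Frobenius and Frobenius structures\<close>

definition cov_deriv_form ::
  "'e::euclidean_space product_field \<Rightarrow> 'e form_field \<Rightarrow> 'e \<Rightarrow> 'e \<Rightarrow> 'e \<Rightarrow> 'e \<Rightarrow> real" where
  "cov_deriv_form \<Gamma> g x u v w = dir_deriv (\<lambda>y. g y v w) u x - g x (\<Gamma> x u v) w - g x v (\<Gamma> x u w)"

definition symmetric_cubic_field ::
  "'e::euclidean_space set \<Rightarrow> 'e set \<Rightarrow> ('e \<Rightarrow> 'e \<Rightarrow> 'e \<Rightarrow> 'e \<Rightarrow> real) \<Rightarrow> bool" where
  "symmetric_cubic_field V U A \<longleftrightarrow>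
     (\<forall>x\<in>U. \<forall>u\<in>V. \<forall>v\<in>V. \<forall>w\<in>V. \<forall>z\<in>V. \<forall>a b.
        A x (a *\<^sub>R u + b *\<^sub>R v) w z = a * A x u w z + b * A x v w z) \<and>
     (\<forall>x\<in>U. \<forall>u\<in>V. \<forall>v\<in>V. \<forall>w\<in>V. A x u v w = A x v u w \<and> A x u v w = A x u w v) \<and>
     (\<forall>u\<in>V. \<forall>v\<in>V. \<forall>w\<in>V. smooth V U (\<lambda>x. A x u v w))"

definition vector_field :: "'e::euclidean_space set \<Rightarrow> 'e set \<Rightarrow> ('e \<Rightarrow> 'e) \<Rightarrow> bool" where
  "vector_field V U X \<longleftrightarrow> smooth V U X \<and> X ` U \<subseteq> V"

definition flat_field :: "'e::euclidean_space set \<Rightarrow> 'e set \<Rightarrow> 'e product_field \<Rightarrow> ('e \<Rightarrow> 'e) \<Rightarrow> bool" where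
  "flat_field V N \<Gamma> X \<longleftrightarrow> vector_field V N X \<and>
     (\<forall>x\<in>N. \<forall>u\<in>V. dir_deriv X u x + \<Gamma> x u (X x) = 0)"

definition apply_field :: "('e::euclidean_space \<Rightarrow> 'e) \<Rightarrow> ('e \<Rightarrow> real) \<Rightarrow> 'e \<Rightarrow> real" where
  "apply_field X f x = dir_deriv f (X x) x"

text \<open>
  The coordinate fields of local flat coordinates are the local frames of flat vector fields, so
  \<open>A\<^sub>a\<^sub>b\<^sub>c = \<partial>\<^sub>a \<partial>\<^sub>b \<partial>\<^sub>c \<Phi>\<close> says \<open>A(X, Y, Z) = X (Y (Z \<Phi>))\<close> for local flat fields. Every tangent vector is
  the value of a local flat field, so the remaining (tensorial) conditions on flat fields are stated
  for tangent vectors; \<open>ginv\<close> is the inverse of the Gram matrix of \<open>g\<close> in the frame \<open>B\<close>.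
\<close>

definition pre_frobenius ::
  "'e::euclidean_space set \<Rightarrow> 'e set \<Rightarrow> 'e form_field \<Rightarrow> 'e product_field \<Rightarrow> 'e form_field \<Rightarrow>
   ('e \<Rightarrow> 'e \<Rightarrow> 'e \<Rightarrow> 'e \<Rightarrow> real) \<Rightarrow> ('e \<Rightarrow> real) \<Rightarrow> 'e product_field \<Rightarrow> bool" where
  "pre_frobenius V U \<rho> \<Gamma> g A \<Phi> circ \<longleftrightarrow>
     \<comment> \<open>(i)\<close>
     riemannian V U \<rho> \<and> affine_connection V U \<Gamma> \<and> flat V U \<Gamma> \<and> torsionless V U \<Gamma> \<and>
     \<comment> \<open>(ii)\<close>
     symmetric_form_field V U g \<and> nondegenerate V U g \<and>
     (\<forall>x\<in>U. \<forall>u\<in>V. \<forall>v\<in>V. \<forall>w\<in>V. cov_deriv_form \<Gamma> g x u v w = cov_deriv_form \<Gamma> g x v u w) \<and>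
     \<comment> \<open>(iii)\<close>
     symmetric_cubic_field V U A \<and> smooth V U \<Phi> \<and>
     (\<forall>N X Y Z. N \<subseteq> U \<longrightarrow> openin (top_of_set V) N \<longrightarrow>
        flat_field V N \<Gamma> X \<longrightarrow> flat_field V N \<Gamma> Y \<longrightarrow> flat_field V N \<Gamma> Z \<longrightarrow>
        (\<forall>x\<in>N. A x (X x) (Y x) (Z x) = apply_field X (apply_field Y (apply_field Z \<Phi>)) x)) \<and>
     \<comment> \<open>(iv)\<close>
     (\<forall>x\<in>U. \<forall>B ginv. B \<subseteq> V \<longrightarrow> independent B \<longrightarrow> span B = V \<longrightarrow>
        (\<forall>a\<in>B. \<forall>c\<in>B. (\<Sum>e\<in>B. g x a e * ginv e c) = (if a = c then 1 else 0)) \<longrightarrow>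
        (\<forall>u\<in>V. \<forall>v\<in>V. circ x u v = (\<Sum>c\<in>B. (\<Sum>e\<in>B. A x u v e * ginv e c) *\<^sub>R c))) \<and>
     \<comment> \<open>(v)\<close>
     (\<forall>x\<in>U. \<forall>u\<in>V. \<forall>v\<in>V. \<forall>w\<in>V.
        A x u v w = g x (circ x u v) w \<and> A x u v w = g x u (circ x v w))"

text \<open>The Frobenius form of the algebra is \<open>g\<close>; its invariance is part of \<open>pre_frobenius\<close>.\<close>

definition frobenius ::
  "'e::euclidean_space set \<Rightarrow> 'e set \<Rightarrow> 'e form_field \<Rightarrow> 'e product_field \<Rightarrow> 'e form_field \<Rightarrow>
   ('e \<Rightarrow> 'e \<Rightarrow> 'e \<Rightarrow> 'e \<Rightarrow> real) \<Rightarrow> ('e \<Rightarrow> real) \<Rightarrow> 'e product_field \<Rightarrow> bool" where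
  "frobenius V U \<rho> \<Gamma> g A \<Phi> circ \<longleftrightarrow> pre_frobenius V U \<rho> \<Gamma> g A \<Phi> circ \<and>
     (\<forall>x\<in>U. \<forall>u\<in>V. \<forall>v\<in>V. \<forall>w\<in>V.
        circ x u v = circ x v u \<and> circ x (circ x u v) w = circ x u (circ x v w)) \<and>
     (\<exists>E. vector_field V U E \<and> (\<forall>x\<in>U. \<forall>u\<in>V. circ x (E x) u = u \<and> circ x u (E x) = u))"

text \<open>
  The form \<open>g\<close> of the structure is required to be the given Riemannian metric itself; with an
  unrelated \<open>g\<close> these predicates would say nothing about the Riemannian manifold.
\<close>

definition carries_pre_frobenius :: "'e::euclidean_space set \<Rightarrow> 'e set \<Rightarrow> 'e form_field \<Rightarrow> bool" where
  "carries_pre_frobenius V U g \<longleftrightarrow> (\<exists>\<Gamma> A \<Phi> circ. pre_frobenius V U g \<Gamma> g A \<Phi> circ)"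

definition carries_frobenius :: "'e::euclidean_space set \<Rightarrow> 'e set \<Rightarrow> 'e form_field \<Rightarrow> bool" where
  "carries_frobenius V U g \<longleftrightarrow> (\<exists>\<Gamma> A \<Phi> circ. frobenius V U g \<Gamma> g A \<Phi> circ)"

text \<open>
  A single flat subspace cannot contain every geodesic of the ambient space, already for
  dimension reasons. The geodesics lie in that subspace up to the isometric action of \<open>G\<close>, i.e. each
  of them lies in a translate of it.
\<close>

definition has_flat_frobenius_torus ::
  "'e::euclidean_space set \<Rightarrow> 'e set \<Rightarrow>
   'f::euclidean_space set \<Rightarrow> 'f set \<Rightarrow> ('f \<Rightarrow> 'f) set \<Rightarrow> 'f form_field \<Rightarrow> bool" where
  "has_flat_frobenius_torus W T V U G g \<longleftrightarrow> (\<exists>h \<iota>.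
     riemannian W T h \<and> flat W T (levi_civita W h) \<and>
     isometric_immersion W T h V U g \<iota> \<and>
     totally_geodesic_submanifold W T h V U g \<iota> \<and>
     carries_frobenius W T h \<and>
     (\<forall>J \<gamma>. geodesic V U g J \<gamma> \<longrightarrow> (\<exists>k\<in>G. \<gamma> ` J \<subseteq> k ` \<iota> ` T)))"

end

(*
All four cones are symmetric cones of Euclidean Jordan algebras. Let P be the quadratic
representation, x' the Jordan inverse of x and u o v the Jordan product. By the spectral theorem
(obtained by Jacobi's method from plane rotations and, to make an off-diagonal entry real,
multiplication by unit scalars; over the octonions this is triality and rests on the Moufang
identities), an invariant metric is determined by its values on diagonal elements, and permutation
invariance leaves only
    g_x(u, v) = alpha <P(x') u, v> + beta <x', u> <x', v>.
All these metrics have the connection Gamma_x(u, v) = - {u, x', v}. At the unit element its curvature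
satisfies <R(u, v) v, u> = <P(v) u, u> - |u o v|^2, which for diagonal u is minus a sum of squares.
Along a geodesic the operator z -> {gamma', z, inverse of gamma} is constant, so that gamma solves a
linear equation; diagonalizing the initial velocity, gamma is a translate of a curve in the torus of
diagonal elements. In logarithmic coordinates the metric of the torus is constant, and a cubic
potential in suitable linear coordinates makes it a Frobenius manifold. For beta = 0 the metric of the
cone is a Hessian metric for its standard affine structure, hence satisfies the Codazzi equation of a
pre-Frobenius structure (with potential zero); the general case is the pullback of this one under
x -> det(x)^p x.
*)
theory Submission
  imports Defs
begin

section \<open>Cones of Jordan algebras with a frame\<close>

text \<open>The Jordan identity is never imposed on arbitrary elements. Apart from invariance under
  \<open>K\<close>, each axiom of \<open>jordan_frame\<close> about iterated products contains a
  diagonal element, so that it can be checked entry by entry; over the octonions, where matrix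
  products cannot be rebracketed, this keeps the axioms within reach. Every point of the cone is
  \<open>m e\<close> with \<open>m\<close> composed of an element of \<open>K\<close> and a diagonal
  scaling, and \<open>m\<close> carries tensor identities from \<open>e\<close> to that point. For
  this the scaling \<open>D a\<close> has to preserve the cone. The cone is defined by positivity of
  Jordan multiplication, from which this invariance cannot be read off as it can for a quadratic
  form under congruence; hence a connectedness argument that serves all four families. The exponent
  p is forced. At the unit element the differential of x -> det(x)^p x fixes trace-free vectors and
  multiplies the unit by S = 1 + n p, with n the size of the frame, so the two metrics match exactly
  when \<alpha> S^2 = \<alpha> + n \<beta>. Positive definiteness of the metric makes both \<alpha>
  and \<alpha> + n \<beta> positive, so a positive S exists.\<close>

text \<open>\<open>V\<close> is a Euclidean Jordan algebra with Jordan frame \<open>c\<close>, \<open>Q\<close> is its polarized quadratic representation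
  \<open>P(x) = Q x x\<close>, from which the Jordan product is recovered as \<open>Q e\<close>, and \<open>K\<close> is a group of automorphisms
  that is large enough for a spectral theorem. \<open>U\<close> is the symmetric cone.\<close>

locale frame_data =
  fixes V :: "'e::euclidean_space set"
    and Q :: "'e \<Rightarrow> 'e \<Rightarrow> 'e \<Rightarrow> 'e"
    and c :: "'n::finite \<Rightarrow> 'e"
    and K :: "('e \<Rightarrow> 'e) set"
begin

definition dg :: "('n \<Rightarrow> real) \<Rightarrow> 'e" where "dg a = (\<Sum>i\<in>UNIV. a i *\<^sub>R c i)"

definition e :: 'e where "e = dg (\<lambda>_. 1)"

definition jmul :: "'e \<Rightarrow> 'e \<Rightarrow> 'e" where "jmul x y = Q e x y"

definition U :: "'e set" where "U = {x \<in> V. \<forall>y\<in>V. y \<noteq> 0 \<longrightarrow> jmul x y \<bullet> y > 0}"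

definition D :: "('n \<Rightarrow> real) \<Rightarrow> 'e \<Rightarrow> 'e" where "D a = Q (dg a) (dg a)"

definition W :: "'e set" where "W = range dg"

definition T :: "'e set" where "T = {dg a | a. \<forall>i. a i > 0}"

end

locale jordan_frame = frame_data +
  assumes subspace_V: "subspace V"
    and c_V: "c i \<in> V"
    and c_inner: "c i \<bullet> c j = (if i = j then 1 else 0)"
    and Q_lin1: "linear (\<lambda>x. Q x y z)"
    and Q_lin3: "linear (Q x y)"
    and Q_comm: "Q x y z = Q y x z"
    and Q_V: "x \<in> V \<Longrightarrow> y \<in> V \<Longrightarrow> z \<in> V \<Longrightarrow> Q x y z \<in> V"
    and Q_adj: "x \<in> V \<Longrightarrow> y \<in> V \<Longrightarrow> z \<in> V \<Longrightarrow> w \<in> V \<Longrightarrow> Q x y z \<bullet> w = z \<bullet> Q x y w"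
    and Q_unit: "x \<in> V \<Longrightarrow> Q e e x = x"
    and Q_e: "x \<in> V \<Longrightarrow> y \<in> V \<Longrightarrow> Q x y e = jmul x y"
    and Q_dg: "Q (dg a) (dg b) (dg d) = dg (\<lambda>i. a i * b i * d i)"
    and dg_pos: "(\<And>i. a i > 0) \<Longrightarrow> x \<in> V \<Longrightarrow> x \<noteq> 0 \<Longrightarrow> jmul (dg a) x \<bullet> x > 0"
    and Q_D: "x \<in> V \<Longrightarrow> y \<in> V \<Longrightarrow> z \<in> V \<Longrightarrow> Q (D a x) (D a y) z = D a (Q x y (D a z))"
    and D_mult: "x \<in> V \<Longrightarrow> D a (D b x) = D (\<lambda>i. a i * b i) x"
    and Q_shift_dg: "z \<in> V \<Longrightarrow> Q (dg a) z (dg a) = jmul (dg (\<lambda>i. (a i)\<^sup>2)) z"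
    and curv_dg: "v \<in> V \<Longrightarrow> Q v v (dg a) \<bullet> dg a \<le> jmul (dg a) v \<bullet> jmul (dg a) v"
    and K_linear: "k \<in> K \<Longrightarrow> linear k"
    and K_V: "k \<in> K \<Longrightarrow> x \<in> V \<Longrightarrow> k x \<in> V"
    and K_inner: "k \<in> K \<Longrightarrow> x \<in> V \<Longrightarrow> y \<in> V \<Longrightarrow> k x \<bullet> k y = x \<bullet> y"
    and K_e: "k \<in> K \<Longrightarrow> k e = e"
    and K_Q: "k \<in> K \<Longrightarrow> x \<in> V \<Longrightarrow> y \<in> V \<Longrightarrow> z \<in> V \<Longrightarrow> Q (k x) (k y) (k z) = k (Q x y z)"
    and K_id: "(\<lambda>x. x) \<in> K"
    and K_inv: "k \<in> K \<Longrightarrow> \<exists>k'\<in>K. \<forall>x\<in>V. k' (k x) = x \<and> k (k' x) = x"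
    and spectral: "x \<in> V \<Longrightarrow> \<exists>k\<in>K. \<exists>a. x = k (dg a)"
    and K_swap: "\<exists>k\<in>K. \<forall>l. k (c l) = c (Transposition.transpose i j l)"
begin

section \<open>Trilinearity and calculus with diagonal elements\<close>

lemma Q_lin2: "linear (\<lambda>y. Q x y z)"
  using Q_lin1[of x z] by (simp add: Q_comm)

lemmas Q_add = linear_add[OF Q_lin1] linear_add[OF Q_lin2] linear_add[OF Q_lin3]
lemmas Q_diff = linear_diff[OF Q_lin1] linear_diff[OF Q_lin2] linear_diff[OF Q_lin3]
lemmas Q_scale = linear_scale[OF Q_lin1] linear_scale[OF Q_lin2] linear_scale[OF Q_lin3]
lemmas Q_neg = linear_neg[OF Q_lin1] linear_neg[OF Q_lin2] linear_neg[OF Q_lin3]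
lemmas Q_zero = linear_0[OF Q_lin1] linear_0[OF Q_lin2] linear_0[OF Q_lin3]
lemmas Q_linear = Q_add Q_diff Q_scale Q_neg Q_zero

text \<open>Fixing the third argument at each basis vector leaves finitely many bilinear maps, whose
  bounds add up to one for the trilinear map.\<close>

lemma Q_bound: obtains B where "B > 0" "\<And>x y z. norm (Q x y z) \<le> B * norm x * norm y * norm z"
proof -
  have bil: "bilinear (\<lambda>x y. Q x y b)" for b
    using Q_lin1 Q_lin2 by (auto simp: bilinear_def)
  have "\<exists>B>0. \<forall>x y. norm (Q x y b) \<le> B * norm x * norm y" for b
    using bilinear_bounded_pos[OF bil] by blast
  then obtain B where B: "B b > 0" "norm (Q x y b) \<le> B b * norm x * norm y" for b x y
    by metis
  have "norm (Q x y z) \<le> (\<Sum>b\<in>Basis. B b) * norm x * norm y * norm z" for x y z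
  proof -
    have "Q x y z = (\<Sum>b\<in>Basis. (z \<bullet> b) *\<^sub>R Q x y b)"
      using linear_sum[OF Q_lin3, of x y "\<lambda>b. (z \<bullet> b) *\<^sub>R b" Basis]
      by (simp add: euclidean_representation linear_scale[OF Q_lin3])
    also have "norm \<dots> \<le> (\<Sum>b\<in>Basis. norm z * (B b * norm x * norm y))"
      by (intro sum_norm_le) (auto intro!: mult_mono B Basis_le_norm)
    finally show ?thesis by (simp add: sum_distrib_left sum_distrib_right mult_ac)
  qed
  moreover have "(\<Sum>b\<in>(Basis::'a set). B b) > 0" by (intro sum_pos B) auto
  ultimately show ?thesis using that by blast
qed

lemma bounded_bilinear_Q12: "bounded_bilinear (\<lambda>x y. Q x y z)"
  using Q_lin1 Q_lin2 by (auto simp: bilinear_def simp flip: bilinear_conv_bounded_bilinear)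

lemma bounded_bilinear_Q13: "bounded_bilinear (\<lambda>x z. Q x y z)"
  using Q_lin1 Q_lin3 by (auto simp: bilinear_def simp flip: bilinear_conv_bounded_bilinear)

lemma dg_V [simp]: "dg a \<in> V"
  unfolding dg_def by (intro subspace_sum subspace_scale subspace_V c_V)

lemma e_V [simp]: "e \<in> V" by (simp add: e_def)

lemma dg_add: "dg a + dg b = dg (\<lambda>i. a i + b i)"
  by (simp add: dg_def scaleR_add_left sum.distrib)

lemma dg_scale: "r *\<^sub>R dg a = dg (\<lambda>i. r * a i)"
  by (simp add: dg_def scaleR_sum_right)

lemma dg_diff: "dg a - dg b = dg (\<lambda>i. a i - b i)"
  by (simp add: dg_def scaleR_diff_left sum_subtractf)

lemma dg_inner_c [simp]: "dg a \<bullet> c i = a i" "c i \<bullet> dg a = a i"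
  by (simp_all add: dg_def inner_sum_left inner_sum_right c_inner if_distrib cong: if_cong)

lemma dg_inner: "dg a \<bullet> dg b = (\<Sum>i\<in>UNIV. a i * b i)"
  unfolding dg_def[of b] by (simp add: inner_sum_right mult.commute)

lemma dg_c: "c i = dg (\<lambda>j. if j = i then 1 else 0)"
  by (simp add: dg_def if_distrib if_distribR cong: if_cong)

lemma jmul_V: "x \<in> V \<Longrightarrow> y \<in> V \<Longrightarrow> jmul x y \<in> V"
  by (simp add: jmul_def Q_V)

lemma jmul_comm: "x \<in> V \<Longrightarrow> y \<in> V \<Longrightarrow> jmul x y = jmul y x"
  by (metis Q_e Q_comm)

lemma jmul_adj: "x \<in> V \<Longrightarrow> y \<in> V \<Longrightarrow> w \<in> V \<Longrightarrow> jmul x y \<bullet> w = y \<bullet> jmul x w"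
  by (simp add: jmul_def Q_adj)

lemma jmul_e [simp]: "x \<in> V \<Longrightarrow> jmul e x = x"
  by (simp add: jmul_def Q_unit)

lemma jmul_dg: "jmul (dg a) (dg b) = dg (\<lambda>i. a i * b i)"
  by (simp add: jmul_def e_def Q_dg)

lemma D_e: "D a e = dg (\<lambda>i. (a i)\<^sup>2)"
  by (simp add: D_def e_def Q_dg power2_eq_square)

lemma D_1: "x \<in> V \<Longrightarrow> D (\<lambda>_. 1) x = x"
  using Q_unit[of x] by (simp add: D_def e_def)

lemma D_V: "x \<in> V \<Longrightarrow> D a x \<in> V" by (simp add: D_def Q_V)

lemma D_linear: "linear (D a)" by (simp add: D_def Q_lin3)

lemma D_adj: "x \<in> V \<Longrightarrow> y \<in> V \<Longrightarrow> D a x \<bullet> y = x \<bullet> D a y"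
  by (simp add: D_def Q_adj)

lemma D_inverse:
  assumes "\<And>i. a i \<noteq> 0" "x \<in> V"
  shows "D (\<lambda>i. inverse (a i)) (D a x) = x" "D a (D (\<lambda>i. inverse (a i)) x) = x"
  using assms by (simp_all add: D_mult D_1)

lemma K_jmul: "k \<in> K \<Longrightarrow> x \<in> V \<Longrightarrow> y \<in> V \<Longrightarrow> jmul (k x) (k y) = k (jmul x y)"
  unfolding jmul_def using K_Q[of k e x y] K_e[of k] by simp

section \<open>The symmetric cone: invariance, openness, convexity\<close>

lemma U_V: "x \<in> U \<Longrightarrow> x \<in> V" by (simp add: U_def)

text \<open>The cone is described by the product and the inner product alone, and \<open>K\<close>
  respects both. The two directions come from \<open>k\<close> and from its inverse.\<close>

lemma K_U:
  assumes "k \<in> K" "x \<in> V" shows "k x \<in> U \<longleftrightarrow> x \<in> U"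
proof -
  have main: "k x \<in> U" if k: "k \<in> K" and x: "x \<in> U" for k x
  proof -
    obtain k' where k': "k' \<in> K" "\<forall>x\<in>V. k' (k x) = x \<and> k (k' x) = x"
      using K_inv[OF k] by blast
    show ?thesis unfolding U_def
    proof (safe)
      show "k x \<in> V" using k x K_V U_V by blast
      fix y assume y: "y \<in> V" "y \<noteq> 0"
      define z where "z = k' y"
      have z: "z \<in> V" "y = k z" using y k' K_V by (auto simp: z_def)
      have "z \<noteq> 0" using y z linear_0[OF K_linear[OF k]] by auto
      then show "jmul (k x) y \<bullet> y > 0"
        using z k x by (simp add: K_jmul U_V K_inner jmul_V) (simp add: U_def)
    qed
  qed
  obtain k' where k': "k' \<in> K" "\<forall>x\<in>V. k' (k x) = x \<and> k (k' x) = x"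
    using K_inv[OF assms(1)] by blast
  then show ?thesis using main[OF assms(1)] main[OF k'(1)] assms(2) by metis
qed

lemma dg_U: "dg a \<in> U \<longleftrightarrow> (\<forall>i. a i > 0)"
proof
  assume U: "dg a \<in> U"
  show "\<forall>i. a i > 0"
  proof
    fix i
    have "c i \<noteq> 0" using c_inner[of i i] by auto
    then have "jmul (dg a) (c i) \<bullet> c i > 0" using U c_V by (auto simp: U_def)
    moreover have "jmul (dg a) (c i) \<bullet> c i = a i"
      unfolding dg_c[of i] by (simp add: jmul_dg dg_inner if_distrib cong: if_cong)
    ultimately show "a i > 0" by simp
  qed
next
  assume "\<forall>i. a i > 0" then show "dg a \<in> U" using dg_pos by (auto simp: U_def)
qed

lemma spectral_U:
  assumes "x \<in> U" obtains k a where "k \<in> K" "\<And>i. a i > 0" "x = k (dg a)"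
  using assms spectral[OF U_V[OF assms]] K_U[of _ "dg _"] dg_U dg_V by metis

lemma T_U: "T \<subseteq> U" by (auto simp: T_def dg_U)

lemma e_U: "e \<in> U" by (simp add: e_def dg_U)

text \<open>Quantitative positivity, the source of openness. Half of the least eigenvalue is
  subtracted, so that all eigenvalues stay strictly positive and \<open>x - m e\<close> is still in
  the cone.\<close>

lemma U_lower:
  assumes "x \<in> U" obtains m where "m > 0" "\<And>y. y \<in> V \<Longrightarrow> jmul x y \<bullet> y \<ge> m * (y \<bullet> y)"
proof -
  obtain k a where ka: "k \<in> K" "\<And>i. a i > 0" "x = k (dg a)" using spectral_U[OF assms] by blast
  define m where "m = Min (range a) / 2"
  have "Min (range a) \<in> range a" by (intro Min_in) auto
  then have m: "m > 0" using ka(2) by (auto simp: m_def)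
  have ma: "a i - m > 0" for i
  proof -
    have "Min (range a) \<le> a i" by (intro Min_le) auto
    then show ?thesis using ka(2)[of i] unfolding m_def by linarith
  qed
  have "x - m *\<^sub>R e = k (dg (\<lambda>i. a i - m))"
    using linear_diff[OF K_linear[OF ka(1)]] linear_scale[OF K_linear[OF ka(1)]] ka K_e
    by (metis (no_types, lifting) dg_diff dg_scale e_def ext mult.right_neutral)
  then have U: "x - m *\<^sub>R e \<in> U" using K_U[OF ka(1)] dg_U ma by simp
  have "jmul x y \<bullet> y \<ge> m * (y \<bullet> y)" if y: "y \<in> V" for y
  proof (cases "y = 0")
    case False
    then have "jmul (x - m *\<^sub>R e) y \<bullet> y > 0" using U y by (simp add: U_def)
    then show ?thesis using y
      by (simp add: jmul_def Q_linear inner_diff_left Q_unit)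
  qed (simp add: jmul_def Q_linear)
  then show ?thesis using that m by blast
qed

text \<open>A perturbation of norm below \<open>m / C\<close> changes the quadratic form at
  \<open>y\<close> by less than \<open>m (y . y)\<close>, which is the margin supplied by
  \<open>U_lower\<close>.\<close>

lemma U_openin: "openin (top_of_set V) U"
proof (unfold openin_euclidean_subtopology_iff, intro conjI ballI)
  show "U \<subseteq> V" using U_V by blast
  fix x assume x: "x \<in> U"
  obtain m where m: "m > 0" "\<And>y. y \<in> V \<Longrightarrow> jmul x y \<bullet> y \<ge> m * (y \<bullet> y)" using U_lower[OF x] by blast
  obtain B where B: "B > 0" "\<And>x y z. norm (Q x y z) \<le> B * norm x * norm y * norm z"
    using Q_bound by blast
  define C where "C = B * norm e"
  have ne: "norm e > 0" using e_U x jmul_e[of e] Q_zero(1) c_inner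
    by (metis dg_inner_c(1) e_def inner_zero_left zero_less_norm_iff zero_neq_one)
  then have C: "C > 0" using B by (simp add: C_def)
  have "x' \<in> U" if x': "x' \<in> V" "dist x' x < m / C" for x'
    unfolding U_def
  proof (safe)
    fix y assume y: "y \<in> V" "y \<noteq> 0"
    have "\<bar>jmul (x' - x) y \<bullet> y\<bar> \<le> norm (jmul (x' - x) y) * norm y" by (rule Cauchy_Schwarz_ineq2)
    also have "\<dots> \<le> (C * norm (x' - x) * norm y) * norm y"
      unfolding jmul_def C_def by (intro mult_right_mono B) auto
    also have "\<dots> < m * norm y * norm y"
      using x'(2) y C by (simp add: dist_norm field_simps)
    finally have "\<bar>jmul (x' - x) y \<bullet> y\<bar> < m * (y \<bullet> y)"
      by (simp add: power2_norm_eq_inner[symmetric] power2_eq_square mult.assoc)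
    moreover have "jmul x' y \<bullet> y = jmul x y \<bullet> y + jmul (x' - x) y \<bullet> y"
      by (simp add: jmul_def Q_linear inner_diff_left)
    ultimately show "0 < jmul x' y \<bullet> y" using m(2)[OF y(1)] by linarith
  qed (use x' in auto)
  then show "\<exists>ea>0. \<forall>x'\<in>V. dist x' x < ea \<longrightarrow> x' \<in> U" using m C by (intro exI[of _ "m / C"]) auto
qed

lemma U_convex: "convex U"
proof (rule convexI)
  fix x y :: 'a and u v :: real
  assume A: "x \<in> U" "y \<in> U" "0 \<le> u" "0 \<le> v" "u + v = 1"
  show "u *\<^sub>R x + v *\<^sub>R y \<in> U" unfolding U_def
  proof safe
    show "u *\<^sub>R x + v *\<^sub>R y \<in> V"
      using A U_V subspace_V by (intro subspace_add subspace_scale) auto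
    fix z assume z: "z \<in> V" "z \<noteq> 0"
    have p: "jmul x z \<bullet> z > 0" "jmul y z \<bullet> z > 0" using A z by (auto simp: U_def)
    have "jmul (u *\<^sub>R x + v *\<^sub>R y) z \<bullet> z = u * (jmul x z \<bullet> z) + v * (jmul y z \<bullet> z)"
      by (simp add: jmul_def Q_linear inner_add_left)
    also have "\<dots> > 0" using A p
      by (metis add_cancel_right_left add_nonneg_pos add_pos_nonneg dual_order.order_iff_strict less_numeral_extra(1) mult_nonneg_nonneg mult_pos_pos)
    finally show "jmul (u *\<^sub>R x + v *\<^sub>R y) z \<bullet> z > 0" .
  qed
qed

text \<open>In a frame that diagonalizes \<open>x\<close>, the map P(x) is a scaling
  \<open>D a\<close> with reciprocal \<open>D (1/a)\<close>. This makes the Jordan inverse unique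
  and later separates the cone from its boundary.\<close>

lemma Q_diag_inj:
  assumes "x \<in> U" "y \<in> V" "Q x x y = 0" shows "y = 0"
proof -
  obtain k a where ka: "k \<in> K" "\<And>i. a i > 0" "x = k (dg a)" using spectral_U[OF assms(1)] by blast
  obtain k' where k': "k' \<in> K" "\<forall>x\<in>V. k' (k x) = x \<and> k (k' x) = x"
    using K_inv[OF ka(1)] by blast
  have k'y: "k' y \<in> V" "y = k (k' y)" using k' assms K_V by auto
  have "Q x x y = k (D a (k' y))" using k'y ka K_Q[OF ka(1), of "dg a" "dg a" "k' y"] by (simp add: D_def)
  then have "D a (k' y) = 0"
    using assms(3) k' D_V[OF k'y(1)] linear_0[OF K_linear[OF k'(1)]] by metis
  then have "k' y = 0" using D_inverse(1)[of a "k' y"] ka(2) k'y linear_0[OF D_linear]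
    by (metis less_irrefl)
  then show ?thesis using k'y linear_0[OF K_linear[OF ka(1)]] by simp
qed

text \<open>Moving \<open>a\<close> to \<open>1\<close> along a path, the image of \<open>x\<close> cannot leave \<open>U\<close>: on the boundary
  the quadratic representation is singular, but along the path it stays injective.\<close>

lemma D_U:
  assumes x: "x \<in> U" and a: "\<And>i. a i > 0" shows "D a x \<in> U"
proof -
  define p where "p s = D (\<lambda>i. a i powr s) x" for s
  have xV: "x \<in> V" using x U_V by blast
  have pV: "p s \<in> V" for s using xV by (simp add: p_def D_V)
  \<comment> \<open>By \<open>Q_D\<close>, P(p s) is the composite of \<open>D ?b\<close>, P(x) and
    \<open>D ?b\<close>, and all three factors are injective.\<close>
  have inj: "y = 0" if "y \<in> V" "Q (p s) (p s) y = 0" for s y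
  proof -
    let ?b = "\<lambda>i. a i powr s"
    have b: "?b i \<noteq> 0" for i using a[of i] by simp
    have "D ?b (Q x x (D ?b y)) = 0" using that xV Q_D[of x x y ?b] by (simp add: p_def)
    then have "Q x x (D ?b y) = 0"
      using D_inverse(1)[of ?b "Q x x (D ?b y)"] b xV that by (simp add: D_V Q_V linear_0[OF D_linear])
    then have "D ?b y = 0" using Q_diag_inj[OF x] that D_V by blast
    then show ?thesis using D_inverse(1)[of ?b y] b that by (simp add: linear_0[OF D_linear])
  qed
  have contdg: "continuous_on A (\<lambda>s. dg (\<lambda>i. a i powr s))" for A
    unfolding dg_def by (intro continuous_intros) (use a in \<open>simp add: less_imp_neq[symmetric]\<close>)
  have cont: "continuous_on A p" for A
    unfolding p_def D_def
    by (rule bounded_bilinear.continuous_on[OF bounded_bilinear_Q12]) (intro contdg)+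
  have closed_step: "p s \<in> U" if lim: "\<And>\<epsilon>. \<epsilon> > 0 \<Longrightarrow> \<exists>t. \<bar>t - s\<bar> < \<epsilon> \<and> p t \<in> U" for s
  proof -
    have nonneg: "jmul (p s) y \<bullet> y \<ge> 0" if y: "y \<in> V" for y
    proof (rule ccontr)
      assume neg: "\<not> ?thesis"
      have "continuous_on UNIV (\<lambda>t. jmul (p t) y \<bullet> y)"
        unfolding jmul_def
        by (intro continuous_intros bounded_linear.continuous_on[OF linear_conv_bounded_linear[THEN iffD1, OF Q_lin2]] cont)
      then have "isCont (\<lambda>t. jmul (p t) y \<bullet> y) s" by (simp add: continuous_on_eq_continuous_at)
      then obtain d where d: "d > 0" "\<And>t. \<bar>t - s\<bar> < d \<Longrightarrow> \<bar>jmul (p t) y \<bullet> y - jmul (p s) y \<bullet> y\<bar> < - (jmul (p s) y \<bullet> y)"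
        using neg unfolding continuous_at_eps_delta dist_real_def by (metis neg_0_less_iff_less not_le)
      obtain t where t: "\<bar>t - s\<bar> < d" "p t \<in> U" using lim[OF d(1)] by blast
      have "jmul (p t) y \<bullet> y < 0" using d(2)[OF t(1)] by linarith
      moreover have "jmul (p t) y \<bullet> y \<ge> 0"
        using t(2) y by (cases "y = 0") (auto simp: U_def less_imp_le)
      ultimately show False by linarith
    qed
    obtain k b where kb: "k \<in> K" "p s = k (dg b)" using spectral[OF pV] by blast
    have "b i > 0" for i
    proof -
      have ck: "k (c i) \<in> V" using kb c_V K_V by blast
      have "k (c i) \<bullet> k (c i) = 1" using kb by (simp add: K_inner c_V c_inner)
      then have nz: "k (c i) \<noteq> 0" by auto
      have "jmul (p s) (k (c i)) \<bullet> k (c i) = b i"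
        unfolding kb dg_c[of i] using kb
        by (simp add: K_jmul K_inner jmul_V jmul_dg dg_inner if_distrib cong: if_cong)
      then have "b i \<ge> 0" using nonneg[OF ck] by simp
      \<comment> \<open>Otherwise P(p s) annihilates the nonzero vector \<open>k (c i)\<close>,
        against injectivity along the path.\<close>
      moreover have "b i \<noteq> 0"
      proof
        assume "b i = 0"
        then have "(\<lambda>j. b j * b j * (if j = i then 1 else 0)) = (\<lambda>_. 0)" by auto
        then have "Q (p s) (p s) (k (c i)) = k (dg (\<lambda>_. 0))"
          unfolding kb dg_c[of i] using kb by (simp add: K_Q Q_dg)
        then have "Q (p s) (p s) (k (c i)) = 0"
          using linear_0[OF K_linear[OF kb(1)]] by (simp add: dg_def)
        then show False using inj ck nz by blast
      qed
      ultimately show ?thesis by simp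
    qed
    then show ?thesis using kb K_U[OF kb(1)] dg_U by simp
  qed
  define S where "S = {s. p s \<in> U}"
  have "open S"
  proof -
    obtain O' where O': "open O'" "U = V \<inter> O'" using U_openin by (auto simp: openin_open)
    have "S = p -` O'" using pV by (auto simp: S_def O')
    then show ?thesis using O'(1) cont[of UNIV] continuous_on_open_vimage[of UNIV p] by auto
  qed
  moreover have "closed S"
  proof (subst closure_subset_eq[symmetric], safe)
    fix s assume "s \<in> closure S"
    then have lim: "\<forall>\<epsilon>>0. \<exists>t\<in>S. dist t s < \<epsilon>" by (simp add: closure_approachable)
    show "s \<in> S" unfolding S_def mem_Collect_eq
      by (rule closed_step) (use lim in \<open>auto simp: S_def dist_real_def\<close>)
  qed
  ultimately have "S = {} \<or> S = UNIV" using clopen by blast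
  moreover have "0 \<in> S" using x a by (auto simp: S_def p_def D_1 U_V less_imp_neq[symmetric])
  ultimately have "1 \<in> S" by auto
  then show ?thesis using a by (simp add: S_def p_def less_imp_le)
qed

end

section \<open>Smooth functions and the inverse map of the cone\<close>

text \<open>A relational companion of \<open>dir_deriv\<close>: it also asserts that the derivative
  exists, so the rules of calculus can be composed before any value is read off.\<close>

definition has_dir_deriv :: "('e::real_normed_vector \<Rightarrow> 'f::real_normed_vector) \<Rightarrow> 'f \<Rightarrow> 'e \<Rightarrow> 'e \<Rightarrow> bool" where
  "has_dir_deriv f d v x \<longleftrightarrow> ((\<lambda>t. f (x + t *\<^sub>R v)) has_vector_derivative d) (at 0)"

lemma dir_deriv_eq: "has_dir_deriv f d v x \<Longrightarrow> dir_deriv f v x = d"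
  by (simp add: has_dir_deriv_def dir_deriv_def vector_derivative_at)

lemma has_dir_deriv_differentiable:
  "has_dir_deriv f d v x \<Longrightarrow> (\<lambda>t::real. f (x + t *\<^sub>R v)) differentiable (at 0)"
  unfolding has_dir_deriv_def by (rule differentiableI_vector)

lemma differentiable_has_dir_deriv:
  "(\<lambda>t::real. f (x + t *\<^sub>R v)) differentiable (at 0) \<Longrightarrow> has_dir_deriv f (dir_deriv f v x) v x"
  unfolding has_dir_deriv_def dir_deriv_def by (simp flip: vector_derivative_works)

lemma has_dir_deriv_const: "has_dir_deriv (\<lambda>x. a) 0 v x"
  by (simp add: has_dir_deriv_def)

lemma has_dir_deriv_id: "has_dir_deriv (\<lambda>x. x) v v x"
  unfolding has_dir_deriv_def by (auto intro!: derivative_eq_intros)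

lemma has_dir_deriv_add:
  "has_dir_deriv f a v x \<Longrightarrow> has_dir_deriv g b v x \<Longrightarrow> has_dir_deriv (\<lambda>x. f x + g x) (a + b) v x"
  unfolding has_dir_deriv_def by (rule has_vector_derivative_add)

lemma has_dir_deriv_bounded_linear:
  "bounded_linear L \<Longrightarrow> has_dir_deriv f a v x \<Longrightarrow> has_dir_deriv (\<lambda>x. L (f x)) (L a) v x"
  unfolding has_dir_deriv_def by (rule bounded_linear.has_vector_derivative)

lemma has_dir_deriv_bilinear:
  assumes "bounded_bilinear B" "has_dir_deriv f a v x" "has_dir_deriv g b v x"
  shows "has_dir_deriv (\<lambda>x. B (f x) (g x)) (B a (g x) + B (f x) b) v x"
  using bounded_bilinear.has_vector_derivative[OF assms(1), of "\<lambda>t. f (x + t *\<^sub>R v)" a 0 UNIV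
      "\<lambda>t. g (x + t *\<^sub>R v)" b] assms(2,3)
  by (simp add: has_dir_deriv_def add.commute)

lemma has_dir_deriv_sum:
  "finite I \<Longrightarrow> (\<And>i. i \<in> I \<Longrightarrow> has_dir_deriv (f i) (d i) v x) \<Longrightarrow>
   has_dir_deriv (\<lambda>x. \<Sum>i\<in>I. f i x) (\<Sum>i\<in>I. d i) v x"
  by (induction I rule: finite_induct) (auto intro: has_dir_deriv_const has_dir_deriv_add)

locale open_subset =
  fixes V U :: "'e::euclidean_space set"
  assumes subsp: "subspace V" and openin: "openin (top_of_set V) U"
begin

text \<open>\<open>U\<close> is open only relative to \<open>V\<close>, but along a direction in
  \<open>V\<close> the admissible parameters form an open set of reals. Derivatives at 0 are
  therefore local, and functions need to agree on \<open>U\<close> only.\<close>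

lemma line_open:
  assumes "x \<in> U" "v \<in> V"
  shows "open {t. x + t *\<^sub>R v \<in> U}"
proof -
  obtain O' where O': "open O'" "U = V \<inter> O'" using openin by (auto simp: openin_open)
  have "{t. x + t *\<^sub>R v \<in> U} = (\<lambda>t. x + t *\<^sub>R v) -` O'"
    using assms subsp by (auto simp: O' subspace_add subspace_scale)
  moreover have "continuous_on UNIV (\<lambda>t. x + t *\<^sub>R v)" by (intro continuous_intros)
  ultimately show ?thesis using O'(1) continuous_on_open_vimage[of UNIV] by auto
qed

lemma has_dir_deriv_cong:
  assumes "\<And>y. y \<in> U \<Longrightarrow> f y = g y" "x \<in> U" "v \<in> V" "has_dir_deriv f d v x"
  shows "has_dir_deriv g d v x"
  using assms(4) unfolding has_dir_deriv_def
  by (rule has_vector_derivative_transform_within_open[OF _ line_open[OF assms(2,3)]])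
    (use assms in auto)

lemma dir_deriv_cong:
  assumes "\<And>y. y \<in> U \<Longrightarrow> f y = g y" "x \<in> U" "v \<in> V"
  shows "dir_deriv f v x = dir_deriv g v x"
proof -
  have "has_dir_deriv f d v x = has_dir_deriv g d v x" for d
    using has_dir_deriv_cong[of f g x v d] has_dir_deriv_cong[of g f x v d] assms by auto
  then show ?thesis unfolding dir_deriv_def vector_derivative_def has_dir_deriv_def by simp
qed

text \<open>Bridge from a derivative relative to \<open>U\<close> to a two-sided derivative along a
  line, by the chain rule on the open parameter set.\<close>

lemma has_dir_derivI:
  assumes "(f has_derivative f') (at x within U)" "x \<in> U" "v \<in> V"
  shows "has_dir_deriv f (f' v) v x"
proof -
  let ?S = "{t. x + t *\<^sub>R v \<in> U}"
  have "((\<lambda>t. x + t *\<^sub>R v) has_vector_derivative v) (at 0 within ?S)"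
    by (auto intro!: derivative_eq_intros)
  moreover have "(f has_derivative f') (at (x + 0 *\<^sub>R v) within (\<lambda>t. x + t *\<^sub>R v) ` ?S)"
    using has_derivative_subset[OF assms(1), of "(\<lambda>t. x + t *\<^sub>R v) ` ?S"] by auto
  ultimately have "((f \<circ> (\<lambda>t. x + t *\<^sub>R v)) has_vector_derivative f' v) (at 0 within ?S)"
    by (rule vector_derivative_diff_chain_within)
  then show ?thesis unfolding has_dir_deriv_def
    using at_within_open[OF _ line_open[OF assms(2,3)], of 0] assms(2) by (simp add: o_def)
qed

lemma C_k_cong:
  assumes "\<And>y. y \<in> U \<Longrightarrow> f y = g y"
  shows "C_k k V U f = C_k k V U g"
  using assms
proof (induction k arbitrary: f g)
  case 0 then show ?case by (simp cong: continuous_on_cong)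
next
  case (Suc k)
  have "continuous_on U f = continuous_on U g" using Suc.prems by (simp cong: continuous_on_cong)
  moreover have "C_k k V U (dir_deriv f v) = C_k k V U (dir_deriv g v)" if "v \<in> V" for v
    using Suc.IH[of "dir_deriv f v" "dir_deriv g v"] dir_deriv_cong[of f g _ v] Suc.prems that by auto
  moreover have "(\<lambda>t::real. f (x + t *\<^sub>R v)) differentiable (at 0) \<longleftrightarrow> (\<lambda>t::real. g (x + t *\<^sub>R v)) differentiable (at 0)"
    if "v \<in> V" "x \<in> U" for v x
    using has_dir_deriv_cong[of f g x v] has_dir_deriv_cong[of g f x v] Suc.prems that
      has_dir_deriv_differentiable differentiable_has_dir_deriv by metis
  ultimately show ?case by simp
qed

text \<open>The derivative is supplied as an explicit function \<open>f'\<close>, so inductions on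
  \<open>k\<close> can work with closed formulas in place of \<open>dir_deriv\<close>.\<close>

lemma C_k_SucI:
  assumes "continuous_on U f"
    and "\<And>v x. v \<in> V \<Longrightarrow> x \<in> U \<Longrightarrow> has_dir_deriv f (f' v x) v x"
    and "\<And>v. v \<in> V \<Longrightarrow> C_k k V U (f' v)"
  shows "C_k (Suc k) V U f"
proof -
  have "C_k k V U (dir_deriv f v)" if "v \<in> V" for v
    using C_k_cong[of "dir_deriv f v" "f' v"] dir_deriv_eq[OF assms(2)] assms(3) that by blast
  then show ?thesis using assms by (auto intro: has_dir_deriv_differentiable)
qed

lemma C_k_mono: "C_k (Suc k) V U f \<Longrightarrow> C_k k V U f"
proof (induction k arbitrary: f)
  case (Suc k)
  then have "\<forall>v\<in>V. C_k k V U (dir_deriv f v)" by auto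
  then show ?case using Suc.prems by auto
qed auto

lemma C_k_const: "C_k k V U (\<lambda>x. a)"
proof (induction k arbitrary: a)
  case (Suc k) then show ?case by (intro C_k_SucI[where f'="\<lambda>_ _. 0"]) (auto simp: has_dir_deriv_const)
qed auto

lemma C_k_id: "C_k k V U (\<lambda>x. x)"
proof (cases k)
  case (Suc j) then show ?thesis unfolding Suc
    by (intro C_k_SucI[where f'="\<lambda>v _. v"]) (auto intro: has_dir_deriv_id C_k_const)
qed auto

lemma C_k_add: "C_k k V U f \<Longrightarrow> C_k k V U g \<Longrightarrow> C_k k V U (\<lambda>x. f x + g x)"
proof (induction k arbitrary: f g)
  case (Suc k)
  then show ?case
    by (intro C_k_SucI[where f'="\<lambda>v x. dir_deriv f v x + dir_deriv g v x"])
      (auto intro!: continuous_intros has_dir_deriv_add differentiable_has_dir_deriv)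
qed (auto intro!: continuous_intros)

lemma C_k_bilinear:
  assumes "bounded_bilinear B"
  shows "C_k k V U f \<Longrightarrow> C_k k V U g \<Longrightarrow> C_k k V U (\<lambda>x. B (f x) (g x))"
proof (induction k arbitrary: f g)
  case 0 then show ?case by (auto intro!: bounded_bilinear.continuous_on[OF assms])
next
  case (Suc k)
  have "C_k k V U f" "C_k k V U g" using Suc.prems C_k_mono by blast+
  then show ?case using Suc.prems
    by (intro C_k_SucI[where f'="\<lambda>v x. B (dir_deriv f v x) (g x) + B (f x) (dir_deriv g v x)"])
      (auto intro!: bounded_bilinear.continuous_on[OF assms] C_k_add Suc.IH
        has_dir_deriv_bilinear[OF assms] differentiable_has_dir_deriv)
qed

lemma C_k_linear:
  assumes "bounded_linear L"
  shows "C_k k V U f \<Longrightarrow> C_k k V U (\<lambda>x. L (f x))"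
proof (induction k arbitrary: f)
  case 0 then show ?case by (auto intro!: bounded_linear.continuous_on[OF assms])
next
  case (Suc k)
  then show ?case
    by (intro C_k_SucI[where f'="\<lambda>v x. L (dir_deriv f v x)"])
      (auto intro!: bounded_linear.continuous_on[OF assms]
        has_dir_deriv_bounded_linear[OF assms] differentiable_has_dir_deriv)
qed

lemma smooth_const: "smooth V U (\<lambda>x. a)" by (simp add: smooth_def C_k_const)
lemma smooth_id: "smooth V U (\<lambda>x. x)" by (simp add: smooth_def C_k_id)
lemma smooth_add: "smooth V U f \<Longrightarrow> smooth V U g \<Longrightarrow> smooth V U (\<lambda>x. f x + g x)"
  by (simp add: smooth_def C_k_add)
lemma smooth_linear: "bounded_linear L \<Longrightarrow> smooth V U f \<Longrightarrow> smooth V U (\<lambda>x. L (f x))"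
  by (simp add: smooth_def C_k_linear)
lemma smooth_bilinear: "bounded_bilinear B \<Longrightarrow> smooth V U f \<Longrightarrow> smooth V U g \<Longrightarrow> smooth V U (\<lambda>x. B (f x) (g x))"
  by (simp add: smooth_def C_k_bilinear)
lemma smooth_cong: "(\<And>y. y \<in> U \<Longrightarrow> f y = g y) \<Longrightarrow> smooth V U f = smooth V U g"
  using C_k_cong[of f g] by (simp add: smooth_def)
lemma smooth_sum: "finite I \<Longrightarrow> (\<And>i. i \<in> I \<Longrightarrow> smooth V U (f i)) \<Longrightarrow> smooth V U (\<lambda>x. \<Sum>i\<in>I. f i x)"
  by (induction I rule: finite_induct) (auto intro: smooth_const smooth_add)
lemma smooth_mult: "smooth V U f \<Longrightarrow> smooth V U g \<Longrightarrow> smooth V U (\<lambda>x. f x * (g x :: real))"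
  by (rule smooth_bilinear[OF bounded_bilinear_mult])
lemma smooth_scaleR: "smooth V U f \<Longrightarrow> smooth V U g \<Longrightarrow> smooth V U (\<lambda>x. f x *\<^sub>R g x)"
  by (rule smooth_bilinear[OF bounded_bilinear_scaleR])
lemma smooth_inner: "smooth V U f \<Longrightarrow> smooth V U g \<Longrightarrow> smooth V U (\<lambda>x. f x \<bullet> g x)"
  by (rule smooth_bilinear[OF bounded_bilinear_inner])
lemma smooth_minus: "smooth V U f \<Longrightarrow> smooth V U (\<lambda>x. - f x)"
  by (rule smooth_linear[OF bounded_linear_minus[OF bounded_linear_ident]])
lemma smooth_diff: "smooth V U f \<Longrightarrow> smooth V U g \<Longrightarrow> smooth V U (\<lambda>x. f x - g x)"
  using smooth_add[OF _ smooth_minus, of f g] by simp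

lemma smooth_has_dir_deriv:
  "smooth V U f \<Longrightarrow> x \<in> U \<Longrightarrow> v \<in> V \<Longrightarrow> has_dir_deriv f (dir_deriv f v x) v x"
  unfolding smooth_def using differentiable_has_dir_deriv C_k.simps(2)[of 0 V U f] by blast

end

lemma C_k_subset:
  "C_k k V U f \<Longrightarrow> V' \<subseteq> V \<Longrightarrow> U' \<subseteq> U \<Longrightarrow> C_k k V' U' f"
proof (induction k arbitrary: f)
  case 0 then show ?case by (auto intro: continuous_on_subset)
next
  case (Suc k)
  have "C_k k V' U' (dir_deriv f v)" if "v \<in> V'" for v using Suc that by auto
  then show ?case using Suc.prems by (auto intro: continuous_on_subset simp del: C_k.simps(1)) blast+
qed

lemma smooth_subset: "smooth V U f \<Longrightarrow> V' \<subseteq> V \<Longrightarrow> U' \<subseteq> U \<Longrightarrow> smooth V' U' f"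
  unfolding smooth_def using C_k_subset[of _ V U f V' U'] by blast

section \<open>The Jordan inverse and the structure group\<close>

context jordan_frame
begin

sublocale open_subset V U
  by unfold_locales (rule subspace_V U_openin)+

text \<open>The single equation P(x) y = x suffices as a definition because P(x) is injective on the
  cone; over associative scalars it reads x y x = x.\<close>

definition jinv :: "'a \<Rightarrow> 'a" where "jinv x = (THE y. y \<in> V \<and> Q x x y = x)"

lemma jinv_eq: assumes "x \<in> U" "y \<in> V" "Q x x y = x" shows "jinv x = y"
  unfolding jinv_def
proof (rule the_equality)
  show "y \<in> V \<and> Q x x y = x" using assms by simp
  fix z assume z: "z \<in> V \<and> Q x x z = x"
  have "Q x x (z - y) = 0" using assms z by (simp add: Q_linear)
  then show "z = y" using Q_diag_inj[OF assms(1), of "z - y"] z assms(2) subspace_diff[OF subspace_V] by auto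
qed

text \<open>\<open>m\<close> is an element of the structure group preserving the cone, \<open>n\<close> is its inverse transpose,
  \<open>m'\<close> and \<open>n'\<close> are the inverses of the two.\<close>

definition str_pair :: "('a \<Rightarrow> 'a) \<Rightarrow> ('a \<Rightarrow> 'a) \<Rightarrow> ('a \<Rightarrow> 'a) \<Rightarrow> ('a \<Rightarrow> 'a) \<Rightarrow> bool" where
  "str_pair m n m' n' \<longleftrightarrow> linear m \<and> linear n \<and> linear m' \<and> linear n' \<and>
    (\<forall>x\<in>V. m x \<in> V \<and> n x \<in> V \<and> m' x \<in> V \<and> n' x \<in> V) \<and>
    (\<forall>x\<in>V. m' (m x) = x \<and> m (m' x) = x \<and> n' (n x) = x \<and> n (n' x) = x) \<and>
    (\<forall>x\<in>V. \<forall>y\<in>V. m x \<bullet> n y = x \<bullet> y) \<and>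
    (\<forall>x\<in>V. \<forall>y\<in>V. \<forall>z\<in>V. Q (m x) (m y) (n z) = m (Q x y z)) \<and>
    (\<forall>x\<in>V. \<forall>y\<in>V. \<forall>z\<in>V. Q (n x) (n y) (m z) = n (Q x y z)) \<and>
    (\<forall>x\<in>V. (m x \<in> U \<longleftrightarrow> x \<in> U) \<and> (n x \<in> U \<longleftrightarrow> x \<in> U))"

lemma str_pairD:
  assumes "str_pair m n m' n'"
  shows "linear m" "linear n" "linear m'" "linear n'"
    "\<And>x. x \<in> V \<Longrightarrow> m x \<in> V" "\<And>x. x \<in> V \<Longrightarrow> n x \<in> V" "\<And>x. x \<in> V \<Longrightarrow> m' x \<in> V" "\<And>x. x \<in> V \<Longrightarrow> n' x \<in> V"
    "\<And>x. x \<in> V \<Longrightarrow> m' (m x) = x" "\<And>x. x \<in> V \<Longrightarrow> m (m' x) = x"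
    "\<And>x. x \<in> V \<Longrightarrow> n' (n x) = x" "\<And>x. x \<in> V \<Longrightarrow> n (n' x) = x"
    "\<And>x y. x \<in> V \<Longrightarrow> y \<in> V \<Longrightarrow> m x \<bullet> n y = x \<bullet> y"
    "\<And>x y z. x \<in> V \<Longrightarrow> y \<in> V \<Longrightarrow> z \<in> V \<Longrightarrow> Q (m x) (m y) (n z) = m (Q x y z)"
    "\<And>x y z. x \<in> V \<Longrightarrow> y \<in> V \<Longrightarrow> z \<in> V \<Longrightarrow> Q (n x) (n y) (m z) = n (Q x y z)"
    "\<And>x. x \<in> V \<Longrightarrow> m x \<in> U \<longleftrightarrow> x \<in> U" "\<And>x. x \<in> V \<Longrightarrow> n x \<in> U \<longleftrightarrow> x \<in> U"
  using assms unfolding str_pair_def by simp_all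

lemma str_pair_inverse: assumes "str_pair m n m' n'" shows "str_pair m' n' m n"
proof -
  note A = str_pairD[OF assms]
  have 1: "m' x \<bullet> n' y = x \<bullet> y" if "x \<in> V" "y \<in> V" for x y
    using A(13)[of "m' x" "n' y"] that A by simp
  have 2: "Q (m' x) (m' y) (n' z) = m' (Q x y z)" if "x \<in> V" "y \<in> V" "z \<in> V" for x y z
    using A(14)[of "m' x" "m' y" "n' z"] A(9)[of "Q (m' x) (m' y) (n' z)"] A that by (simp add: Q_V)
  have 3: "Q (n' x) (n' y) (m' z) = n' (Q x y z)" if "x \<in> V" "y \<in> V" "z \<in> V" for x y z
    using A(15)[of "n' x" "n' y" "m' z"] A(11)[of "Q (n' x) (n' y) (m' z)"] A that by (simp add: Q_V)
  have 4: "(m' x \<in> U \<longleftrightarrow> x \<in> U) \<and> (n' x \<in> U \<longleftrightarrow> x \<in> U)" if "x \<in> V" for x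
    using A(16)[of "m' x"] A(17)[of "n' x"] A that by simp
  show ?thesis unfolding str_pair_def using A 1 2 3 4 by simp
qed

lemma str_pair_comp:
  assumes "str_pair m1 n1 m1' n1'" "str_pair m2 n2 m2' n2'"
  shows "str_pair (\<lambda>x. m1 (m2 x)) (\<lambda>x. n1 (n2 x)) (\<lambda>x. m2' (m1' x)) (\<lambda>x. n2' (n1' x))"
proof -
  have "linear (\<lambda>x. m1 (m2 x))" "linear (\<lambda>x. n1 (n2 x))" "linear (\<lambda>x. m2' (m1' x))" "linear (\<lambda>x. n2' (n1' x))"
    using str_pairD(1-4)[OF assms(1)] str_pairD(1-4)[OF assms(2)] by (auto intro: linear_compose[unfolded o_def])
  then show ?thesis using assms unfolding str_pair_def by simp
qed

lemma str_pair_K: assumes "k \<in> K" "k' \<in> K" "\<And>x. x \<in> V \<Longrightarrow> k' (k x) = x \<and> k (k' x) = x"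
  shows "str_pair k k k' k'"
  unfolding str_pair_def
  using assms K_linear[of k] K_linear[of k'] K_V[of k] K_V[of k'] K_inner[of k] K_Q[of k] K_U[of k] by simp

text \<open>\<open>D a\<close> is self-adjoint, so its inverse transpose is its inverse, the scaling
  by reciprocals. Both preserve the cone by \<open>D_U\<close>, applied to \<open>a\<close> and to
  \<open>1/a\<close>.\<close>

lemma str_pair_D: assumes a: "\<And>i. a i > 0"
  shows "str_pair (D a) (D (\<lambda>i. inverse (a i))) (D (\<lambda>i. inverse (a i))) (D a)"
proof -
  let ?b = "\<lambda>i. inverse (a i)"
  have b: "?b i > 0" for i using a by simp
  have inv: "D ?b (D a x) = x" "D a (D ?b x) = x" if "x \<in> V" for x
    using D_inverse[of a x] a that by (auto simp: less_imp_neq[symmetric])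
  have "D a x \<in> U \<longleftrightarrow> x \<in> U" if "x \<in> V" for x
    using D_U[of x a] D_U[of "D a x" ?b] a b inv[OF that] by auto
  moreover have "D ?b x \<in> U \<longleftrightarrow> x \<in> U" if "x \<in> V" for x
    using D_U[of x ?b] D_U[of "D ?b x" a] a b inv[OF that] by auto
  moreover have "D a x \<bullet> D ?b y = x \<bullet> y" if "x \<in> V" "y \<in> V" for x y
    using that by (simp add: D_adj D_V inv)
  ultimately show ?thesis unfolding str_pair_def using inv by (simp add: D_linear D_V Q_D Q_V)
qed

lemma str_pair_jinv:
  assumes s: "str_pair m n m' n'" shows "jinv (m e) = n e"
proof (rule jinv_eq)
  show "m e \<in> U" "n e \<in> V" using str_pairD[OF s] e_U by auto
  show "Q (m e) (m e) (n e) = m e" using str_pairD[OF s] Q_unit[of e] by simp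
qed

text \<open>Transitivity: if \<open>x = k (dg a)\<close>, then \<open>k\<close> after the scaling by
  square roots sends \<open>e\<close> to \<open>x\<close>, because
  \<open>D b e = dg (b^2)\<close>.\<close>

lemma str_pair_U:
  assumes "x \<in> U" obtains m n m' n' where "str_pair m n m' n'" "m e = x" "n e = jinv x"
proof -
  obtain k a where ka: "k \<in> K" "\<And>i. a i > 0" "x = k (dg a)" using spectral_U[OF assms] by blast
  obtain k' where k': "k' \<in> K" "\<And>x. x \<in> V \<Longrightarrow> k' (k x) = x \<and> k (k' x) = x"
    using K_inv[OF ka(1)] by blast
  let ?b = "\<lambda>i. sqrt (a i)"
  have s: "str_pair (\<lambda>x. k (D ?b x)) (\<lambda>x. k (D (\<lambda>i. inverse (?b i)) x))
    (\<lambda>x. D (\<lambda>i. inverse (?b i)) (k' x)) (\<lambda>x. D ?b (k' x))"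
    by (rule str_pair_comp[OF str_pair_K[OF ka(1) k'] str_pair_D]) (simp_all add: ka(2))
  have "k (D ?b e) = x" using ka(2) by (simp add: D_e ka(3) less_imp_le)
  then show ?thesis using that[OF s] str_pair_jinv[OF s] by simp
qed

lemma jinv_V: "x \<in> U \<Longrightarrow> jinv x \<in> V"
  using str_pair_U[of x] str_pairD(6)[OF _ e_V] by metis

lemma Q_jinv: assumes "x \<in> U" shows "Q x x (jinv x) = x"
proof -
  obtain m n m' n' where s: "str_pair m n m' n'" "m e = x" "n e = jinv x" using str_pair_U[OF assms] by blast
  then show ?thesis using str_pairD(14)[OF s(1), of e e e] Q_unit[of e] by simp
qed

lemma jinv_str_pair: assumes s: "str_pair m n m' n'" and x: "x \<in> U" shows "jinv (m x) = n (jinv x)"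
proof -
  obtain p q p' q' where p: "str_pair p q p' q'" "p e = x" "q e = jinv x" using str_pair_U[OF x] by blast
  show ?thesis using str_pair_jinv[OF str_pair_comp[OF s p(1)]] p by simp
qed

lemma jinv_dg: assumes "\<And>i. a i > 0" shows "jinv (dg a) = dg (\<lambda>i. inverse (a i))"
proof (rule jinv_eq)
  show "Q (dg a) (dg a) (dg (\<lambda>i. inverse (a i))) = dg a"
  proof -
    have "a i * a i * inverse (a i) = a i" for i using assms[of i] by simp
    then show ?thesis by (simp only: Q_dg)
  qed
qed (use assms dg_U in auto)

lemma jinv_e: "jinv e = e" unfolding e_def by (simp add: jinv_dg)

text \<open>For \<open>x = e + h\<close> the error \<open>y = jinv x - (e - h)\<close> satisfies
  P(x) y = h^2 + P(h) h, which is quadratic in \<open>h\<close>. Since P(x) is close to the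
  identity, |y| is at most 2 |P(x) y|, so the linear approximation comes with an explicit error
  bound.\<close>

lemma jinv_derivative_e: "(jinv has_derivative (\<lambda>u. - u)) (at e within U)"
proof -
  obtain B where B: "B > 0" "\<And>x y z. norm (Q x y z) \<le> B * norm x * norm y * norm z"
    using Q_bound by blast
  define E where "E = B * norm e"
  have E: "E \<ge> 0" using B by (simp add: E_def)
  have jb: "norm (jmul x y) \<le> E * norm x * norm y" for x y
    using B(2)[of e x y] by (simp add: jmul_def E_def)
  \<comment> \<open>The bound 1 lets higher powers of |h| be absorbed in lower ones; the other bound
    keeps \<open>2 *\<^sub>R jmul h y + Q h h y\<close> below half of |y|.\<close>
  define \<delta> where "\<delta> = min 1 (1 / (2 * (2 * E + B)))"
  have EB: "2 * E + B > 0" using B E by simp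
  have \<delta>: "\<delta> > 0" using EB by (simp add: \<delta>_def)
  define C where "C = 2 * (E + B)"
  show ?thesis
  proof (rule has_derivativeI_sandwich[where H = "\<lambda>y. C * norm (y - e)"])
    show "bounded_linear (\<lambda>u::'a. - u)" by (rule bounded_linear_minus[OF bounded_linear_ident])
    have "((\<lambda>y. C * norm (y - e)) \<longlongrightarrow> C * norm (e - e)) (at e within U)"
      by (intro tendsto_intros)
    then show "((\<lambda>y. C * norm (y - e)) \<longlongrightarrow> 0) (at e within U)" by simp
    fix x assume x: "x \<in> U" "x \<noteq> e" "dist x e < \<delta>"
    define h where "h = x - e"
    have hV: "h \<in> V" using x U_V e_V subspace_diff[OF subspace_V] by (simp add: h_def)
    have xe: "x = e + h" by (simp add: h_def)
    have h: "norm h > 0" "norm h \<le> 1" "(2 * E + B) * norm h \<le> 1 / 2"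
      using x(2,3) EB by (auto simp: h_def dist_norm \<delta>_def field_simps)
    have P: "Q x x y = y + 2 *\<^sub>R jmul h y + Q h h y" if "y \<in> V" for y
      using that Q_comm[of h e y] by (simp add: xe Q_linear Q_unit jmul_def scaleR_2 algebra_simps)
    define y where "y = jinv x - (e - h)"
    have yV: "y \<in> V" using jinv_V[OF x(1)] hV subspace_diff[OF subspace_V] by (simp add: y_def)
    have "Q x x y = Q x x (jinv x) - Q x x (e - h)" by (simp add: y_def Q_linear)
    also have "\<dots> = x - ((e - h) + 2 *\<^sub>R jmul h (e - h) + Q h h (e - h))"
      using P[of "e - h"] hV subspace_diff[OF subspace_V] by (simp add: Q_jinv[OF x(1)])
    also have "\<dots> = jmul h h + Q h h h"
      using hV jmul_comm[of h e] Q_e[OF hV hV] by (simp add: xe Q_linear jmul_def Q_unit algebra_simps scaleR_2)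
    finally have Py: "Q x x y = jmul h h + Q h h h" .
    have "norm y \<le> norm (Q x x y) + norm (2 *\<^sub>R jmul h y + Q h h y)"
      using norm_triangle_ineq4[of "Q x x y" "2 *\<^sub>R jmul h y + Q h h y"] P[OF yV] by (simp add: algebra_simps)
    also have "norm (2 *\<^sub>R jmul h y + Q h h y) \<le> 2 * (E * norm h * norm y) + B * norm h * norm h * norm y"
      by (intro order_trans[OF norm_triangle_ineq] add_mono) (use jb B in auto)
    also have "\<dots> \<le> 2 * (E * norm h * norm y) + B * norm h * 1 * norm y"
      using h B by (intro add_left_mono mult_right_mono mult_left_mono) auto
    also have "\<dots> = ((2 * E + B) * norm h) * norm y" by (simp add: algebra_simps)
    also have "\<dots> \<le> (1/2) * norm y" using h by (intro mult_right_mono) auto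
    finally have "norm y \<le> 2 * norm (Q x x y)" by simp
    also have "norm (Q x x y) \<le> E * norm h * norm h + B * norm h * norm h * norm h"
      unfolding Py by (intro order_trans[OF norm_triangle_ineq] add_mono jb B)
    also have "\<dots> \<le> E * norm h * norm h + B * norm h * norm h * 1"
      using h B by (intro add_left_mono mult_left_mono) auto
    finally have "norm y \<le> C * norm h * norm h" by (simp add: C_def algebra_simps)
    then show "norm (jinv x - jinv e - - (x - e)) / norm (x - e) \<le> C * norm (x - e)"
      using h by (simp add: jinv_e y_def h_def field_simps)
  qed (fact \<delta>)
qed

text \<open>Increments between points of \<open>U\<close> lie in \<open>V\<close>, so a derivative
  relative to \<open>U\<close> may be replaced by any bounded linear map that agrees with it on
  \<open>V\<close>. The algebraic identities hold on \<open>V\<close> only, while the maps live on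
  the ambient space.\<close>

lemma has_derivative_V_cong:
  assumes "(f has_derivative f') (at x within U)" "x \<in> U" "\<And>v. v \<in> V \<Longrightarrow> f' v = g' v" "bounded_linear g'"
  shows "(f has_derivative g') (at x within U)"
proof -
  have "f' (y - x) = g' (y - x)" if "y \<in> U" for y
    using assms(2,3) that U_V subspace_diff[OF subspace_V] by blast
  then have "\<forall>\<^sub>F y in at x within U. (1 / norm (y - x)) *\<^sub>R (f y - (f x + f' (y - x))) =
     (1 / norm (y - x)) *\<^sub>R (f y - (f x + g' (y - x)))"
    by (auto simp: eventually_at_filter)
  then show ?thesis using assms(1,4) unfolding has_derivative_within by (auto elim: Lim_transform_eventually)
qed

text \<open>Transport from \<open>e\<close>: \<open>jinv\<close> is conjugated by the structure map
  as \<open>n\<close> after \<open>jinv\<close> after \<open>m'\<close>, so the derivative at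
  \<open>x\<close> is \<open>- n m'\<close>. Applying \<open>n\<close> to
  \<open>Q e e (m' v)\<close> identifies \<open>n m'\<close> with P(jinv x) on
  \<open>V\<close>.\<close>

lemma jinv_derivative:
  assumes x: "x \<in> U"
  shows "(jinv has_derivative (\<lambda>u. - Q (jinv x) (jinv x) u)) (at x within U)"
proof -
  obtain m n m' n' where s: "str_pair m n m' n'" "m e = x" "n e = jinv x" using str_pair_U[OF x] by blast
  have lin: "bounded_linear m'" "bounded_linear n"
    using s(1) by (auto dest: str_pairD simp: linear_conv_bounded_linear)
  have m'x: "m' x = e" using str_pairD(9)[OF s(1), of e] s(2) by simp
  have m'U: "m' y \<in> U" if "y \<in> U" for y
    using str_pairD(16)[OF str_pair_inverse[OF s(1)]] that U_V by blast
  have "(jinv has_derivative (\<lambda>u. - u)) (at (m' x) within m' ` U)"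
    using has_derivative_subset[OF jinv_derivative_e, of "m' ` U"] m'U m'x by auto
  then have "((\<lambda>y. jinv (m' y)) has_derivative (\<lambda>u. - m' u)) (at x within U)"
    by (rule has_derivative_in_compose[OF bounded_linear.has_derivative[OF lin(1) has_derivative_ident]])
  then have "((\<lambda>y. n (jinv (m' y))) has_derivative (\<lambda>u. n (- m' u))) (at x within U)"
    by (rule bounded_linear.has_derivative[OF lin(2)])
  then have "(jinv has_derivative (\<lambda>u. n (- m' u))) (at x within U)"
  proof (rule has_derivative_transform[rotated 2])
    fix y assume y: "y \<in> U"
    then show "jinv y = n (jinv (m' y))"
      using jinv_str_pair[OF s(1) m'U[OF y]] str_pairD(10)[OF s(1) U_V[OF y]] by simp
  qed (fact x)
  then show ?thesis
  proof (rule has_derivative_V_cong)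
    fix v assume v: "v \<in> V"
    have "Q (n e) (n e) (m (m' v)) = n (Q e e (m' v))" using str_pairD(15)[OF s(1) e_V e_V str_pairD(7)[OF s(1) v]] .
    then show "n (- m' v) = - Q (jinv x) (jinv x) v"
      using s str_pairD[OF s(1)] v linear_neg[of n] Q_unit by auto
  next
    show "bounded_linear (\<lambda>u. - Q (jinv x) (jinv x) u)"
      by (rule bounded_linear_minus[OF linear_conv_bounded_linear[THEN iffD1, OF Q_lin3]])
  qed (fact x)
qed

lemma jinv_continuous: "continuous_on U jinv"
  using has_derivative_continuous[OF jinv_derivative] by (auto simp: continuous_on_eq_continuous_within)

lemma jinv_dir: "x \<in> U \<Longrightarrow> v \<in> V \<Longrightarrow> has_dir_deriv jinv (- Q (jinv x) (jinv x) v) v x"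
  by (rule has_dir_derivI[OF jinv_derivative])

text \<open>The derivative is a quadratic expression in \<open>jinv\<close> itself, so each order of
  differentiability produces the next.\<close>

lemma jinv_smooth: "smooth V U jinv"
  unfolding smooth_def
proof
  show "C_k k V U jinv" for k
  proof (induction k)
    case 0 show ?case by (simp add: jinv_continuous)
  next
    case (Suc k) show ?case
      by (rule C_k_SucI[where f' = "\<lambda>v x. - Q (jinv x) (jinv x) v"])
       (auto intro!: jinv_continuous jinv_dir C_k_linear[OF bounded_linear_minus[OF bounded_linear_ident]]
         C_k_bilinear[OF bounded_bilinear_Q12] Suc.IH)
  qed
qed

end

section \<open>Invariant metrics and their geodesics\<close>

text \<open>Energy estimate: weighted by the exponential of \<open>- 2 * C\<close> times elapsed
  time, |y|^2 cannot increase forwards in time, and with the opposite weight it cannot increase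
  backwards. It is 0 at \<open>s\<close>, hence 0 on both sides.\<close>

lemma linear_ode_zero:
  fixes y :: "real \<Rightarrow> 'a::real_inner"
  assumes J: "convex J" "s \<in> J" "t \<in> J"
    and deriv: "\<And>t. t \<in> J \<Longrightarrow> (y has_vector_derivative L (y t)) (at t)"
    and L: "\<And>x. norm (L x) \<le> C * norm x"
    and init: "y s = 0"
  shows "y t = 0"
proof -
  define f where "f r t = (y t \<bullet> y t) * exp (r * (t - s))" for r t
  have seg: "u \<in> J" if "min s t \<le> u" "u \<le> max s t" for u
    using closed_segment_subset[OF J(2,3,1)] that by (auto simp: closed_segment_eq_real_ivl split: if_splits)
  have df: "(f r has_real_derivative (2 * (y u \<bullet> L (y u)) + r * (y u \<bullet> y u)) * exp (r * (u - s))) (at u)"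
    if "u \<in> J" for u r
  proof -
    have "((\<lambda>t. y t \<bullet> y t) has_real_derivative 2 * (y u \<bullet> L (y u))) (at u)"
      using bounded_bilinear.has_vector_derivative[OF bounded_bilinear_inner deriv[OF that] deriv[OF that]]
      by (simp add: inner_commute has_real_derivative_iff_has_vector_derivative)
    moreover have "((\<lambda>t. exp (r * (t - s))) has_real_derivative r * exp (r * (u - s))) (at u)"
      by (auto intro!: derivative_eq_intros)
    ultimately have "((\<lambda>t. (y t \<bullet> y t) * exp (r * (t - s))) has_real_derivative
        2 * (y u \<bullet> L (y u)) * exp (r * (u - s)) + r * exp (r * (u - s)) * (y u \<bullet> y u)) (at u)"
      by (rule DERIV_mult)
    then show ?thesis unfolding f_def by (simp add: algebra_simps)
  qed
  have bnd: "\<bar>y u \<bullet> L (y u)\<bar> \<le> C * (y u \<bullet> y u)" for u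
  proof -
    have "\<bar>y u \<bullet> L (y u)\<bar> \<le> norm (y u) * (C * norm (y u))"
      by (rule order_trans[OF Cauchy_Schwarz_ineq2 mult_left_mono[OF L]]) simp
    then show ?thesis by (simp add: dot_square_norm power2_eq_square mult_ac)
  qed
  have f0: "f r s = 0" for r by (simp add: f_def init)
  have "\<exists>r. f r t \<le> 0"
  proof (cases "s \<le> t")
    case True
    have "f (- 2 * C) t \<le> f (- 2 * C) s"
    proof (rule DERIV_nonpos_imp_nonincreasing[OF True], intro exI conjI)
      fix u assume "s \<le> u" "u \<le> t"
      then have u: "u \<in> J" using seg True by simp
      show "(f (- 2 * C) has_real_derivative (2 * (y u \<bullet> L (y u)) + (- 2 * C) * (y u \<bullet> y u)) * exp ((- 2 * C) * (u - s))) (at u)"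
        by (rule df[OF u])
      show "(2 * (y u \<bullet> L (y u)) + (- 2 * C) * (y u \<bullet> y u)) * exp ((- 2 * C) * (u - s)) \<le> 0"
        by (rule mult_nonpos_nonneg) (use bnd[of u] in \<open>auto simp: abs_le_iff\<close>)
    qed
    then show ?thesis using f0[of "- 2 * C"] by (intro exI[of _ "- 2 * C"]) linarith
  next
    case False
    then have ts: "t \<le> s" by simp
    have "f (2 * C) t \<le> f (2 * C) s"
    proof (rule DERIV_nonneg_imp_nondecreasing[OF ts], intro exI conjI)
      fix u assume "t \<le> u" "u \<le> s"
      then have u: "u \<in> J" using seg ts by simp
      show "(f (2 * C) has_real_derivative (2 * (y u \<bullet> L (y u)) + (2 * C) * (y u \<bullet> y u)) * exp ((2 * C) * (u - s))) (at u)"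
        by (rule df[OF u])
      show "(2 * (y u \<bullet> L (y u)) + (2 * C) * (y u \<bullet> y u)) * exp ((2 * C) * (u - s)) \<ge> 0"
        by (rule mult_nonneg_nonneg) (use bnd[of u] in \<open>auto simp: abs_le_iff\<close>)
    qed
    then show ?thesis using f0[of "2 * C"] by (intro exI[of _ "2 * C"]) linarith
  qed
  then have "y t \<bullet> y t \<le> 0" by (auto simp: f_def mult_le_0_iff)
  then show ?thesis using inner_ge_zero[of "y t"] by (metis antisym inner_eq_zero_iff)
qed

text \<open>Pairing the curve with a vector orthogonal to \<open>V\<close> gives a function that
  vanishes near \<open>t\<close>; so the velocity lies in the double orthogonal complement, which is
  \<open>V\<close>.\<close>

lemma subspace_has_vector_derivative:
  fixes \<gamma> :: "real \<Rightarrow> 'a::euclidean_space"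
  assumes V: "subspace V" and J: "open J" "t \<in> J" "\<gamma> ` J \<subseteq> V"
    and d: "(\<gamma> has_vector_derivative d) (at t)"
  shows "d \<in> V"
proof -
  have "y \<bullet> d = 0" if y: "y \<in> V\<^sup>\<bottom>" for y
  proof -
    have "((\<lambda>s. y \<bullet> \<gamma> s) has_vector_derivative y \<bullet> d) (at t)"
      using bounded_linear.has_vector_derivative[OF bounded_linear_inner_right d] .
    moreover have "((\<lambda>s. y \<bullet> \<gamma> s) has_vector_derivative 0) (at t)"
      by (rule has_vector_derivative_transform_within_open[OF has_vector_derivative_const[of 0] J(1,2)])
        (use J(3) y in \<open>auto simp: orthogonal_comp_def orthogonal_def inner_commute[of y]\<close>)
    ultimately show ?thesis by (rule vector_derivative_unique_at)
  qed
  then have "d \<in> V\<^sup>\<bottom>\<^sup>\<bottom>" by (auto simp: orthogonal_comp_def orthogonal_def)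
  then show ?thesis by (simp add: orthogonal_comp_self V)
qed

section \<open>Invariant tensors of the cone and their derivatives\<close>

context jordan_frame
begin

text \<open>\<open>\<tau>\<close> and \<open>-\<sigma>\<close> are the first and second derivative of \<open>log det\<close>, and \<open>- gam\<close> is the Levi-Civita connection
  of every invariant metric.\<close>

definition \<tau> :: "'a \<Rightarrow> 'a \<Rightarrow> real" where "\<tau> x u = jinv x \<bullet> u"

definition \<sigma> :: "'a \<Rightarrow> 'a \<Rightarrow> 'a \<Rightarrow> real" where "\<sigma> x u v = Q (jinv x) (jinv x) u \<bullet> v"

definition gam :: "'a \<Rightarrow> 'a \<Rightarrow> 'a \<Rightarrow> 'a" where "gam x u v = Q u v (jinv x)"

lemma tau_str_pair: "str_pair m n m' n' \<Longrightarrow> x \<in> U \<Longrightarrow> u \<in> V \<Longrightarrow> \<tau> (m x) (m u) = \<tau> x u"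
  using str_pairD(13)[of m n m' n' u "jinv x"] by (simp add: \<tau>_def jinv_str_pair jinv_V inner_commute)

lemma P_str_pair: "str_pair m n m' n' \<Longrightarrow> x \<in> U \<Longrightarrow> u \<in> V \<Longrightarrow>
    Q (jinv (m x)) (jinv (m x)) (m u) = n (Q (jinv x) (jinv x) u)"
  by (simp add: jinv_str_pair str_pairD(15) jinv_V)

lemma sigma_str_pair: "str_pair m n m' n' \<Longrightarrow> x \<in> U \<Longrightarrow> u \<in> V \<Longrightarrow> v \<in> V \<Longrightarrow> \<sigma> (m x) (m u) (m v) = \<sigma> x u v"
  using str_pairD(13)[of m n m' n' v "Q (jinv x) (jinv x) u"]
  by (simp add: \<sigma>_def P_str_pair Q_V jinv_V inner_commute)

lemma gam_str_pair: "str_pair m n m' n' \<Longrightarrow> x \<in> U \<Longrightarrow> u \<in> V \<Longrightarrow> v \<in> V \<Longrightarrow> gam (m x) (m u) (m v) = m (gam x u v)"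
  by (simp add: gam_def jinv_str_pair str_pairD(14) jinv_V)

lemma gam_V: "x \<in> U \<Longrightarrow> u \<in> V \<Longrightarrow> v \<in> V \<Longrightarrow> gam x u v \<in> V"
  by (simp add: gam_def Q_V jinv_V)

lemma gam_comm: "gam x u v = gam x v u" by (simp add: gam_def Q_comm)

lemma sigma_comm: "x \<in> U \<Longrightarrow> u \<in> V \<Longrightarrow> v \<in> V \<Longrightarrow> \<sigma> x u v = \<sigma> x v u"
  using Q_adj[of "jinv x" "jinv x" u v] by (simp add: \<sigma>_def jinv_V inner_commute)

lemma tau_e: "\<tau> e u = e \<bullet> u" by (simp add: \<tau>_def jinv_e)
lemma sigma_e: "u \<in> V \<Longrightarrow> \<sigma> e u v = u \<bullet> v" by (simp add: \<sigma>_def jinv_e Q_unit)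
lemma gam_e: "u \<in> V \<Longrightarrow> v \<in> V \<Longrightarrow> gam e u v = jmul u v" by (simp add: gam_def jinv_e Q_e)

lemmas form_linear =
  inner_add_left inner_add_right inner_diff_left inner_diff_right Q_linear

lemma sigma_linear:
  "\<sigma> x (u + v) w = \<sigma> x u w + \<sigma> x v w" "\<sigma> x w (u + v) = \<sigma> x w u + \<sigma> x w v"
  "\<sigma> x (u - v) w = \<sigma> x u w - \<sigma> x v w" "\<sigma> x w (u - v) = \<sigma> x w u - \<sigma> x w v"
  "\<sigma> x (r *\<^sub>R u) w = r * \<sigma> x u w" "\<sigma> x w (r *\<^sub>R u) = r * \<sigma> x w u"
  "\<sigma> x (- u) w = - \<sigma> x u w" "\<sigma> x w (- u) = - \<sigma> x w u" "\<sigma> x 0 w = 0" "\<sigma> x w 0 = 0"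
  by (simp_all add: \<sigma>_def form_linear)

lemma tau_linear:
  "\<tau> x (u + v) = \<tau> x u + \<tau> x v" "\<tau> x (u - v) = \<tau> x u - \<tau> x v" "\<tau> x (r *\<^sub>R u) = r * \<tau> x u"
  "\<tau> x (- u) = - \<tau> x u" "\<tau> x 0 = 0"
  by (simp_all add: \<tau>_def form_linear)

lemma gam_linear:
  "gam x (u + v) w = gam x u w + gam x v w" "gam x w (u + v) = gam x w u + gam x w v"
  "gam x (u - v) w = gam x u w - gam x v w" "gam x w (u - v) = gam x w u - gam x w v"
  "gam x (r *\<^sub>R u) w = r *\<^sub>R gam x u w" "gam x w (r *\<^sub>R u) = r *\<^sub>R gam x w u"
  "gam x (- u) w = - gam x u w" "gam x w (- u) = - gam x w u" "gam x 0 w = 0" "gam x w 0 = 0"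
  by (simp_all add: gam_def Q_linear)

text \<open>Reduction to the unit element, where \<open>\<sigma>\<close> is the inner product,
  \<open>\<tau>\<close> the trace and \<open>gam\<close> the Jordan product. The tensor identities
  that follow become elementary there.\<close>

lemma transport3:
  assumes x: "x \<in> U" "u \<in> V" "v \<in> V" "w \<in> V"
  obtains m n m' n' u0 v0 w0 where "str_pair m n m' n'" "m e = x" "n e = jinv x"
    "u0 \<in> V" "v0 \<in> V" "w0 \<in> V" "m u0 = u" "m v0 = v" "m w0 = w"
proof -
  obtain m n m' n' where s: "str_pair m n m' n'" "m e = x" "n e = jinv x" using str_pair_U[OF x(1)] by blast
  show ?thesis
    by (rule that[OF s, of "m' u" "m' v" "m' w"]) (use str_pairD(7,10)[OF s(1)] x in auto)
qed

text \<open>At \<open>e\<close> this is e . (u v) = u . v, the defining property of the trace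
  form.\<close>

lemma tau_gam: assumes "x \<in> U" "u \<in> V" "v \<in> V" shows "\<tau> x (gam x u v) = \<sigma> x u v"
proof -
  obtain m n m' n' u0 v0 w0 where s: "str_pair m n m' n'" "m e = x" "n e = jinv x"
    "u0 \<in> V" "v0 \<in> V" "w0 \<in> V" "m u0 = u" "m v0 = v" "m w0 = v"
    using transport3[OF assms assms(3)] .
  have "\<tau> e (gam e u0 v0) = \<sigma> e u0 v0"
    using s jmul_adj[of u0 v0 e] jmul_comm[of u0 e]
    by (simp add: tau_e sigma_e gam_e inner_commute)
  moreover have "\<tau> x (gam x u v) = \<tau> e (gam e u0 v0)"
    using gam_str_pair[OF s(1) e_U s(4,5)] tau_str_pair[OF s(1) e_U, of "gam e u0 v0"] s(2,7,8)
    by (simp add: gam_V e_U s)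
  moreover have "\<sigma> x u v = \<sigma> e u0 v0" using sigma_str_pair[OF s(1) e_U s(4,5)] s by simp
  ultimately show ?thesis by simp
qed

text \<open>At \<open>e\<close> this says that Jordan multiplication by \<open>u\<close> is
  self-adjoint. With \<open>gam_comm\<close> it makes \<open>\<sigma> x (gam x u v) w\<close>
  totally symmetric.\<close>

lemma sigma_gam: assumes "x \<in> U" "u \<in> V" "v \<in> V" "w \<in> V"
  shows "\<sigma> x (gam x u v) w = \<sigma> x (gam x u w) v"
proof -
  obtain m n m' n' u0 v0 w0 where s: "str_pair m n m' n'" "m e = x" "n e = jinv x"
    "u0 \<in> V" "v0 \<in> V" "w0 \<in> V" "m u0 = u" "m v0 = v" "m w0 = w"
    using transport3[OF assms] .
  have red: "\<sigma> x (gam x (m a) (m b)) (m d) = jmul a b \<bullet> d" if "a \<in> V" "b \<in> V" "d \<in> V" for a b d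
    using gam_str_pair[OF s(1) e_U that(1,2)] sigma_str_pair[OF s(1) e_U, of "gam e a b" d] s(2) that
    by (simp add: gam_V e_U sigma_e gam_e jmul_V)
  show ?thesis using red[of u0 v0 w0] red[of u0 w0 v0] s jmul_adj[of u0 v0 w0] by (simp add: inner_commute)
qed

lemma sigma_x: assumes "x \<in> U" "v \<in> V" shows "\<sigma> x x v = \<tau> x v"
proof -
  obtain m n m' n' u0 v0 w0 where s: "str_pair m n m' n'" "m e = x" "n e = jinv x"
    "u0 \<in> V" "v0 \<in> V" "w0 \<in> V" "m u0 = v" "m v0 = v" "m w0 = v"
    using transport3[OF assms assms(2) assms(2)] .
  show ?thesis using sigma_str_pair[OF s(1) e_U e_V s(4)] tau_str_pair[OF s(1) e_U s(4)] s
    by (simp add: sigma_e tau_e)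
qed

lemma e_inner_e: "e \<bullet> e = real CARD('b)" by (simp add: e_def dg_inner)

lemma tau_x: assumes "x \<in> U" shows "\<tau> x x = real CARD('b)"
proof -
  obtain m n m' n' where s: "str_pair m n m' n'" "m e = x" "n e = jinv x" using str_pair_U[OF assms] by blast
  show ?thesis using tau_str_pair[OF s(1) e_U e_V] s by (simp add: tau_e e_inner_e)
qed

lemma gam_x: assumes "x \<in> U" "u \<in> V" shows "gam x u x = u"
proof -
  obtain m n m' n' u0 v0 w0 where s: "str_pair m n m' n'" "m e = x" "n e = jinv x"
    "u0 \<in> V" "v0 \<in> V" "w0 \<in> V" "m u0 = u" "m v0 = u" "m w0 = u"
    using transport3[OF assms assms(2) assms(2)] .
  show ?thesis using gam_str_pair[OF s(1) e_U s(4) e_V] s jmul_comm[of u0 e] by (simp add: gam_e)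
qed

text \<open>At \<open>e\<close>, where P(jinv x) is the identity, both sides are
  \<open>jmul u v\<close>. It merges the two terms of the product rule for
  \<open>Q (jinv y) (jinv y) v\<close> into a single \<open>gam\<close>.\<close>

lemma P_gam: assumes "x \<in> U" "u \<in> V" "v \<in> V"
  shows "Q (Q (jinv x) (jinv x) u) (jinv x) v = Q (jinv x) (jinv x) (gam x u v)"
proof -
  obtain m n m' n' u0 v0 w0 where s: "str_pair m n m' n'" "m e = x" "n e = jinv x"
    "u0 \<in> V" "v0 \<in> V" "w0 \<in> V" "m u0 = u" "m v0 = v" "m w0 = v"
    using transport3[OF assms assms(3)] .
  have P: "Q (jinv x) (jinv x) (m a) = n a" if "a \<in> V" for a
    using P_str_pair[OF s(1) e_U that] s(2) that by (simp add: jinv_e Q_unit)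
  have "Q (n u0) (n e) (m v0) = n (jmul u0 v0)"
    using str_pairD(15)[OF s(1) s(4) e_V s(5)] Q_comm[of u0 e] by (simp add: jmul_def)
  moreover have "gam x u v = m (jmul u0 v0)" using gam_str_pair[OF s(1) e_U s(4,5)] s by (simp add: gam_e)
  ultimately show ?thesis using P s by (metis jmul_V)
qed

text \<open>This is what makes the conserved operator of a geodesic constant. At \<open>e\<close> it
  becomes Q u z u = (u u) z, and diagonalizing \<open>u\<close> by \<open>K\<close> leaves the axiom
  \<open>Q_shift_dg\<close>.\<close>

lemma Q_shift: assumes "x \<in> U" "u \<in> V" "z \<in> V"
  shows "Q (gam x u u) z (jinv x) = Q u z (Q (jinv x) (jinv x) u)"
proof -
  have key: "Q y z y = jmul (jmul y y) z" if yz: "y \<in> V" "z \<in> V" for y z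
  proof -
    obtain k a where k: "k \<in> K" "y = k (dg a)" using spectral yz by blast
    obtain k' where k': "k' \<in> K" "\<forall>x\<in>V. k' (k x) = x \<and> k (k' x) = x"
      using K_inv[OF k(1)] by blast
    have z: "z = k (k' z)" "k' z \<in> V" using k' yz K_V by auto
    have "Q y z y = k (Q (dg a) (k' z) (dg a))" using K_Q[OF k(1), of "dg a" "k' z" "dg a"] z k by simp
    also have "\<dots> = k (jmul (jmul (dg a) (dg a)) (k' z))"
      using Q_shift_dg[OF z(2), of a] by (simp add: jmul_dg power2_eq_square)
    also have "\<dots> = jmul (jmul y y) z"
      using K_jmul[OF k(1), of "dg a" "dg a"] K_jmul[OF k(1), of "jmul (dg a) (dg a)" "k' z"] z k jmul_V by simp
    finally show ?thesis .
  qed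
  obtain m n m' n' u0 v0 w0 where s: "str_pair m n m' n'" "m e = x" "n e = jinv x"
    "u0 \<in> V" "v0 \<in> V" "w0 \<in> V" "m u0 = u" "m v0 = z" "m w0 = z"
    using transport3[OF assms assms(3)] .
  have P: "Q (jinv x) (jinv x) u = n u0"
    using P_str_pair[OF s(1) e_U s(4)] s by (simp add: jinv_e Q_unit)
  have "Q u z (n u0) = m (Q u0 v0 u0)" using str_pairD(14)[OF s(1) s(4,5,4)] s by simp
  moreover have "gam x u u = m (jmul u0 u0)" using gam_str_pair[OF s(1) e_U s(4,4)] s by (simp add: gam_e)
  moreover have "Q (m (jmul u0 u0)) (m v0) (n e) = m (Q (jmul u0 u0) v0 e)"
    using str_pairD(14)[OF s(1) jmul_V[OF s(4,4)] s(5) e_V] .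
  ultimately show ?thesis using P s key[OF s(4,5)] Q_e[OF jmul_V[OF s(4,4)] s(5)] by simp
qed

lemma tau_dir: "x \<in> U \<Longrightarrow> u \<in> V \<Longrightarrow> v \<in> V \<Longrightarrow> has_dir_deriv (\<lambda>y. \<tau> y v) (- \<sigma> x u v) u x"
  unfolding \<tau>_def \<sigma>_def
  using has_dir_deriv_bilinear[OF bounded_bilinear_inner jinv_dir[of x u] has_dir_deriv_const[of v]]
  by simp

lemma Qjj_dir: "x \<in> U \<Longrightarrow> u \<in> V \<Longrightarrow> v \<in> V \<Longrightarrow>
   has_dir_deriv (\<lambda>y. Q (jinv y) (jinv y) v) (- 2 *\<^sub>R Q (jinv x) (jinv x) (gam x u v)) u x"
  using has_dir_deriv_bilinear[OF bounded_bilinear_Q12 jinv_dir[of x u] jinv_dir[of x u], of v]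
    Q_comm[of "jinv x" "Q (jinv x) (jinv x) u" v]
  by (simp add: Q_linear P_gam scaleR_2)

lemma sigma_dir: "x \<in> U \<Longrightarrow> u \<in> V \<Longrightarrow> v \<in> V \<Longrightarrow> w \<in> V \<Longrightarrow>
   has_dir_deriv (\<lambda>y. \<sigma> y v w) (- 2 * \<sigma> x (gam x u v) w) u x"
  unfolding \<sigma>_def
  using has_dir_deriv_bilinear[OF bounded_bilinear_inner Qjj_dir[of x u v] has_dir_deriv_const[of w]]
  by simp

lemma gam_dir: "x \<in> U \<Longrightarrow> u \<in> V \<Longrightarrow>
   has_dir_deriv (\<lambda>y. gam y v w) (- Q v w (Q (jinv x) (jinv x) u)) u x"
  unfolding gam_def
  using has_dir_deriv_bounded_linear[OF linear_conv_bounded_linear[THEN iffD1, OF Q_lin3] jinv_dir[of x u]]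
  by (simp add: Q_linear)

lemma smooth_tau: "smooth V U (\<lambda>x. \<tau> x u)"
  unfolding \<tau>_def by (intro smooth_inner jinv_smooth smooth_const)

lemma smooth_sigma: "smooth V U (\<lambda>x. \<sigma> x u v)"
  unfolding \<sigma>_def
  by (intro smooth_inner smooth_const smooth_bilinear[OF bounded_bilinear_Q12] jinv_smooth)

lemma smooth_gam: "smooth V U (\<lambda>x. gam x u v)"
  unfolding gam_def
  by (intro smooth_linear[OF linear_conv_bounded_linear[THEN iffD1, OF Q_lin3]] jinv_smooth)

end

text \<open>Common interface for the congruence groups and for the full automorphism group of the
  octonionic cone: \<open>G\<close> contains enough maps to bring a point to \<open>e\<close> and to
  diagonalize a tangent vector there, and all of \<open>G\<close> preserves
  \<open>U\<close>.\<close>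

locale jordan_cone = jordan_frame +
  fixes G :: "('a \<Rightarrow> 'a) set"
  assumes K_G: "K \<subseteq> G"
    and D_G: "(\<And>i. a i > 0) \<Longrightarrow> D a \<in> G"
    and G_comp: "k \<in> G \<Longrightarrow> l \<in> G \<Longrightarrow> (\<lambda>x. k (l x)) \<in> G"
    and G_U: "k \<in> G \<Longrightarrow> k ` U = U"
begin

text \<open>After the point has been moved to \<open>e\<close>, the stabilizer \<open>K\<close> of
  \<open>e\<close> is still free to diagonalize the tangent vector. The maps are tracked in
  \<open>G\<close> and as structure pairs at the same time.\<close>

lemma G_frame:
  assumes x: "x \<in> U" and u: "u \<in> V"
  obtains m n m' n' a where "str_pair m n m' n'" "m \<in> G" "m' \<in> G" "m e = x" "n e = jinv x" "m (dg a) = u"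
proof -
  obtain k a where ka: "k \<in> K" "\<And>i. a i > 0" "x = k (dg a)" using spectral_U[OF x] by blast
  obtain k' where k': "k' \<in> K" "\<And>x. x \<in> V \<Longrightarrow> k' (k x) = x \<and> k (k' x) = x"
    using K_inv[OF ka(1)] by blast
  let ?b = "\<lambda>i. sqrt (a i)"
  have b: "?b i > 0" "inverse (?b i) > 0" for i using ka(2)[of i] by simp_all
  let ?m = "\<lambda>x. k (D ?b x)" and ?m' = "\<lambda>x. D (\<lambda>i. inverse (?b i)) (k' x)"
  have s: "str_pair ?m (\<lambda>x. k (D (\<lambda>i. inverse (?b i)) x)) ?m' (\<lambda>x. D ?b (k' x))"
    by (rule str_pair_comp[OF str_pair_K[OF ka(1) k'] str_pair_D]) (simp_all add: ka(2))
  have mG: "?m \<in> G" "?m' \<in> G"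
    using G_comp[OF subsetD[OF K_G ka(1)] D_G[OF b(1)]] G_comp[OF D_G[OF b(2)] subsetD[OF K_G k'(1)]] by simp_all
  have me: "?m e = x" using ka(2) by (simp add: D_e ka(3) less_imp_le)
  have "?m' u \<in> V" using str_pairD[OF s] u by simp
  then obtain l d where l: "l \<in> K" "?m' u = l (dg d)" using spectral by blast
  obtain l' where l': "l' \<in> K" "\<And>x. x \<in> V \<Longrightarrow> l' (l x) = x \<and> l (l' x) = x"
    using K_inv[OF l(1)] by blast
  have s2: "str_pair (\<lambda>x. ?m (l x)) (\<lambda>x. k (D (\<lambda>i. inverse (?b i)) (l x))) (\<lambda>x. l' (?m' x)) (\<lambda>x. l' (D ?b (k' x)))"
    by (rule str_pair_comp[OF s str_pair_K[OF l(1) l']])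
  show ?thesis
  proof (rule that[OF s2])
    show "?m (l (dg d)) = u" using l(2) str_pairD(10)[OF s u] by simp
    show e1: "?m (l e) = x" using me K_e[OF l(1)] by simp
    show "k (D (\<lambda>i. inverse (?b i)) (l e)) = jinv x"
      using str_pair_jinv[OF s] me K_e[OF l(1)] by simp
    show "(\<lambda>x. ?m (l x)) \<in> G" by (rule G_comp[OF mG(1) subsetD[OF K_G l(1)]])
    show "(\<lambda>x. l' (?m' x)) \<in> G" by (rule G_comp[OF subsetD[OF K_G l'(1)] mG(2)])
  qed
qed

lemma homogeneous: "homogeneous U G"
  unfolding homogeneous_def
proof (intro conjI ballI)
  fix x y assume x: "x \<in> U" and y: "y \<in> U"
  obtain m n m' n' a where m: "str_pair m n m' n'" "m \<in> G" "m' \<in> G" "m e = x"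
    using G_frame[OF x e_V] by metis
  obtain p q p' q' a where p: "str_pair p q p' q'" "p \<in> G" "p' \<in> G" "p e = y"
    using G_frame[OF y e_V] by metis
  have "p (m' x) = y" using str_pairD(9)[OF m(1) e_V] m p by simp
  then show "\<exists>k\<in>G. k x = y" using G_comp[OF p(2) m(3)] by (intro bexI[of _ "\<lambda>z. p (m' z)"]) auto
qed (rule G_U)

lemma T_W: "T \<subseteq> W" by (auto simp: T_def W_def)
lemma W_V: "W \<subseteq> V" by (auto simp: W_def)

lemma curve_deriv:
  assumes "linear m"
    and "\<And>i. ((\<lambda>t. f t i) has_real_derivative f' i) (at t)"
  shows "((\<lambda>t. m (dg (f t))) has_vector_derivative m (dg f')) (at t)"
proof -
  have "((\<lambda>t. f t i *\<^sub>R c i) has_vector_derivative f' i *\<^sub>R c i) (at t)" for i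
    using bounded_linear.has_vector_derivative[OF bounded_linear_scaleR_left assms(2)[of i,
      unfolded has_real_derivative_iff_has_vector_derivative]] .
  then have "((\<lambda>t. dg (f t)) has_vector_derivative dg f') (at t)"
    unfolding dg_def by (intro has_vector_derivative_sum) auto
  from bounded_linear.has_vector_derivative[OF linear_conv_bounded_linear[THEN iffD1, OF assms(1)] this]
  show ?thesis .
qed

end

lemma symmetric_form_fieldD:
  assumes "symmetric_form_field V U g" "x \<in> U"
  shows "u \<in> V \<Longrightarrow> v \<in> V \<Longrightarrow> g x u v = g x v u"
    and "u \<in> V \<Longrightarrow> v \<in> V \<Longrightarrow> w \<in> V \<Longrightarrow> g x (a *\<^sub>R u + b *\<^sub>R v) w = a * g x u w + b * g x v w"
    and "u \<in> V \<Longrightarrow> v \<in> V \<Longrightarrow> w \<in> V \<Longrightarrow> g x (u + v) w = g x u w + g x v w"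
    and "u \<in> V \<Longrightarrow> v \<in> V \<Longrightarrow> w \<in> V \<Longrightarrow> g x (u - v) w = g x u w - g x v w"
    and "u \<in> V \<Longrightarrow> w \<in> V \<Longrightarrow> g x (a *\<^sub>R u) w = a * g x u w"
    and "w \<in> V \<Longrightarrow> subspace V \<Longrightarrow> g x 0 w = 0"
proof -
  show 1: "g x u v = g x v u" if "u \<in> V" "v \<in> V" for u v
    using assms that by (simp add: symmetric_form_field_def)
  show 2: "g x (a *\<^sub>R u + b *\<^sub>R v) w = a * g x u w + b * g x v w" if "u \<in> V" "v \<in> V" "w \<in> V" for u v w a b
    using assms that by (simp add: symmetric_form_field_def)
  show "g x (u + v) w = g x u w + g x v w" if "u \<in> V" "v \<in> V" "w \<in> V"
    using 2[OF that, of 1 1] by simp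
  show "g x (u - v) w = g x u w - g x v w" if "u \<in> V" "v \<in> V" "w \<in> V"
    using 2[OF that, of 1 "-1"] by simp
  show "g x (a *\<^sub>R u) w = a * g x u w" if "u \<in> V" "w \<in> V"
    using 2[OF that(1,1,2), of a 0] by simp
  show "g x 0 w = 0" if "w \<in> V" "subspace V"
    using 2[OF subspace_0[OF that(2)] subspace_0[OF that(2)] that(1), of 0 0] by simp
qed

text \<open>It makes the denominator of the sectional curvature nonnegative, so that the sign of the
  quotient is controlled by its numerator.\<close>

lemma form_field_cauchy_schwarz:
  assumes r: "riemannian V U g" and x: "x \<in> U" "u \<in> V" "v \<in> V" and V: "subspace V"
  shows "(g x u v)\<^sup>2 \<le> g x u u * g x v v"
proof (cases "v = 0")
  case True
  have s: "symmetric_form_field V U g" using r by (simp add: riemannian_def)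
  have "g x u 0 = 0" "g x 0 0 = 0"
    using symmetric_form_fieldD(6)[OF s x(1) x(2) V] symmetric_form_fieldD(6)[OF s x(1) subspace_0[OF V] V]
      symmetric_form_fieldD(1)[OF s x(1,2) subspace_0[OF V]] by simp_all
  then show ?thesis using True by simp
next
  case False
  have s: "symmetric_form_field V U g" using r by (simp add: riemannian_def)
  note lin = symmetric_form_fieldD[OF s x(1)]
  define a b c where "a = g x u u" "b = g x u v" "c = g x v v"
  have c: "c > 0" using r x False by (simp add: riemannian_def a_b_c_def)
  \<comment> \<open>A multiple of the component of \<open>u\<close> orthogonal to \<open>v\<close>;
    its square length is \<open>c * (c * a - b * b)\<close>.\<close>
  let ?w = "c *\<^sub>R u - b *\<^sub>R v"
  have V': "c *\<^sub>R u \<in> V" "b *\<^sub>R v \<in> V" "?w \<in> V"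
    using x V by (auto intro: subspace_scale subspace_diff)
  have "g x ?w z = c * g x u z - b * g x v z" if "z \<in> V" for z
    using lin(4)[OF V'(1,2) that] lin(5) x that by simp
  moreover have "g x z ?w = c * g x u z - b * g x v z" if "z \<in> V" for z
    using calculation lin(1) V'(3) that by metis
  ultimately have "g x ?w ?w = c * (c * a - b * b) - b * (c * b - b * c)"
    using x V' lin(1)[OF x(2,3)] by (simp add: a_b_c_def)
  moreover have "g x ?w ?w \<ge> 0"
  proof (cases "?w = 0")
    case True then show ?thesis using lin(6)[OF subspace_0[OF V] V] by simp
  next
    case False then show ?thesis using r x V' by (auto simp: riemannian_def less_imp_le)
  qed
  ultimately have "c * (c * a - b * b) \<ge> 0" by simp
  then have "c * a - b * b \<ge> 0" using c by (simp add: zero_le_mult_iff)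
  then show ?thesis by (simp add: a_b_c_def power2_eq_square mult.commute)
qed

section \<open>Classification of the invariant metrics\<close>

context jordan_cone
begin

text \<open>By the spectral decomposition, an invariant metric is determined by its values at \<open>e\<close> on
  diagonal elements, and these are invariant under permutations of the frame.\<close>

lemma invariant_metric_form:
  assumes inv: "invariant_metric V U G g"
  obtains \<alpha> \<beta> where "\<alpha> > 0" "\<alpha> + real CARD('b) * \<beta> > 0"
    "\<And>x u v. x \<in> U \<Longrightarrow> u \<in> V \<Longrightarrow> v \<in> V \<Longrightarrow> g x u v = \<alpha> * \<sigma> x u v + \<beta> * (\<tau> x u * \<tau> x v)"
proof -
  have riem: "riemannian V U g" using inv by (simp add: invariant_metric_def)
  have s: "symmetric_form_field V U g" using riem by (simp add: riemannian_def)
  have gG: "g (k x) (k u) (k v) = g x u v" if "k \<in> G" "x \<in> U" "u \<in> V" "v \<in> V" for k x u v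
    using inv that by (simp add: invariant_metric_def)
  have pos: "g x u u > 0" if "x \<in> U" "u \<in> V" "u \<noteq> 0" for x u
    using riem that by (simp add: riemannian_def)
  note lin = symmetric_form_fieldD[OF s e_U]
  define q where "q u v = g e u v" for u v
  have qK: "q (k u) (k v) = q u v" if "k \<in> K" "u \<in> V" "v \<in> V" for k u v
    using gG[OF _ e_U that(2,3), of k] K_G K_e[OF that(1)] that(1) by (auto simp: q_def)
  define b where "b i j = q (c i) (c j)" for i j
  have bsym: "b i j = b j i" for i j by (simp add: b_def q_def lin(1) c_V)
  have bt: "b (Transposition.transpose i j l) (Transposition.transpose i j l') = b l l'" for i j l l'
  proof -
    obtain k where k: "k \<in> K" "\<forall>l. k (c l) = c (Transposition.transpose i j l)" using K_swap by blast
    show ?thesis using qK[OF k(1) c_V c_V, of l l'] k(2) by (simp add: b_def)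
  qed
  have diag: "b i i = b j j" for i j using bt[of i j i i] by simp
  \<comment> \<open>The transposition of \<open>j\<close> and \<open>l\<close> fixes
    \<open>i\<close>, hence carries the pair (i, j) to (i, l).\<close>
  have off1: "b i j = b i l" if "i \<noteq> j" "i \<noteq> l" for i j l
    using bt[of j l i j] that by simp
  have off: "b i j = b k l" if "i \<noteq> j" "k \<noteq> l" for i j k l
  proof (cases "i = l")
    case True
    then show ?thesis using off1[of i j k] that bsym[of i k] by auto
  next
    case False
    then show ?thesis using off1[of i j l] off1[of l i k] that bsym[of i l] bsym[of k l] by auto
  qed
  have sum_l: "q (\<Sum>i\<in>I. a i *\<^sub>R c i) w = (\<Sum>i\<in>I. a i * q (c i) w)" if "w \<in> V" for I :: "'b set" and a w
  proof -
    have "finite I" by simp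
    then show ?thesis
    proof (induction I rule: finite_induct)
      case empty then show ?case using lin(6)[OF that subspace_V] by (simp add: q_def)
    next
      case (insert i I)
      have "(\<Sum>i\<in>I. a i *\<^sub>R c i) \<in> V" by (intro subspace_sum subspace_scale subspace_V c_V)
      then show ?case using insert that subspace_scale[OF subspace_V c_V]
        by (simp add: q_def lin(3,5) c_V)
    qed
  qed
  have qdg: "q (dg a) (dg d) = (\<Sum>i\<in>UNIV. \<Sum>j\<in>UNIV. a i * d j * b i j)" for a d
  proof -
    have cd: "q (c i) (dg d) = (\<Sum>j\<in>UNIV. d j * b i j)" for i
    proof -
      have "q (c i) (dg d) = q (dg d) (c i)" by (simp add: q_def lin(1) c_V)
      also have "\<dots> = (\<Sum>j\<in>UNIV. d j * b i j)" unfolding dg_def by (simp add: sum_l c_V b_def bsym[unfolded b_def, of i])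
      finally show ?thesis .
    qed
    have "q (dg a) (dg d) = (\<Sum>i\<in>UNIV. a i * q (c i) (dg d))" unfolding dg_def[of a] by (rule sum_l) simp
    also have "\<dots> = (\<Sum>i\<in>UNIV. a i * (\<Sum>j\<in>UNIV. d j * b i j))" by (simp only: cd)
    finally show ?thesis by (simp add: sum_distrib_left mult_ac)
  qed
  obtain i0 :: 'b where True by blast
  \<comment> \<open>A frame with a single element has no off-diagonal value; the default 0 then puts
    the whole metric into \<open>\<alpha>\<close>.\<close>
  define \<beta> where "\<beta> = (if \<exists>j. j \<noteq> i0 then b i0 (SOME j. j \<noteq> i0) else 0)"
  define \<alpha> where "\<alpha> = b i0 i0 - \<beta>"
  have \<beta>: "b i j = \<beta>" if "i \<noteq> j" for i j
  proof -
    have ex: "\<exists>j. j \<noteq> i0" using that by metis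
    then have "(SOME j. j \<noteq> i0) \<noteq> i0" by (rule someI_ex)
    then show ?thesis using off[OF that, of i0 "SOME j. j \<noteq> i0"] ex by (simp add: \<beta>_def)
  qed
  have bij: "b i j = (if i = j then \<alpha> else 0) + \<beta>" for i j
    using diag[of i i0] \<beta>[of i j] by (auto simp: \<alpha>_def)
  have qdg2: "q (dg a) (dg d) = \<alpha> * (dg a \<bullet> dg d) + \<beta> * ((e \<bullet> dg a) * (e \<bullet> dg d))" for a d
  proof -
    have "(\<Sum>j\<in>UNIV. a i * d j * b i j) = \<alpha> * (a i * d i) + \<beta> * (a i * (\<Sum>j\<in>UNIV. d j))" for i
    proof -
      have "(\<Sum>j\<in>UNIV. a i * d j * b i j) =
          (\<Sum>j\<in>UNIV. (if i = j then \<alpha> * (a i * d j) else 0) + \<beta> * (a i * d j))"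
        by (intro sum.cong refl) (simp add: bij algebra_simps)
      then show ?thesis by (simp add: sum.distrib sum_distrib_left)
    qed
    then have "q (dg a) (dg d) = (\<Sum>i\<in>UNIV. \<alpha> * (a i * d i) + \<beta> * (a i * (\<Sum>j\<in>UNIV. d j)))"
      by (simp only: qdg)
    also have "\<dots> = \<alpha> * (\<Sum>i\<in>UNIV. a i * d i) + \<beta> * ((\<Sum>i\<in>UNIV. a i) * (\<Sum>j\<in>UNIV. d j))"
      unfolding sum.distrib sum_distrib_left[symmetric] sum_distrib_right[symmetric] ..
    finally show ?thesis by (simp add: dg_inner e_def)
  qed
  have "q (dg a) (dg a) > 0" if "a i \<noteq> 0" for a i
  proof -
    have "dg a \<noteq> 0" using that dg_inner_c(1)[where a = a and i = i] by (metis inner_zero_left)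
    then show ?thesis unfolding q_def by (rule pos[OF e_U dg_V])
  qed
  note qpos = this[unfolded qdg2]
  have "\<alpha> > 0"
  proof (cases "\<exists>j. j \<noteq> i0")
    case True
    then obtain j where j: "j \<noteq> i0" by blast
    \<comment> \<open>A trace-free diagonal vector kills the \<open>\<beta>\<close> term and
      isolates \<open>\<alpha>\<close>.\<close>
    let ?a = "\<lambda>i. (if i = i0 then 1 else 0) - (if i = j then 1 else 0) :: real"
    have "e \<bullet> dg ?a = 0" by (simp add: e_def dg_inner sum_subtractf)
    then have "\<alpha> * (dg ?a \<bullet> dg ?a) > 0" using qpos[of ?a i0] j by simp
    then show ?thesis using inner_ge_zero[of "dg ?a"] by (auto simp: zero_less_mult_iff)
  next
    case False
    then have u: "UNIV = {i0}" "\<beta> = 0" by (auto simp: \<beta>_def)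
    show ?thesis using qpos[of "\<lambda>_. 1" i0] u(2) by (simp add: dg_inner zero_less_mult_iff)
  qed
  moreover have "\<alpha> + real CARD('b) * \<beta> > 0"
  proof -
    \<comment> \<open>The unit element is the other test vector: its square length is n (\<alpha> +
      n \<beta>).\<close>
    have "\<alpha> * real CARD('b) + \<beta> * (real CARD('b) * real CARD('b)) > 0"
      using qpos[of "\<lambda>_. 1" i0] by (simp add: e_inner_e flip: e_def)
    then have "(\<alpha> + real CARD('b) * \<beta>) * real CARD('b) > 0" by (simp add: algebra_simps)
    then show ?thesis by (simp add: zero_less_mult_iff)
  qed
  moreover have "g x u v = \<alpha> * \<sigma> x u v + \<beta> * (\<tau> x u * \<tau> x v)" if x: "x \<in> U" "u \<in> V" "v \<in> V" for x u v
  proof -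
    have quu: "q u u = \<alpha> * (u \<bullet> u) + \<beta> * ((e \<bullet> u) * (e \<bullet> u))" if u: "u \<in> V" for u
    proof -
      obtain k a where k: "k \<in> K" "u = k (dg a)" using spectral u by blast
      have "e \<bullet> u = e \<bullet> dg a" using K_inner[OF k(1) e_V, of "dg a"] K_e[OF k(1)] k by simp
      then show ?thesis using k qK[OF k(1), of "dg a" "dg a"] qdg2[of a a] by (simp add: K_inner)
    qed
    \<comment> \<open>Two vectors need not be diagonal in a common frame, so the spectral theorem
      gives only the quadratic form; polarization recovers the bilinear one.\<close>
    have quv: "q u v = \<alpha> * (u \<bullet> v) + \<beta> * ((e \<bullet> u) * (e \<bullet> v))" if uv: "u \<in> V" "v \<in> V" for u v
    proof -
      have V': "u + v \<in> V" using uv subspace_V by (simp add: subspace_add)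
      have "q (u + v) (u + v) = q u u + 2 * q u v + q v v"
        using lin(3)[OF uv V'] lin(1)[OF uv(1) V'] lin(1)[OF uv(2) V'] lin(3)[OF uv uv(1)]
          lin(3)[OF uv uv(2)] lin(1)[OF uv] by (simp add: q_def)
      then show ?thesis unfolding quu[OF V'] quu[OF uv(1)] quu[OF uv(2)]
        by (simp add: inner_add_left inner_add_right inner_commute algebra_simps)
    qed
    obtain m n m' n' a where m: "str_pair m n m' n'" "m \<in> G" "m' \<in> G" "m e = x" "m (dg a) = u"
      using G_frame[OF x(1,2)] by metis
    define v0 where "v0 = m' v"
    have v0: "v0 \<in> V" "v = m v0" using str_pairD(7,10)[OF m(1) x(3)] by (simp_all add: v0_def)
    have "g x u v = q (dg a) v0" using gG[OF m(2) e_U dg_V v0(1), of a] m v0 by (simp add: q_def)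
    also have "\<dots> = \<alpha> * \<sigma> e (dg a) v0 + \<beta> * (\<tau> e (dg a) * \<tau> e v0)"
      using quv[of "dg a" v0] v0 by (simp add: sigma_e tau_e)
    also have "\<dots> = \<alpha> * \<sigma> x u v + \<beta> * (\<tau> x u * \<tau> x v)"
      using sigma_str_pair[OF m(1) e_U, of "dg a" v0] tau_str_pair[OF m(1) e_U] m v0 by auto
    finally show ?thesis .
  qed
  ultimately show ?thesis by (rule that)
qed

end

section \<open>Levi-Civita connection, curvature and geodesics of the cone\<close>

locale jordan_cone_metric = jordan_cone +
  fixes g :: "'a form_field" and \<alpha> \<beta> :: real
  assumes riem: "riemannian V U g"
    and \<alpha>: "\<alpha> > 0" and \<alpha>\<beta>: "\<alpha> + real CARD('b) * \<beta> > 0"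
    and g_eq: "x \<in> U \<Longrightarrow> u \<in> V \<Longrightarrow> v \<in> V \<Longrightarrow> g x u v = \<alpha> * \<sigma> x u v + \<beta> * (\<tau> x u * \<tau> x v)"
begin

lemma g_pos: "x \<in> U \<Longrightarrow> u \<in> V \<Longrightarrow> u \<noteq> 0 \<Longrightarrow> g x u u > 0"
  using riem by (simp add: riemannian_def)

lemma g_dir:
  assumes "x \<in> U" "u \<in> V" "v \<in> V" "w \<in> V"
  shows "has_dir_deriv (\<lambda>y. g y v w)
    (\<alpha> * (- 2 * \<sigma> x (gam x u v) w) - \<beta> * (\<sigma> x u v * \<tau> x w + \<tau> x v * \<sigma> x u w)) u x"
proof (rule has_dir_deriv_cong)
  have "has_dir_deriv (\<lambda>y. \<tau> y v * \<tau> y w) (- \<sigma> x u v * \<tau> x w + \<tau> x v * - \<sigma> x u w) u x"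
    by (rule has_dir_deriv_bilinear[OF bounded_bilinear_mult tau_dir tau_dir]) (use assms in auto)
  from has_dir_deriv_add[OF has_dir_deriv_bounded_linear[OF bounded_linear_mult_right[of \<alpha>] sigma_dir[OF assms]]
      has_dir_deriv_bounded_linear[OF bounded_linear_mult_right[of \<beta>] this]]
  have "has_dir_deriv (\<lambda>y. \<alpha> * \<sigma> y v w + \<beta> * (\<tau> y v * \<tau> y w))
    (\<alpha> * (- 2 * \<sigma> x (gam x u v) w) + \<beta> * (- \<sigma> x u v * \<tau> x w + \<tau> x v * - \<sigma> x u w)) u x" .
  moreover have "\<alpha> * (- 2 * \<sigma> x (gam x u v) w) + \<beta> * (- \<sigma> x u v * \<tau> x w + \<tau> x v * - \<sigma> x u w) =
    \<alpha> * (- 2 * \<sigma> x (gam x u v) w) - \<beta> * (\<sigma> x u v * \<tau> x w + \<tau> x v * \<sigma> x u w)"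
    by (simp add: algebra_simps)
  ultimately show "has_dir_deriv (\<lambda>y. \<alpha> * \<sigma> y v w + \<beta> * (\<tau> y v * \<tau> y w))
    (\<alpha> * (- 2 * \<sigma> x (gam x u v) w) - \<beta> * (\<sigma> x u v * \<tau> x w + \<tau> x v * \<sigma> x u w)) u x"
    by metis
qed (use assms g_eq in auto)

text \<open>The subspace \<open>S\<close> is \<open>V\<close> for the cone and the span of the frame for the torus.\<close>

lemma levi_civita_gam:
  assumes S: "S \<subseteq> V" "subspace S" and x: "x \<in> U" "u \<in> S" "v \<in> S" "gam x u v \<in> S"
    and h: "\<And>y u v. y \<in> T' \<Longrightarrow> u \<in> S \<Longrightarrow> v \<in> S \<Longrightarrow> h y u v = g y u v"
    and T': "open_subset S T'" "T' \<subseteq> U" "x \<in> T'"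
  shows "levi_civita S h x u v = - gam x u v"
proof -
  have V: "w \<in> V" if "w \<in> S" for w using S that by blast
  have dd: "dir_deriv (\<lambda>y. h y b d) a x =
      \<alpha> * (- 2 * \<sigma> x (gam x a b) d) - \<beta> * (\<sigma> x a b * \<tau> x d + \<tau> x b * \<sigma> x a d)"
    if "a \<in> S" "b \<in> S" "d \<in> S" for a b d
  proof (rule dir_deriv_eq, rule open_subset.has_dir_deriv_cong[OF T'(1)])
    show "g y b d = h y b d" if "y \<in> T'" for y
      using h[OF that \<open>b \<in> S\<close> \<open>d \<in> S\<close>] by simp
  qed (use g_dir[of x a b d] V that x T' in auto)
  \<comment> \<open>In the Koszul combination the three terms \<open>\<sigma> x (gam ...)\<close>
    are equal, so one of them survives with its factor, and the \<beta> terms without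
    \<open>\<tau> x w\<close> cancel in pairs.\<close>
  have K: "2 * h x (- gam x u v) w = dir_deriv (\<lambda>y. h y v w) u x + dir_deriv (\<lambda>y. h y u w) v x
      - dir_deriv (\<lambda>y. h y u v) w x" if w: "w \<in> S" for w
  proof -
    have V': "u \<in> V" "v \<in> V" "w \<in> V" "x \<in> U" using V x w by auto
    have gs: "- gam x u v \<in> S" using x(4) S(2) by (rule subspace_neg[rotated])
    have "h x (- gam x u v) w = - (\<alpha> * \<sigma> x (gam x u v) w + \<beta> * (\<sigma> x u v * \<tau> x w))"
      using h[OF T'(3) gs w] g_eq[OF V'(4) V[OF gs] V'(3)] V'
      by (simp add: sigma_linear tau_linear tau_gam)
    moreover have "\<sigma> x (gam x v u) w = \<sigma> x (gam x u v) w" by (simp add: gam_comm)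
    moreover have "\<sigma> x (gam x w u) v = \<sigma> x (gam x u v) w"
      using sigma_gam[of x u w v] V' gam_comm by metis
    moreover have "\<sigma> x v u = \<sigma> x u v" "\<sigma> x w v = \<sigma> x v w" "\<sigma> x w u = \<sigma> x u w"
      using sigma_comm V' by auto
    ultimately show ?thesis unfolding dd[OF x(2,3) w] dd[OF x(3,2) w] dd[OF w x(2,3)]
      by (simp add: algebra_simps)
  qed
  show ?thesis unfolding levi_civita_def
  proof (rule the_equality)
    show "- gam x u v \<in> S \<and> (\<forall>w\<in>S. 2 * h x (- gam x u v) w = dir_deriv (\<lambda>y. h y v w) u x +
        dir_deriv (\<lambda>y. h y u w) v x - dir_deriv (\<lambda>y. h y u v) w x)"
      using K x(4) S(2) subspace_neg by blast
    fix c assume c: "c \<in> S \<and> (\<forall>w\<in>S. 2 * h x c w = dir_deriv (\<lambda>y. h y v w) u x +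
        dir_deriv (\<lambda>y. h y u w) v x - dir_deriv (\<lambda>y. h y u v) w x)"
    let ?d = "c - - gam x u v"
    have dS: "?d \<in> S" "- gam x u v \<in> S" using c x(4) S(2) by (auto intro: subspace_diff subspace_neg subspace_add)
    have "g x c ?d = g x (- gam x u v) ?d"
      using c K[OF dS(1)] dS h[OF T'(3)] by auto
    then have "g x ?d ?d = 0"
      using symmetric_form_fieldD(4)[of V U g x c "- gam x u v" ?d] riem V c dS x
      by (simp add: riemannian_def)
    then show "c = - gam x u v" using g_pos[OF x(1) V[OF dS(1)]]
      by (metis eq_iff_diff_eq_0 less_irrefl)
  qed
qed

lemma open_subset_VU: "open_subset V U" by unfold_locales

lemma levi_civita_U:
  assumes "x \<in> U" "u \<in> V" "v \<in> V" shows "levi_civita V g x u v = - gam x u v"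
  by (rule levi_civita_gam[OF order_refl subspace_V assms gam_V[OF assms] refl open_subset_VU order_refl assms(1)])

lemma curvature_U:
  assumes x: "x \<in> U" and V: "u \<in> V" "v \<in> V" "w \<in> V"
  shows "curvature (levi_civita V g) x u v w =
    Q v w (Q (jinv x) (jinv x) u) - Q u w (Q (jinv x) (jinv x) v) + gam x u (gam x v w) - gam x v (gam x u w)"
proof -
  have dd: "dir_deriv (\<lambda>y. levi_civita V g y b d) a x = Q b d (Q (jinv x) (jinv x) a)"
    if "a \<in> V" "b \<in> V" "d \<in> V" for a b d
  proof (rule dir_deriv_eq, rule has_dir_deriv_cong)
    show "has_dir_deriv (\<lambda>y. - gam y b d) (Q b d (Q (jinv x) (jinv x) a)) a x"
      using has_dir_deriv_bounded_linear[OF bounded_linear_minus[OF bounded_linear_ident] gam_dir[OF x that(1)]]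
      by simp
  qed (use levi_civita_U that x in auto)
  have nV: "- gam x a b \<in> V" if "a \<in> V" "b \<in> V" for a b
    using gam_V[OF x that] subspace_V subspace_neg by blast
  show ?thesis unfolding curvature_def
    using levi_civita_U[OF x] nV V by (simp add: dd gam_linear)
qed

text \<open>One structure map brings the base point to \<open>e\<close> and \<open>u\<close> to a
  diagonal \<open>d\<close>, while \<open>v\<close> stays arbitrary; the sign of the numerator is
  then exactly the axiom \<open>curv_dg\<close>.\<close>

lemma nonpositive: "nonpositive_curvature V U g"
  unfolding nonpositive_curvature_def
proof (intro ballI impI)
  fix x u v assume x: "x \<in> U" "u \<in> V" "v \<in> V"
  obtain m n m' n' a where m: "str_pair m n m' n'" "m e = x" "n e = jinv x" "m (dg a) = u"
    using G_frame[OF x(1,2)] by metis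
  define d v0 where "d = dg a" and "v0 = m' v"
  have V: "d \<in> V" "v0 \<in> V" by (simp_all add: d_def v0_def str_pairD(7)[OF m(1) x(3)])
  have mm: "m d = u" "m v0 = v" using m str_pairD(10)[OF m(1) x(3)] by (simp_all add: d_def v0_def)
  define R where "R = Q v0 v0 d - Q d v0 v0 + jmul d (jmul v0 v0) - jmul v0 (jmul d v0)"
  have RV: "R \<in> V" unfolding R_def
    by (intro subspace_diff subspace_add subspace_V Q_V jmul_V V)
  have P: "Q (jinv x) (jinv x) u = n d" "Q (jinv x) (jinv x) v = n v0"
    using P_str_pair[OF m(1) e_U V(1)] P_str_pair[OF m(1) e_U V(2)] V m(2) mm by (simp_all add: jinv_e Q_unit)
  have gm: "gam x (m a) (m b) = m (jmul a b)" if "a \<in> V" "b \<in> V" for a b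
    using gam_str_pair[OF m(1) e_U that] m(2) that by (simp add: gam_e)
  have "curvature (levi_civita V g) x u v v =
      Q (m v0) (m v0) (n d) - Q (m d) (m v0) (n v0) + m (jmul d (jmul v0 v0)) - m (jmul v0 (jmul d v0))"
    unfolding curvature_U[OF x x(3)] P unfolding mm[symmetric] using V by (simp add: gm jmul_V)
  also have "\<dots> = m R"
    unfolding R_def using V str_pairD(14)[OF m(1)]
    by (simp add: linear_diff[OF str_pairD(1)[OF m(1)]] linear_add[OF str_pairD(1)[OF m(1)]])
  finally have curv: "curvature (levi_civita V g) x u v v = m R" .
  \<comment> \<open>This cancels the contribution of \<open>jmul d (jmul v0 v0)\<close> to
    \<open>R . d\<close>, leaving P(v0) d . d minus the square length of
    \<open>jmul d v0\<close>.\<close>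
  have 1: "Q d v0 v0 \<bullet> d = jmul v0 v0 \<bullet> jmul d d"
  proof -
    have "Q d v0 v0 \<bullet> d = v0 \<bullet> Q d v0 d" using V by (simp add: Q_adj)
    also have "Q d v0 d = jmul (jmul d d) v0"
      using Q_shift_dg[OF V(2), of a] by (simp add: d_def jmul_dg power2_eq_square)
    also have "v0 \<bullet> jmul (jmul d d) v0 = jmul v0 v0 \<bullet> jmul d d"
      using V jmul_comm[of "jmul d d" v0] jmul_adj[of v0 v0 "jmul d d"] by (simp add: jmul_V)
    finally show ?thesis .
  qed
  have "jmul d (jmul v0 v0) \<bullet> d = jmul v0 v0 \<bullet> jmul d d" using V by (simp add: jmul_adj jmul_V)
  moreover have "jmul v0 (jmul d v0) \<bullet> d = jmul d v0 \<bullet> jmul d v0"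
    using V jmul_comm[of v0 d] by (simp add: jmul_adj jmul_V)
  ultimately have Rd: "R \<bullet> d \<le> 0"
    using curv_dg[OF V(2), of a] 1 by (simp add: R_def inner_add_left inner_diff_left d_def)
  \<comment> \<open>The curvature vector is trace-free at \<open>e\<close>, so the \<beta> part of
    the metric does not see it.\<close>
  have "e \<bullet> R = 0"
  proof -
    have ej: "e \<bullet> jmul a b = a \<bullet> b" if "a \<in> V" "b \<in> V" for a b
      using jmul_adj[OF that e_V] jmul_comm[OF that(1) e_V] that by (simp add: inner_commute)
    have "e \<bullet> Q v0 v0 d = jmul v0 v0 \<bullet> d" "e \<bullet> Q d v0 v0 = jmul d v0 \<bullet> v0"
      using V by (simp_all add: Q_e flip: Q_adj)
    then show ?thesis using V jmul_adj[of d v0 v0]  jmul_comm[of v0 d] jmul_adj[of v0 d v0] jmul_adj[of v0 v0 d]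
      by (simp add: R_def inner_add_right inner_diff_right ej jmul_V inner_commute)
  qed
  then have "g x (m R) u = \<alpha> * (R \<bullet> d)"
    using g_eq[OF x(1) _ x(2), of "m R"] str_pairD(5)[OF m(1) RV] sigma_str_pair[OF m(1) e_U RV V(1)]
      tau_str_pair[OF m(1) e_U RV] m(2) mm RV by (simp add: sigma_e tau_e)
  then have "g x (curvature (levi_civita V g) x u v v) u \<le> 0"
    using Rd \<alpha> by (simp add: curv mult_nonneg_nonpos)
  moreover have "g x u u * g x v v - (g x u v)\<^sup>2 \<ge> 0"
    using form_field_cauchy_schwarz[OF riem x subspace_V] by simp
  ultimately show "sectional V g x u v \<le> 0"
    unfolding sectional_def by (rule divide_nonpos_nonneg)
qed

text \<open>The geodesics can be written down: in the frame that diagonalizes the initial velocity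
  each diagonal coordinate is an exponential, and exponentials solve f'' = f'^2 / f for all
  times.\<close>

lemma complete: "geodesically_complete V U g"
  unfolding geodesically_complete_def
proof (intro ballI)
  fix x v assume x: "x \<in> U" "v \<in> V"
  obtain m n m' n' a where m: "str_pair m n m' n'" "m e = x" "m (dg a) = v"
    using G_frame[OF x] by metis
  \<comment> \<open>The weight \<open>r\<close> lets one family contain the curve
    (\<open>r = 1\<close>), its velocity (\<open>r = a\<close>) and its acceleration
    (\<open>r = a^2\<close>).\<close>
  let ?f = "\<lambda>r t. m (dg (\<lambda>i. r i * exp (a i * t)))"
  have d: "(?f r has_vector_derivative ?f (\<lambda>i. r i * a i) t) (at t)" for r t
    by (rule curve_deriv[OF str_pairD(1)[OF m(1)]]) (auto intro!: derivative_eq_intros)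
  have fU: "?f (\<lambda>_. 1) t \<in> U" for t using str_pairD(16)[OF m(1)] dg_U by simp
  have fV: "?f r t \<in> V" for r t using str_pairD(5)[OF m(1)] by simp
  have gamf: "gam (?f (\<lambda>_. 1) t) (?f a t) (?f a t) = ?f (\<lambda>i. a i * a i) t" for t
  proof -
    have "gam (?f (\<lambda>_. 1) t) (?f a t) (?f a t) =
        m (gam (dg (\<lambda>i. exp (a i * t))) (dg (\<lambda>i. a i * exp (a i * t))) (dg (\<lambda>i. a i * exp (a i * t))))"
      using gam_str_pair[OF m(1), of "dg (\<lambda>i. exp (a i * t))"] dg_U by simp
    then show ?thesis by (simp add: gam_def jinv_dg Q_dg field_simps)
  qed
  have lc: "levi_civita V g (?f (\<lambda>_. 1) t) (?f a t) (?f a t) = - ?f (\<lambda>i. a i * a i) t" for t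
    unfolding levi_civita_U[OF fU fV fV] gamf ..
  have "geodesic V U g UNIV (?f (\<lambda>_. 1))"
    unfolding geodesic_def
  proof (intro conjI)
    show "\<exists>\<gamma>' \<gamma>''. \<forall>t\<in>UNIV. (?f (\<lambda>_. 1) has_vector_derivative \<gamma>' t) (at t) \<and>
        (\<gamma>' has_vector_derivative \<gamma>'' t) (at t) \<and>
        \<gamma>'' t + levi_civita V g (?f (\<lambda>_. 1) t) (\<gamma>' t) (\<gamma>' t) = 0"
      by (rule exI[of _ "?f a"], rule exI[of _ "?f (\<lambda>i. a i * a i)"], intro ballI conjI)
        (use d[of "\<lambda>_. 1"] d[of a] lc in simp_all)
  qed (use fU in auto)
  moreover have "?f (\<lambda>_. 1) 0 = x" using m(2) by (simp add: e_def)
  moreover have "(?f (\<lambda>_. 1) has_vector_derivative v) (at 0)" using d[of "\<lambda>_. 1" 0] m(3) by simp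
  ultimately show "\<exists>\<gamma>. geodesic V U g UNIV \<gamma> \<and> \<gamma> 0 = x \<and> (\<gamma> has_vector_derivative v) (at 0)" by blast
qed

lemma cartan_hadamard: "cartan_hadamard V U g"
  unfolding cartan_hadamard_def
  using riem complete nonpositive convex_imp_simply_connected[OF U_convex] by blast

lemma geodesic_in_flat:
  assumes geo: "geodesic V U g J \<gamma>" shows "\<exists>k\<in>G. \<gamma> ` J \<subseteq> k ` T"
proof (cases "J = {}")
  \<comment> \<open>The definition of a geodesic admits the empty interval, for which any element of
    \<open>G\<close> will do.\<close>
  case True then show ?thesis using K_id K_G by blast
next
  case False
  then obtain s where s: "s \<in> J" by blast
  obtain \<gamma>' \<gamma>'' where J: "open J" "is_interval J" "\<gamma> ` J \<subseteq> U"
    and d: "\<And>t. t \<in> J \<Longrightarrow> (\<gamma> has_vector_derivative \<gamma>' t) (at t)"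
      "\<And>t. t \<in> J \<Longrightarrow> (\<gamma>' has_vector_derivative \<gamma>'' t) (at t)"
      "\<And>t. t \<in> J \<Longrightarrow> \<gamma>'' t + levi_civita V g (\<gamma> t) (\<gamma>' t) (\<gamma>' t) = 0"
    using geo unfolding geodesic_def by metis
  have \<gamma>U: "\<gamma> t \<in> U" if "t \<in> J" for t using J(3) that by blast
  have \<gamma>'V: "\<gamma>' t \<in> V" if "t \<in> J" for t
    using subspace_has_vector_derivative[OF subspace_V J(1) that _ d(1)[OF that]] J(3) U_V by blast
  have eq: "\<gamma>'' t = gam (\<gamma> t) (\<gamma>' t) (\<gamma>' t)" if "t \<in> J" for t
    using d(3)[OF that] levi_civita_U[OF \<gamma>U[OF that] \<gamma>'V[OF that] \<gamma>'V[OF that]] by simp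
  have convJ: "convex J" using J(2) by (simp add: is_interval_convex)
  have dj: "((\<lambda>t. jinv (\<gamma> t)) has_vector_derivative - Q (jinv (\<gamma> t)) (jinv (\<gamma> t)) (\<gamma>' t)) (at t)"
    if t: "t \<in> J" for t
  proof -
    have "(jinv has_derivative (\<lambda>u. - Q (jinv (\<gamma> t)) (jinv (\<gamma> t)) u)) (at (\<gamma> t) within \<gamma> ` J)"
      by (rule has_derivative_subset[OF jinv_derivative[OF \<gamma>U[OF t]] J(3)])
    from vector_derivative_diff_chain_within[OF has_vector_derivative_at_within[OF d(1)[OF t]] this]
    show ?thesis using at_within_open[OF t J(1)] by (simp add: o_def)
  qed
  text \<open>The operator \<open>z \<mapsto> Q (\<gamma>' t) z (jinv (\<gamma> t))\<close> is the moment map of the geodesic flow, hence constant.\<close>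
  have const: "Q (\<gamma>' t) z (jinv (\<gamma> t)) = Q (\<gamma>' s) z (jinv (\<gamma> s))" if z: "z \<in> V" and t: "t \<in> J" for z t
  proof -
    let ?M = "\<lambda>t. Q (\<gamma>' t) z (jinv (\<gamma> t))"
    have "(?M has_vector_derivative 0) (at r within J)" if r: "r \<in> J" for r
    proof -
      have "(?M has_vector_derivative Q (\<gamma>' r) z (- Q (jinv (\<gamma> r)) (jinv (\<gamma> r)) (\<gamma>' r)) + Q (\<gamma>'' r) z (jinv (\<gamma> r))) (at r)"
        by (rule bounded_bilinear.has_vector_derivative[OF bounded_bilinear_Q13 d(2)[OF r] dj[OF r]])
      moreover have "Q (\<gamma>' r) z (- Q (jinv (\<gamma> r)) (jinv (\<gamma> r)) (\<gamma>' r)) + Q (\<gamma>'' r) z (jinv (\<gamma> r)) = 0"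
        using Q_shift[OF \<gamma>U[OF r] \<gamma>'V[OF r] z] by (simp add: eq[OF r] Q_linear)
      ultimately show ?thesis by (simp add: has_vector_derivative_at_within)
    qed
    then obtain C where "\<And>r. r \<in> J \<Longrightarrow> ?M r = C"
      using has_vector_derivative_zero_constant[OF convJ] by blast
    then show ?thesis using s t by simp
  qed
  define L where "L z = Q (\<gamma>' s) z (jinv (\<gamma> s))" for z
  \<comment> \<open>Apply the constant operator to the current point \<open>z = \<gamma> t\<close>:
    by \<open>gam_x\<close> its value there is the velocity.\<close>
  have ode: "\<gamma>' t = L (\<gamma> t)" if t: "t \<in> J" for t
    using const[OF U_V[OF \<gamma>U[OF t]] t] gam_x[OF \<gamma>U[OF t] \<gamma>'V[OF t]] gam_comm
    by (simp add: L_def gam_def)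
  obtain B where B: "\<And>z. norm (L z) \<le> B * norm z"
    using linear_bounded[of L] Q_lin2 unfolding L_def by blast
  obtain m n m' n' a where m: "str_pair m n m' n'" "m \<in> G" "m e = \<gamma> s" "n e = jinv (\<gamma> s)" "m (dg a) = \<gamma>' s"
    using G_frame[OF \<gamma>U[OF s] \<gamma>'V[OF s]] by metis
  define E where "E t = dg (\<lambda>i. exp (a i * (t - s)))" for t
  have dE: "((\<lambda>t. m (E t)) has_vector_derivative L (m (E t))) (at t)" for t
  proof -
    have "((\<lambda>t. m (E t)) has_vector_derivative m (dg (\<lambda>i. a i * exp (a i * (t - s))))) (at t)"
      unfolding E_def
      by (rule curve_deriv[OF str_pairD(1)[OF m(1)]]) (auto intro!: derivative_eq_intros)
    moreover have "L (m (E t)) = m (dg (\<lambda>i. a i * exp (a i * (t - s))))"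
      using str_pairD(14)[OF m(1), of "dg a" "E t" e] m by (simp add: L_def E_def Q_dg e_def)
    ultimately show ?thesis by simp
  qed
  \<comment> \<open>Both curves solve the equation given by \<open>L\<close> and agree at
    \<open>s\<close>, so their difference is covered by \<open>linear_ode_zero\<close>.\<close>
  have "\<gamma> t - m (E t) = 0" if t: "t \<in> J" for t
  proof (rule linear_ode_zero[OF convJ s t _ B])
    show "\<gamma> s - m (E s) = 0" using m(3) by (simp add: E_def e_def)
    fix r assume r: "r \<in> J"
    show "((\<lambda>t. \<gamma> t - m (E t)) has_vector_derivative L (\<gamma> r - m (E r))) (at r)"
      using has_vector_derivative_diff[OF d(1)[OF r] dE[of r]] ode[OF r] by (simp add: L_def Q_linear)
  qed
  note \<gamma>E = this
  have "\<gamma> t \<in> m ` T" if "t \<in> J" for t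
  proof (rule image_eqI)
    show "\<gamma> t = m (E t)" using \<gamma>E[OF that] by simp
    show "E t \<in> T" by (auto simp: E_def T_def)
  qed
  then show ?thesis using m(2) by blast
qed

end

section \<open>Frobenius structures\<close>

lemma riemannian_nondegenerate: "riemannian V U g \<Longrightarrow> nondegenerate V U g"
  unfolding riemannian_def nondegenerate_def by (metis less_irrefl)

text \<open>For \<open>z = u \<circ> v\<close> this is the coordinate formula (iv) for the product, as \<open>A(u, v, w) = g(u \<circ> v, w)\<close>.\<close>

lemma product_in_frame:
  assumes V: "subspace V" and s: "symmetric_form_field V U g" and x: "x \<in> U"
    and B: "B \<subseteq> V" "independent B" "span B = V"
    and ginv: "\<And>a c. a \<in> B \<Longrightarrow> c \<in> B \<Longrightarrow> (\<Sum>e\<in>B. g x a e * ginv e c) = (if a = c then 1 else 0)"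
    and z: "z \<in> V"
  shows "z = (\<Sum>c\<in>B. (\<Sum>e\<in>B. g x z e * ginv e c) *\<^sub>R c)"
proof -
  have fin: "finite B" using B(2) independent_imp_finite by blast
  obtain r where r: "z = (\<Sum>b\<in>B. r b *\<^sub>R b)"
    using z B(3) span_finite[OF fin] by auto
  have lin: "g x (\<Sum>b\<in>I. r b *\<^sub>R b) w = (\<Sum>b\<in>I. r b * g x b w)" if "I \<subseteq> B" "w \<in> V" for I w
    using finite_subset[OF that(1) fin] that(1)
  proof (induction I rule: finite_induct)
    case empty then show ?case using symmetric_form_fieldD(6)[OF s x that(2) V] by simp
  next
    case (insert b I)
    have "(\<Sum>b\<in>I. r b *\<^sub>R b) \<in> V" using insert B(1) V by (intro subspace_sum subspace_scale) auto
    moreover have "b \<in> V" "r b *\<^sub>R b \<in> V" using insert B(1) V by (auto intro: subspace_scale)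
    ultimately show ?case using insert that(2)
      by (simp add: symmetric_form_fieldD(3)[OF s x] symmetric_form_fieldD(5)[OF s x])
  qed
  have "(\<Sum>e\<in>B. g x z e * ginv e c) = r c" if c: "c \<in> B" for c
  proof -
    have "(\<Sum>e\<in>B. g x z e * ginv e c) = (\<Sum>e\<in>B. \<Sum>b\<in>B. r b * g x b e * ginv e c)"
      using B(1) lin[OF order_refl] by (intro sum.cong refl) (auto simp: r sum_distrib_right subset_iff)
    also have "\<dots> = (\<Sum>b\<in>B. r b * (\<Sum>e\<in>B. g x b e * ginv e c))"
      by (subst sum.swap) (simp add: sum_distrib_left mult.assoc)
    also have "\<dots> = r c" using c fin by (simp add: ginv if_distrib cong: if_cong)
    finally show ?thesis .
  qed
  then show ?thesis using r by simp
qed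

text \<open>Permutation-invariant symmetric forms are combinations of the standard form and the
  square of the sum; matching the two coefficients with \<alpha> and \<beta> fixes \<open>s\<close>
  and \<open>r\<close>.\<close>

lemma sum_of_squares_form:
  fixes a b :: "'n::finite \<Rightarrow> real" and s r :: real
  shows "(\<Sum>i\<in>UNIV. (s * a i + r * sum a UNIV) * (s * b i + r * sum b UNIV)) =
    s\<^sup>2 * (\<Sum>i\<in>UNIV. a i * b i) + (2 * s * r + real CARD('n) * r\<^sup>2) * (sum a UNIV * sum b UNIV)"
proof -
  define A B where "A = sum a UNIV" and "B = sum b UNIV"
  have "(\<Sum>i\<in>UNIV. (s * a i + r * A) * (s * b i + r * B)) =
      (\<Sum>i\<in>UNIV. s\<^sup>2 * (a i * b i) + (s * r * B) * a i + (s * r * A) * b i + r\<^sup>2 * A * B)"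
    by (intro sum.cong refl) (simp add: algebra_simps power2_eq_square)
  also have "\<dots> = s\<^sup>2 * (\<Sum>i\<in>UNIV. a i * b i) + (s * r * B) * A + (s * r * A) * B + real CARD('n) * (r\<^sup>2 * A * B)"
    by (simp add: sum.distrib A_def B_def flip: sum_distrib_left)
  also have "\<dots> = s\<^sup>2 * (\<Sum>i\<in>UNIV. a i * b i) + (2 * s * r + real CARD('n) * r\<^sup>2) * (A * B)"
    by (simp add: distrib_right)
  finally show ?thesis unfolding A_def B_def .
qed

text \<open>What remains of the Codazzi equation, with \<open>a\<close>, \<open>b\<close>,
  \<open>d\<close> the values of \<open>\<tau>\<close> at \<open>u\<close>, \<open>v\<close>,
  \<open>w\<close>. The coefficients of \<open>suw\<close> and \<open>svw\<close> are multiples of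
  \<alpha> p (1 + S) - \<beta>, and the terms in a b d cancel in pairs.\<close>

lemma codazzi_identity:
  fixes \<alpha> \<beta> p S a b d suw svw :: real
  assumes "\<beta> = \<alpha> * p * (1 + S)"
  shows "- \<beta> * (b * suw) + \<beta> * (a * svw) - p * a * (\<alpha> * svw + \<beta> * (d * b)) + p * b * (\<alpha> * suw + \<beta> * (d * a))
     + \<alpha> * S * (p\<^sup>2 * (a * d) + p * suw) * b - \<alpha> * S * (p\<^sup>2 * (b * d) + p * svw) * a = 0"
  unfolding assms by (simp add: algebra_simps power2_eq_square)

context jordan_cone_metric
begin

subsection \<open>The flat torus\<close>

lemma subspace_W: "subspace W"
proof -
  have W: "W = span (range c)"
  proof
    show "W \<subseteq> span (range c)" by (auto simp: W_def dg_def intro!: span_sum span_scale intro: span_base)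
    show "span (range c) \<subseteq> W"
    proof (rule span_minimal)
      show "range c \<subseteq> W" unfolding W_def using dg_c by blast
      have "0 = dg (\<lambda>_. 0)" by (simp add: dg_def)
      then show "subspace W" unfolding subspace_def W_def by (auto simp: dg_add dg_scale)
    qed
  qed
  then show ?thesis by simp
qed

lemma T_eq: "T = W \<inter> U"
  by (auto simp: T_def W_def dg_U)

lemma open_subset_WT: "open_subset W T"
proof
  show "subspace W" by (rule subspace_W)
  obtain O' where "open O'" "U = V \<inter> O'" using U_openin by (auto simp: openin_open)
  then have "T = W \<inter> O'" using W_V by (auto simp: T_eq)
  then show "openin (top_of_set W) T" using \<open>open O'\<close> by (auto simp: openin_open)
qed

lemma e_T: "e \<in> T" by (auto simp: e_def T_def)

lemma jinv_T: assumes "x \<in> T" shows "jinv x \<in> T"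
proof -
  obtain a where a: "x = dg a" "\<And>i. a i > 0" using assms by (auto simp: T_def)
  then have "jinv x = dg (\<lambda>i. inverse (a i))" "\<And>i. inverse (a i) > 0" by (simp_all add: jinv_dg)
  then show ?thesis unfolding T_def by blast
qed

lemma WV: "u \<in> W \<Longrightarrow> u \<in> V" using W_V by blast

lemma TU: "x \<in> T \<Longrightarrow> x \<in> U" using T_U by blast

lemma gam_W: "x \<in> T \<Longrightarrow> u \<in> W \<Longrightarrow> v \<in> W \<Longrightarrow> gam x u v \<in> W"
  using jinv_T[of x] by (auto simp: gam_def W_def T_def Q_dg)

lemma form_W: "symmetric_form_field W T g"
proof -
  have s: "symmetric_form_field V U g" using riem by (simp add: riemannian_def)
  show ?thesis unfolding symmetric_form_field_def
  proof (intro conjI ballI allI)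
    show "smooth W T (\<lambda>x. g x u v)" if "u \<in> W" "v \<in> W" for u v
      using s that WV by (intro smooth_subset[OF _ W_V T_U]) (auto simp: symmetric_form_field_def)
  qed (use symmetric_form_fieldD(1,2)[OF s TU] WV in blast)+
qed

lemma riem_W: "riemannian W T g"
  unfolding riemannian_def domain_in_def
  using form_W open_subset_WT e_T g_pos TU WV by (auto simp: open_subset_def)

lemma levi_civita_T: "x \<in> T \<Longrightarrow> u \<in> W \<Longrightarrow> v \<in> W \<Longrightarrow> levi_civita W g x u v = - gam x u v"
  by (rule levi_civita_gam[OF W_V subspace_W TU _ _ gam_W refl open_subset_WT T_U])

text \<open>On diagonal elements \<open>Q\<close> is the componentwise product of three factors, so
  the four terms of the curvature formula cancel by commutativity.\<close>

lemma flat_T: "flat W T (levi_civita W g)"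
  unfolding flat_def
proof (intro ballI)
  fix x u v w assume x: "x \<in> T" and W: "u \<in> W" "v \<in> W" "w \<in> W"
  interpret WT: open_subset W T by (rule open_subset_WT)
  have dd: "dir_deriv (\<lambda>y. levi_civita W g y b d) a x = Q b d (Q (jinv x) (jinv x) a)"
    if "a \<in> W" "b \<in> W" "d \<in> W" for a b d
  proof (rule dir_deriv_eq, rule WT.has_dir_deriv_cong)
    show "has_dir_deriv (\<lambda>y. - gam y b d) (Q b d (Q (jinv x) (jinv x) a)) a x"
      using has_dir_deriv_bounded_linear[OF bounded_linear_minus[OF bounded_linear_ident] gam_dir[OF TU[OF x] WV[OF that(1)]]]
      by simp
  qed (use levi_civita_T that x in auto)
  have nW: "- gam x a b \<in> W" if "a \<in> W" "b \<in> W" for a b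
    using gam_W[OF x that] subspace_W subspace_neg by blast
  have "curvature (levi_civita W g) x u v w =
    Q v w (Q (jinv x) (jinv x) u) - Q u w (Q (jinv x) (jinv x) v) + gam x u (gam x v w) - gam x v (gam x u w)"
    unfolding curvature_def using levi_civita_T[OF x] nW W by (simp add: dd gam_linear)
  also have "\<dots> = 0"
  proof -
    obtain p where "jinv x = dg p" using jinv_T[OF x] by (auto simp: T_def)
    moreover obtain a b d where "u = dg a" "v = dg b" "w = dg d" using W by (auto simp: W_def)
    ultimately show ?thesis
      by (simp add: gam_def Q_dg dg_add dg_diff mult_ac dg_def[of "\<lambda>_. 0"])
  qed
  finally show "curvature (levi_civita W g) x u v w = 0" .
qed

lemma isometric_T: "isometric_immersion W T g V U g (\<lambda>x. x)"
  unfolding isometric_immersion_def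
  using riem_W riem open_subset.smooth_id[OF open_subset_WT] T_U
  by (auto simp: dir_deriv_eq[OF has_dir_deriv_id])

text \<open>Both Levi-Civita connections are \<open>- gam\<close>, and \<open>gam\<close> maps
  diagonal vectors to diagonal vectors at points of the torus; the second fundamental form
  vanishes.\<close>

lemma totally_geodesic_T: "totally_geodesic_submanifold W T g V U g (\<lambda>x. x)"
  unfolding totally_geodesic_submanifold_def
proof (intro conjI allI impI)
  show "\<exists>\<kappa>. homeomorphism T ((\<lambda>x. x) ` T) (\<lambda>x. x) \<kappa>"
    by (rule exI[of _ "\<lambda>x. x"]) (simp add: homeomorphism_def)
  fix J \<gamma> assume geo: "geodesic W T g J \<gamma>"
  then obtain \<gamma>' \<gamma>'' where J: "open J" "is_interval J" "\<gamma> ` J \<subseteq> T"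
    and d: "\<And>t. t \<in> J \<Longrightarrow> (\<gamma> has_vector_derivative \<gamma>' t) (at t)"
      "\<And>t. t \<in> J \<Longrightarrow> (\<gamma>' has_vector_derivative \<gamma>'' t) (at t)"
      "\<And>t. t \<in> J \<Longrightarrow> \<gamma>'' t + levi_civita W g (\<gamma> t) (\<gamma>' t) (\<gamma>' t) = 0"
    unfolding geodesic_def by metis
  have "\<gamma>' t \<in> W" if "t \<in> J" for t
    using subspace_has_vector_derivative[OF subspace_W J(1) that _ d(1)[OF that]] J(3) T_W by blast
  then have lc: "levi_civita V g (\<gamma> t) (\<gamma>' t) (\<gamma>' t) = levi_civita W g (\<gamma> t) (\<gamma>' t) (\<gamma>' t)" if "t \<in> J" for t
    using that J(3) levi_civita_T levi_civita_U T_U WV by (auto simp: image_subset_iff subset_iff)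
  show "geodesic V U g J ((\<lambda>x. x) \<circ> \<gamma>)"
    unfolding geodesic_def
  proof (intro conjI)
    show "\<exists>\<gamma>' \<gamma>''. \<forall>t\<in>J. (((\<lambda>x. x) \<circ> \<gamma>) has_vector_derivative \<gamma>' t) (at t) \<and>
        (\<gamma>' has_vector_derivative \<gamma>'' t) (at t) \<and>
        \<gamma>'' t + levi_civita V g (((\<lambda>x. x) \<circ> \<gamma>) t) (\<gamma>' t) (\<gamma>' t) = 0"
      by (rule exI[of _ \<gamma>'], rule exI[of _ \<gamma>'']) (use d lc in \<open>simp add: o_def\<close>)
  qed (use J T_U in auto)
qed (rule isometric_T)

subsection \<open>The Frobenius structure on the torus\<close>

text \<open>In the logarithmic coordinates \<open>t\<^sub>i\<close> the metric is the constant form \<open>\<alpha> \<Sum> dt\<^sub>i\<^sup>2 + \<beta> (\<Sum> dt\<^sub>i)\<^sup>2\<close>. It is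
  the sum of the squares of the forms \<open>l\<^sub>i = s dt\<^sub>i + r \<Sum> dt\<^sub>j\<close>, and the product is taken componentwise
  in the coordinates belonging to them.\<close>

definition s :: real where "s = sqrt \<alpha>"
text \<open>In logarithmic coordinates the metric has eigenvalue \<alpha> on sum-zero vectors and
  \<alpha> + n \<beta> on the constant ones; \<open>s\<close> and \<open>t\<close> are their square
  roots. The forms act on the constant direction by \<open>s + n r\<close>, whence
  \<open>r\<close>.\<close>

definition t :: real where "t = sqrt (\<alpha> + real CARD('b) * \<beta>)"
definition r :: real where "r = (t - s) / real CARD('b)"

lemma s_pos: "s > 0" and t_pos: "t > 0"
  using \<alpha> \<alpha>\<beta> by (simp_all add: s_def t_def)

lemma t_eq: "t = s + real CARD('b) * r" by (simp add: r_def)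

lemma nr: "real CARD('b) * r = t - s" by (simp add: r_def)

lemma s_sq: "s\<^sup>2 = \<alpha>" using \<alpha> by (simp add: s_def)

lemma sr_eq: "2 * s * r + real CARD('b) * r\<^sup>2 = \<beta>"
proof -
  have "real CARD('b) * \<beta> = t\<^sup>2 - s\<^sup>2" using \<alpha> \<alpha>\<beta> by (simp add: s_def t_def)
  also have "\<dots> = real CARD('b) * (2 * s * r + real CARD('b) * r\<^sup>2)"
    unfolding t_eq by (simp add: power2_eq_square algebra_simps)
  finally show ?thesis by simp
qed

text \<open>With \<open>M\<close> the form \<open>l i\<close> becomes a pairing with
  \<open>jinv x\<close>, so its smoothness and derivatives come from those of
  \<open>jinv\<close>.\<close>

definition M :: "'b \<Rightarrow> 'a \<Rightarrow> 'a" where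
  "M i u = s *\<^sub>R ((u \<bullet> c i) *\<^sub>R c i) + r *\<^sub>R (\<Sum>j\<in>UNIV. (u \<bullet> c j) *\<^sub>R c j)"

definition l :: "'b \<Rightarrow> 'a \<Rightarrow> 'a \<Rightarrow> real" where "l i x u = jinv x \<bullet> M i u"

text \<open>The inverse of s I + r J, with J the all-ones matrix, is (I - (r/t) J) / s; the factor
  \<open>x . c i\<close> undoes the division by the coordinates of \<open>x\<close>.\<close>

definition linv :: "'a \<Rightarrow> ('b \<Rightarrow> real) \<Rightarrow> 'a" where
  "linv x y = dg (\<lambda>i. (x \<bullet> c i) * ((y i - r / t * (\<Sum>j\<in>UNIV. y j)) / s))"

text \<open>The primitive of the form \<open>l i\<close>: these functions are flat orthonormal
  coordinates of the torus.\<close>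

definition L :: "'b \<Rightarrow> 'a \<Rightarrow> real" where
  "L i x = s * ln (x \<bullet> c i) + r * (\<Sum>j\<in>UNIV. ln (x \<bullet> c j))"

lemma M_bl: "bounded_linear (M i)"
  unfolding M_def linear_conv_bounded_linear[symmetric]
proof (rule linearI, goal_cases)
  case 1 show ?case by (simp add: inner_add_left scaleR_add_left scaleR_add_right sum.distrib)
next
  case 2 show ?case by (simp add: scaleR_add_right scaleR_sum_right mult_ac)
qed

lemma l_dg: assumes "\<And>i. p i > 0"
  shows "l i (dg p) (dg a) = s * (a i / p i) + r * (\<Sum>j\<in>UNIV. a j / p j)"
  using assms by (simp add: l_def M_def jinv_dg inner_add_right inner_sum_right divide_inverse)

lemma l_linear: "l i x (a *\<^sub>R u + b *\<^sub>R v) = a * l i x u + b * l i x v"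
  by (simp add: l_def linear_add[OF bounded_linear.linear[OF M_bl]] linear_scale[OF bounded_linear.linear[OF M_bl]]
    inner_add_right)

lemma l_linv: assumes "x \<in> T" shows "l i x (linv x y) = y i"
proof -
  obtain p where p: "x = dg p" "\<And>i. p i > 0" using assms by (auto simp: T_def)
  have p0: "p i \<noteq> 0" for i using p(2)[of i] by simp
  let ?Y = "\<Sum>j\<in>UNIV. y j"
  have "(\<Sum>j\<in>UNIV. (y j - r / t * ?Y) / s) = (?Y - real CARD('b) * (r / t * ?Y)) / s"
    by (simp add: sum_subtractf flip: sum_divide_distrib)
  also have "real CARD('b) * (r / t * ?Y) = (real CARD('b) * r) / t * ?Y" by simp
  also have "(?Y - (real CARD('b) * r) / t * ?Y) / s = ?Y / t"
    unfolding nr using s_pos t_pos by (simp add: field_simps)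
  finally have *: "(\<Sum>j\<in>UNIV. (y j - r / t * ?Y) / s) = ?Y / t" .
  have "l i x (linv x y) = s * ((y i - r / t * ?Y) / s) + r * (\<Sum>j\<in>UNIV. (y j - r / t * ?Y) / s)"
    unfolding linv_def p(1) l_dg[OF p(2)] by (simp add: p0)
  then show ?thesis unfolding * using s_pos by simp
qed

lemma linv_l: assumes "x \<in> T" "u \<in> W" shows "linv x (\<lambda>i. l i x u) = u"
proof -
  obtain p where p: "x = dg p" "\<And>i. p i > 0" using assms by (auto simp: T_def)
  have p0: "p i \<noteq> 0" for i using p(2)[of i] by simp
  obtain a where a: "u = dg a" using assms by (auto simp: W_def)
  let ?Z = "\<Sum>j\<in>UNIV. a j / p j"
  have "(\<Sum>i\<in>UNIV. l i x u) = t * ?Z"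
    unfolding p(1) a l_dg[OF p(2)] sum.distrib sum_distrib_left[symmetric] t_eq
    by (simp add: algebra_simps)
  then have "linv x (\<lambda>i. l i x u) = dg (\<lambda>i. p i * ((l i x u - r * ?Z) / s))"
    using t_pos by (simp add: linv_def p(1))
  also have "\<dots> = u" unfolding p(1) a l_dg[OF p(2)] using s_pos by (simp add: p0)
  finally show ?thesis .
qed

lemma linv_W: "linv x y \<in> W" by (simp add: linv_def W_def)

lemma g_l: assumes "x \<in> T" "u \<in> W" "v \<in> W" shows "g x u v = (\<Sum>i\<in>UNIV. l i x u * l i x v)"
proof -
  obtain p where p: "x = dg p" "\<And>i. p i > 0" using assms by (auto simp: T_def)
  obtain a b where ab: "u = dg a" "v = dg b" using assms by (auto simp: W_def)
  define a' b' where "a' i = a i / p i" and "b' i = b i / p i" for i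
  define A B where "A = sum a' UNIV" and "B = sum b' UNIV"
  have jx: "jinv x = dg (\<lambda>i. inverse (p i))" using p(2) by (simp add: p(1) jinv_dg)
  have "\<sigma> x u v = (\<Sum>i\<in>UNIV. inverse (p i) * inverse (p i) * a i * b i)"
    by (simp only: \<sigma>_def jx ab Q_dg dg_inner)
  also have "\<dots> = (\<Sum>i\<in>UNIV. a' i * b' i)"
    by (intro sum.cong refl) (simp add: a'_def b'_def divide_inverse)
  finally have \<sigma>: "\<sigma> x u v = (\<Sum>i\<in>UNIV. a' i * b' i)" .
  have \<tau>: "\<tau> x u = A" "\<tau> x v = B"
    unfolding \<tau>_def jx ab dg_inner A_def B_def a'_def b'_def divide_inverse
    by (auto intro!: sum.cong simp: mult.commute)
  have "g x u v = \<alpha> * (\<Sum>i\<in>UNIV. a' i * b' i) + \<beta> * (A * B)"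
    using g_eq[OF TU[OF assms(1)] WV[OF assms(2)] WV[OF assms(3)]] by (simp only: \<sigma> \<tau>)
  moreover have "(\<Sum>i\<in>UNIV. l i x u * l i x v) =
      (\<Sum>i\<in>UNIV. (s * a' i + r * sum a' UNIV) * (s * b' i + r * sum b' UNIV))"
    unfolding p(1) ab l_dg[OF p(2)] a'_def b'_def by (rule refl)
  moreover note sum_of_squares_form[of s a' r b']
  ultimately show ?thesis by (simp only: s_sq sr_eq A_def B_def)
qed

lemma smooth_l: "smooth W T (\<lambda>x. l i x u)"
proof -
  interpret WT: open_subset W T by (rule open_subset_WT)
  show ?thesis unfolding l_def
    by (intro WT.smooth_inner WT.smooth_const smooth_subset[OF jinv_smooth W_V T_U])
qed

lemma ln_dir: assumes "x \<in> T" "v \<in> W"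
  shows "has_dir_deriv (\<lambda>x. ln (x \<bullet> c i)) ((v \<bullet> c i) * (jinv x \<bullet> c i)) v x"
proof -
  obtain p where p: "x = dg p" "\<And>i. p i > 0" using assms by (auto simp: T_def)
  have "((\<lambda>t. ln ((x + t *\<^sub>R v) \<bullet> c i)) has_real_derivative (v \<bullet> c i) * inverse (x \<bullet> c i)) (at 0)"
    unfolding inner_add_left inner_scaleR_left using p(2)[of i]
    by (auto intro!: derivative_eq_intros simp: p(1) divide_inverse)
  then show ?thesis using p(2)
    by (simp add: has_dir_deriv_def has_real_derivative_iff_has_vector_derivative p(1) jinv_dg)
qed

text \<open>One differentiation turns the logarithm into a component of \<open>jinv\<close>, which
  is already known to be smooth.\<close>

lemma smooth_ln: "smooth W T (\<lambda>x. ln (x \<bullet> c i))"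
proof -
  interpret WT: open_subset W T by (rule open_subset_WT)
  have cont: "continuous_on T (\<lambda>x. ln (x \<bullet> c i))"
    by (intro continuous_intros) (auto simp: T_def less_imp_neq[symmetric])
  have "C_k k W T (\<lambda>x. ln (x \<bullet> c i))" for k
  proof (cases k)
    case 0 then show ?thesis using cont by simp
  next
    case (Suc j)
    have "smooth W T (\<lambda>x. (v \<bullet> c i) * (jinv x \<bullet> c i))" for v
      by (intro WT.smooth_mult WT.smooth_inner WT.smooth_const smooth_subset[OF jinv_smooth W_V T_U])
    then show ?thesis unfolding Suc
      by (intro WT.C_k_SucI[where f' = "\<lambda>v x. (v \<bullet> c i) * (jinv x \<bullet> c i)"])
       (auto simp: cont ln_dir smooth_def)
  qed
  then show ?thesis by (simp add: smooth_def)
qed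

lemma L_dir: assumes "x \<in> T" "v \<in> W" shows "has_dir_deriv (L i) (l i x v) v x"
proof -
  have "has_dir_deriv (\<lambda>x. s * ln (x \<bullet> c i) + r * (\<Sum>j\<in>UNIV. ln (x \<bullet> c j)))
     (s * ((v \<bullet> c i) * (jinv x \<bullet> c i)) + r * (\<Sum>j\<in>UNIV. (v \<bullet> c j) * (jinv x \<bullet> c j))) v x"
    by (intro has_dir_deriv_add has_dir_deriv_bounded_linear[OF bounded_linear_mult_right]
        has_dir_deriv_sum ln_dir assms) auto
  then show ?thesis unfolding L_def l_def M_def
    by (simp add: inner_add_right inner_sum_right mult.assoc)
qed

text \<open>\<open>l i\<close> is the differential of a flat coordinate, hence parallel, and a
  parallel form has zero derivative on a parallel field. This reduces iterated derivatives of the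
  potential to those of the coordinates \<open>L i\<close>.\<close>

lemma flat_field_l:
  assumes N: "N \<subseteq> T" "openin (top_of_set W) N" and X: "flat_field W N (levi_civita W g) X"
    and x: "x \<in> N" "u \<in> W"
  shows "has_dir_deriv (\<lambda>y. l i y (X y)) 0 u x"
proof -
  interpret WN: open_subset W N using subspace_W N by unfold_locales
  have XW: "X x \<in> W" using X x by (auto simp: flat_field_def vector_field_def)
  have xT: "x \<in> T" using x N by blast
  have "has_dir_deriv X (dir_deriv X u x) u x"
    using X x by (intro WN.smooth_has_dir_deriv) (auto simp: flat_field_def vector_field_def)
  moreover have "dir_deriv X u x = gam x u (X x)"
  proof -
    have "dir_deriv X u x + levi_civita W g x u (X x) = 0" using X x unfolding flat_field_def by blast
    then show ?thesis unfolding levi_civita_T[OF xT x(2) XW] by simp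
  qed
  ultimately have XD: "has_dir_deriv X (gam x u (X x)) u x" by simp
  have "has_dir_deriv (\<lambda>y. jinv y \<bullet> M i (X y))
      (- Q (jinv x) (jinv x) u \<bullet> M i (X x) + jinv x \<bullet> M i (gam x u (X x))) u x"
    by (rule has_dir_deriv_bilinear[OF bounded_bilinear_inner jinv_dir[OF TU[OF xT] WV[OF x(2)]]
        has_dir_deriv_bounded_linear[OF M_bl XD]])
  moreover have "- Q (jinv x) (jinv x) u \<bullet> M i (X x) + jinv x \<bullet> M i (gam x u (X x)) = 0"
  proof -
    obtain p where p: "jinv x = dg p" using jinv_T[OF xT] by (auto simp: T_def)
    obtain a b where "u = dg a" "X x = dg b" using XW x by (auto simp: W_def)
    then show ?thesis by (simp add: p gam_def Q_dg M_def inner_add_right inner_sum_right mult_ac sum_negf)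
  qed
  ultimately show ?thesis by (simp add: l_def)
qed

text \<open>At each point the algebra is R^n with componentwise product, read in the orthonormal
  coframe \<open>l i\<close>. Commutativity, associativity and invariance of the form then hold
  component by component.\<close>

lemma frobenius_T: "carries_frobenius W T g"
proof -
  interpret WT: open_subset W T by (rule open_subset_WT)
  let ?\<Gamma> = "levi_civita W g"
  define A where "A x u v w = (\<Sum>i\<in>UNIV. l i x u * l i x v * l i x w)" for x u v w
  \<comment> \<open>The factor 1/6 cancels the 3! from differentiating the cube of
    \<open>L i\<close> three times along flat fields.\<close>
  define \<Phi> where "\<Phi> x = (\<Sum>i\<in>UNIV. (1/6) * (L i x * L i x * L i x))" for x
  define circ where "circ x u v = linv x (\<lambda>i. l i x u * l i x v)" for x u v
  have circ_W: "circ x u v \<in> W" for x u v by (simp add: circ_def linv_W)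
  have l_circ: "l i x (circ x u v) = l i x u * l i x v" if "x \<in> T" for i x u v
    using that by (simp add: circ_def l_linv)
  have gA: "A x u v w = g x (circ x u v) w" "A x u v w = g x u (circ x v w)"
    if "x \<in> T" "u \<in> W" "v \<in> W" "w \<in> W" for x u v w
    using that by (simp_all add: A_def g_l circ_W l_circ mult.assoc)
  have aff: "affine_connection W T ?\<Gamma>"
    unfolding affine_connection_def
  proof (intro conjI ballI allI)
    show "?\<Gamma> x u v \<in> W" if "x \<in> T" "u \<in> W" "v \<in> W" for x u v
      using that gam_W subspace_W by (simp add: levi_civita_T subspace_neg)
    show "smooth W T (\<lambda>x. ?\<Gamma> x u v)" if "u \<in> W" "v \<in> W" for u v
    proof -
      have "smooth W T (\<lambda>x. ?\<Gamma> x u v) = smooth W T (\<lambda>x. - gam x u v)"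
        by (rule WT.smooth_cong) (rule levi_civita_T[OF _ that])
      then show ?thesis using WT.smooth_minus[OF smooth_subset[OF smooth_gam W_V T_U]] by simp
    qed
    fix x u v w a b assume *: "x \<in> T" "u \<in> W" "v \<in> W" "w \<in> W"
    then have "a *\<^sub>R u + b *\<^sub>R v \<in> W" by (intro subspace_add subspace_scale subspace_W)
    then show "?\<Gamma> x (a *\<^sub>R u + b *\<^sub>R v) w = a *\<^sub>R ?\<Gamma> x u w + b *\<^sub>R ?\<Gamma> x v w"
      "?\<Gamma> x w (a *\<^sub>R u + b *\<^sub>R v) = a *\<^sub>R ?\<Gamma> x w u + b *\<^sub>R ?\<Gamma> x w v"
      by (simp_all add: levi_civita_T * gam_linear)
  qed
  have tl: "torsionless W T ?\<Gamma>"
    unfolding torsionless_def by (auto simp: levi_civita_T gam_comm)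
  \<comment> \<open>The connection is the Levi-Civita connection of \<open>g\<close>, so
    \<open>g\<close> is parallel and both sides of the Codazzi equation vanish.\<close>
  have cov0: "cov_deriv_form ?\<Gamma> g x u v w = 0" if "x \<in> T" "u \<in> W" "v \<in> W" "w \<in> W" for x u v w
  proof -
    note xU = TU[OF that(1)] and V = WV[OF that(2)] WV[OF that(3)] WV[OF that(4)]
    have nV: "- gam x u v \<in> V" "- gam x u w \<in> V" using gam_V[OF xU] V subspace_V subspace_neg by blast+
    have s1: "\<sigma> x v (gam x u w) = \<sigma> x (gam x u v) w"
      using sigma_comm[OF xU V(2) gam_V[OF xU V(1,3)]] sigma_gam[OF xU V(1,3,2)] by simp
    have g1: "g x (- gam x u v) w = - (\<alpha> * \<sigma> x (gam x u v) w + \<beta> * (\<sigma> x u v * \<tau> x w))"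
      "g x v (- gam x u w) = - (\<alpha> * \<sigma> x (gam x u v) w + \<beta> * (\<tau> x v * \<sigma> x u w))"
      unfolding g_eq[OF xU nV(1) V(3)] g_eq[OF xU V(2) nV(2)] sigma_linear tau_linear s1 tau_gam[OF xU V(1,2)] tau_gam[OF xU V(1,3)]
      by simp_all
    show ?thesis
      unfolding cov_deriv_form_def dir_deriv_eq[OF g_dir[OF xU V]] levi_civita_T[OF that(1,2,3)] levi_civita_T[OF that(1,2,4)] g1
      by (simp add: algebra_simps)
  qed
  have cub: "symmetric_cubic_field W T A"
    unfolding symmetric_cubic_field_def
  proof (intro conjI ballI allI)
    show "smooth W T (\<lambda>x. A x u v w)" for u v w
      unfolding A_def by (intro WT.smooth_sum WT.smooth_mult smooth_l) simp
  qed (simp_all add: A_def l_linear algebra_simps sum.distrib sum_distrib_left)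
  have sm\<Phi>: "smooth W T \<Phi>"
    unfolding \<Phi>_def L_def
    by (intro WT.smooth_sum WT.smooth_mult WT.smooth_add WT.smooth_const smooth_ln) auto
  have third: "A x (X x) (Y x) (Z x) = apply_field X (apply_field Y (apply_field Z \<Phi>)) x"
    if N: "N \<subseteq> T" "openin (top_of_set W) N" and fl: "flat_field W N ?\<Gamma> X" "flat_field W N ?\<Gamma> Y" "flat_field W N ?\<Gamma> Z"
      and x: "x \<in> N" for N X Y Z x
  proof -
    interpret WN: open_subset W N using subspace_W N by unfold_locales
    have W: "X y \<in> W" "Y y \<in> W" "Z y \<in> W" if "y \<in> N" for y
      using fl that by (auto simp: flat_field_def vector_field_def)
    have NT: "y \<in> T" if "y \<in> N" for y using that N by blast
    note dl = flat_field_l[OF N fl(2)] flat_field_l[OF N fl(3)]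
    have 1: "apply_field Z \<Phi> y = (\<Sum>i\<in>UNIV. (1/2) * (L i y * L i y * l i y (Z y)))" if y: "y \<in> N" for y
    proof -
      have "has_dir_deriv \<Phi> (\<Sum>i\<in>UNIV. (1/6) * ((l i y (Z y) * L i y + L i y * l i y (Z y)) * L i y + L i y * L i y * l i y (Z y))) (Z y) y"
        unfolding \<Phi>_def
        by (intro has_dir_deriv_sum has_dir_deriv_bounded_linear[OF bounded_linear_mult_right]
          has_dir_deriv_bilinear[OF bounded_bilinear_mult] L_dir NT W y) simp
      from dir_deriv_eq[OF this] show ?thesis
        unfolding apply_field_def by (simp add: algebra_simps)
    qed
    have 2: "apply_field Y (apply_field Z \<Phi>) y = (\<Sum>i\<in>UNIV. L i y * l i y (Y y) * l i y (Z y))" if y: "y \<in> N" for y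
    proof -
      have "has_dir_deriv (\<lambda>y. \<Sum>i\<in>UNIV. (1/2) * (L i y * L i y * l i y (Z y)))
          (\<Sum>i\<in>UNIV. (1/2) * ((l i y (Y y) * L i y + L i y * l i y (Y y)) * l i y (Z y) + L i y * L i y * 0)) (Y y) y"
        by (intro has_dir_deriv_sum has_dir_deriv_bounded_linear[OF bounded_linear_mult_right]
          has_dir_deriv_bilinear[OF bounded_bilinear_mult] L_dir NT W y dl) simp
      from dir_deriv_eq[OF this] show ?thesis
        unfolding apply_field_def[of Y]
        using WN.dir_deriv_cong[OF 1 y W(2)[OF y]] by (simp add: algebra_simps)
    qed
    have "has_dir_deriv (\<lambda>y. \<Sum>i\<in>UNIV. L i y * l i y (Y y) * l i y (Z y))
       (\<Sum>i\<in>UNIV. (l i x (X x) * l i x (Y x) + L i x * 0) * l i x (Z x) + L i x * l i x (Y x) * 0) (X x) x"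
        by (intro has_dir_deriv_sum has_dir_deriv_bilinear[OF bounded_bilinear_mult] L_dir NT W x dl) simp
    from dir_deriv_eq[OF this] show ?thesis
      unfolding apply_field_def[of X]
      using WN.dir_deriv_cong[OF 2 x W(1)[OF x]] by (simp add: A_def)
  qed
  have "pre_frobenius W T g ?\<Gamma> g A \<Phi> circ"
    unfolding pre_frobenius_def
  proof (intro conjI)
    show "\<forall>x\<in>T. \<forall>B ginv. B \<subseteq> W \<longrightarrow> independent B \<longrightarrow> span B = W \<longrightarrow>
        (\<forall>a\<in>B. \<forall>c\<in>B. (\<Sum>e\<in>B. g x a e * ginv e c) = (if a = c then 1 else 0)) \<longrightarrow>
        (\<forall>u\<in>W. \<forall>v\<in>W. circ x u v = (\<Sum>c\<in>B. (\<Sum>e\<in>B. A x u v e * ginv e c) *\<^sub>R c))"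
    proof (intro ballI allI impI)
      fix x B ginv u v
      assume *: "x \<in> T" "B \<subseteq> W" "independent B" "span B = W"
        "\<forall>a\<in>B. \<forall>c\<in>B. (\<Sum>e\<in>B. g x a e * ginv e c) = (if a = c then 1 else 0)" "u \<in> W" "v \<in> W"
      have "circ x u v = (\<Sum>c\<in>B. (\<Sum>e\<in>B. g x (circ x u v) e * ginv e c) *\<^sub>R c)"
        by (rule product_in_frame[OF subspace_W form_W *(1-4) _ circ_W]) (use *(5) in blast)
      also have "\<dots> = (\<Sum>c\<in>B. (\<Sum>e\<in>B. A x u v e * ginv e c) *\<^sub>R c)"
        using gA(1)[OF *(1,6,7)] *(2) by (intro sum.cong refl arg_cong2[of _ _ _ _ scaleR]) (auto simp: subset_iff)
      finally show "circ x u v = (\<Sum>c\<in>B. (\<Sum>e\<in>B. A x u v e * ginv e c) *\<^sub>R c)" .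
    qed
    show "\<forall>x\<in>T. \<forall>u\<in>W. \<forall>v\<in>W. \<forall>w\<in>W. cov_deriv_form ?\<Gamma> g x u v w = cov_deriv_form ?\<Gamma> g x v u w"
      by (simp add: cov0)
    show "\<forall>N X Y Z. N \<subseteq> T \<longrightarrow> openin (top_of_set W) N \<longrightarrow>
        flat_field W N ?\<Gamma> X \<longrightarrow> flat_field W N ?\<Gamma> Y \<longrightarrow> flat_field W N ?\<Gamma> Z \<longrightarrow>
        (\<forall>x\<in>N. A x (X x) (Y x) (Z x) = apply_field X (apply_field Y (apply_field Z \<Phi>)) x)"
      by (intro allI impI ballI third)
    show "\<forall>x\<in>T. \<forall>u\<in>W. \<forall>v\<in>W. \<forall>w\<in>W. A x u v w = g x (circ x u v) w \<and> A x u v w = g x u (circ x v w)"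
      by (intro ballI conjI gA)
  qed (rule riem_W aff flat_T tl form_W riemannian_nondegenerate cub sm\<Phi>)+
  moreover have "circ x u v = circ x v u" for x u v by (simp add: circ_def mult.commute)
  moreover have "circ x (circ x u v) w = circ x u (circ x v w)" if "x \<in> T" for x u v w
    using that by (simp add: circ_def l_linv mult.assoc)
  moreover have "\<exists>E. vector_field W T E \<and> (\<forall>x\<in>T. \<forall>u\<in>W. circ x (E x) u = u \<and> circ x u (E x) = u)"
  proof (intro exI conjI ballI)
    \<comment> \<open>Every \<open>l i x x\<close> equals \<open>s + n r = t\<close>, so the
      position vector divided by \<open>t\<close> has all components 1.\<close>
    let ?E = "\<lambda>x. (1 / t) *\<^sub>R x"
    show "vector_field W T ?E" unfolding vector_field_def
      using T_W subspace_W by (auto intro!: WT.smooth_scaleR WT.smooth_const WT.smooth_id subspace_scale)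
    fix x u assume xu: "x \<in> T" "u \<in> W"
    have "l i x (?E x) = 1" for i
    proof -
      obtain p where p: "x = dg p" "\<And>i. p i > 0" using xu by (auto simp: T_def)
      have p0: "p i \<noteq> 0" for i using p(2)[of i] by simp
      have "l i x x = t" unfolding p(1) l_dg[OF p(2)] by (simp add: p0 t_eq)
      then show ?thesis using l_linear[of i x "1 / t" x 0 x] t_pos by simp
    qed
    then show "circ x (?E x) u = u" "circ x u (?E x) = u" using xu by (simp_all add: circ_def linv_l)
  qed
  ultimately have "frobenius W T g ?\<Gamma> g A \<Phi> circ" unfolding frobenius_def by blast
  then show ?thesis unfolding carries_frobenius_def by blast
qed

lemma flat_frobenius_torus: "has_flat_frobenius_torus W T V U G g"
  unfolding has_flat_frobenius_torus_def
proof (intro exI conjI allI impI)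
  show "\<exists>k\<in>G. \<gamma> ` J \<subseteq> k ` (\<lambda>x. x) ` T" if "geodesic V U g J \<gamma>" for J \<gamma>
    using geodesic_in_flat[OF that] by simp
qed (rule riem_W flat_T isometric_T totally_geodesic_T frobenius_T)+

subsection \<open>The pre-Frobenius structure of the cone\<close>

text \<open>The map \<open>x \<mapsto> det(x)\<^sup>p x\<close> pulls the Hessian metric \<open>\<alpha> \<sigma>\<close> back to \<open>g\<close> for a suitable \<open>p\<close>. The connection
  used here is the pullback of the standard flat connection of \<open>V\<close> under it.\<close>

definition S :: real where "S = sqrt ((\<alpha> + real CARD('b) * \<beta>) / \<alpha>)"
definition p :: real where "p = (S - 1) / real CARD('b)"
text \<open>Let F(x) = det(x)^p x. Up to the factor det(x)^p, its differential is u + p \<tau>(u) x,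
  with inverse w - (p/S) \<tau>(w) x. Applying the inverse of DF to D^2 F(u, v) gives
  \<open>\<Gamma>\<close>, and \<open>- kap\<close> is the resulting coefficient of x.\<close>

definition kap :: "'a \<Rightarrow> 'a \<Rightarrow> 'a \<Rightarrow> real" where
  "kap x u v = (p\<^sup>2 * (\<tau> x u * \<tau> x v) + p * \<sigma> x u v) / S"
definition \<Gamma> :: "'a product_field" where
  "\<Gamma> x u v = (p * \<tau> x u) *\<^sub>R v + (p * \<tau> x v) *\<^sub>R u - kap x u v *\<^sub>R x"

lemma S_pos: "S > 0" using \<alpha> \<alpha>\<beta> by (simp add: S_def)

lemma S_eq: "S = 1 + real CARD('b) * p" by (simp add: p_def)

lemma \<alpha>S: "\<alpha> * S\<^sup>2 = \<alpha> + real CARD('b) * \<beta>" using \<alpha> \<alpha>\<beta> by (simp add: S_def)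

text \<open>From n \<beta> = \<alpha> (S - 1) (S + 1) and S - 1 = n p.\<close>

lemma \<beta>p: "\<beta> = \<alpha> * p * (1 + S)"
proof -
  have "real CARD('b) * \<beta> = \<alpha> * S\<^sup>2 - \<alpha>" using \<alpha>S by simp
  also have "\<dots> = real CARD('b) * (\<alpha> * p * (1 + S))" unfolding S_eq by (simp add: power2_eq_square algebra_simps)
  finally show ?thesis by simp
qed

lemma S_kap: "S * kap x u v = p\<^sup>2 * (\<tau> x u * \<tau> x v) + p * \<sigma> x u v"
  using S_pos by (simp add: kap_def)

lemma \<Gamma>_V: "x \<in> U \<Longrightarrow> u \<in> V \<Longrightarrow> v \<in> V \<Longrightarrow> \<Gamma> x u v \<in> V"
  unfolding \<Gamma>_def by (intro subspace_add subspace_diff subspace_scale subspace_V) (auto dest: U_V)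

lemma \<Gamma>_dir:
  assumes x: "x \<in> U" and V: "u \<in> V" "v \<in> V" "w \<in> V"
  shows "has_dir_deriv (\<lambda>y. \<Gamma> y v w)
    ((- p * \<sigma> x u v) *\<^sub>R w + (- p * \<sigma> x u w) *\<^sub>R v
      - (((- p\<^sup>2 * (\<sigma> x u v * \<tau> x w + \<tau> x v * \<sigma> x u w) - 2 * p * \<sigma> x (gam x u v) w) / S) *\<^sub>R x + kap x v w *\<^sub>R u)) u x"
proof -
  have 1: "has_dir_deriv (\<lambda>y. (p * \<tau> y b) *\<^sub>R d) ((p * - \<sigma> x u b) *\<^sub>R d) u x" if "b \<in> V" for b d
    by (rule has_dir_deriv_bounded_linear[OF bounded_linear_scaleR_left],
        rule has_dir_deriv_bounded_linear[OF bounded_linear_mult_right tau_dir[OF x V(1) that]])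
  have "has_dir_deriv (\<lambda>y. kap y v w)
     ((p\<^sup>2 * (- \<sigma> x u v * \<tau> x w + \<tau> x v * - \<sigma> x u w) + p * (- 2 * \<sigma> x (gam x u v) w)) / S) u x"
    unfolding kap_def
    by (intro has_dir_deriv_bounded_linear[OF bounded_linear_divide] has_dir_deriv_add
        has_dir_deriv_bounded_linear[OF bounded_linear_mult_right]
        has_dir_deriv_bilinear[OF bounded_bilinear_mult] tau_dir sigma_dir x V)
  from has_dir_deriv_bilinear[OF bounded_bilinear_scaleR this has_dir_deriv_id]
  have 2: "has_dir_deriv (\<lambda>y. kap y v w *\<^sub>R y)
    (((p\<^sup>2 * (- \<sigma> x u v * \<tau> x w + \<tau> x v * - \<sigma> x u w) + p * (- 2 * \<sigma> x (gam x u v) w)) / S) *\<^sub>R x + kap x v w *\<^sub>R u) u x" .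
  from has_dir_deriv_add[OF has_dir_deriv_add[OF 1[OF V(2), of w] 1[OF V(3), of v]]
      has_dir_deriv_bounded_linear[OF bounded_linear_minus[OF bounded_linear_ident] 2]]
  have *: "has_dir_deriv (\<lambda>y. \<Gamma> y v w)
    ((p * - \<sigma> x u v) *\<^sub>R w + (p * - \<sigma> x u w) *\<^sub>R v +
      - (((p\<^sup>2 * (- \<sigma> x u v * \<tau> x w + \<tau> x v * - \<sigma> x u w) + p * (- 2 * \<sigma> x (gam x u v) w)) / S) *\<^sub>R x + kap x v w *\<^sub>R u)) u x"
    unfolding \<Gamma>_def by simp
  have "p\<^sup>2 * (- \<sigma> x u v * \<tau> x w + \<tau> x v * - \<sigma> x u w) + p * (- 2 * \<sigma> x (gam x u v) w) =
    - p\<^sup>2 * (\<sigma> x u v * \<tau> x w + \<tau> x v * \<sigma> x u w) - 2 * p * \<sigma> x (gam x u v) w"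
    by (simp add: algebra_simps)
  then have **: "(p * - \<sigma> x u v) *\<^sub>R w + (p * - \<sigma> x u w) *\<^sub>R v +
      - (((p\<^sup>2 * (- \<sigma> x u v * \<tau> x w + \<tau> x v * - \<sigma> x u w) + p * (- 2 * \<sigma> x (gam x u v) w)) / S) *\<^sub>R x + kap x v w *\<^sub>R u) =
    (- p * \<sigma> x u v) *\<^sub>R w + (- p * \<sigma> x u w) *\<^sub>R v
      - (((- p\<^sup>2 * (\<sigma> x u v * \<tau> x w + \<tau> x v * \<sigma> x u w) - 2 * p * \<sigma> x (gam x u v) w) / S) *\<^sub>R x + kap x v w *\<^sub>R u)"
    by (simp only:) simp
  show ?thesis using * unfolding ** .
qed

text \<open>The diffeomorphism itself is not constructed; flatness is verified by collecting terms.
  The \<open>w\<close> part cancels, and the coefficients of \<open>u\<close>, \<open>v\<close>,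
  \<open>x\<close> vanish once the formula for \<open>S * kap\<close> is combined with S = 1 + n
  p.\<close>

lemma flat_\<Gamma>: "flat V U \<Gamma>"
  unfolding flat_def
proof (intro ballI)
  fix x u v w assume x: "x \<in> U" and V: "u \<in> V" "v \<in> V" "w \<in> V"
  let ?n = "real CARD('b)"
  define a b d suv suw svw G where defs: "a = \<tau> x u" "b = \<tau> x v" "d = \<tau> x w"
    "suv = \<sigma> x u v" "suw = \<sigma> x u w" "svw = \<sigma> x v w" "G = \<sigma> x (gam x u v) w"
  have sym: "\<sigma> x v u = suv" "\<sigma> x (gam x v u) w = G"
    using V x by (simp_all add: defs sigma_comm gam_comm)
  define kv ku where k: "kv = kap x v w" "ku = kap x u w"
  have kS: "S * kv = p\<^sup>2 * (b * d) + p * svw" "S * ku = p\<^sup>2 * (a * d) + p * suw"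
    using S_kap by (simp_all add: k defs)
  have xx: "\<sigma> x u x = a" "\<sigma> x v x = b" "\<tau> x x = ?n"
    using V x U_V[OF x] by (simp_all add: defs sigma_comm[OF x _ U_V[OF x]] sigma_x tau_x)
  have tau\<Gamma>: "\<tau> x (\<Gamma> x v w) = 2 * p * b * d - ?n * kv" "\<tau> x (\<Gamma> x u w) = 2 * p * a * d - ?n * ku"
    by (simp_all add: \<Gamma>_def tau_linear xx k flip: defs)
  have sig\<Gamma>: "\<sigma> x u (\<Gamma> x v w) = p * b * suw + p * d * suv - kv * a"
    "\<sigma> x v (\<Gamma> x u w) = p * a * svw + p * d * suv - ku * b"
    by (simp_all add: \<Gamma>_def sigma_linear xx sym k flip: defs)
  define Ku Kv where K: "Ku = kap x u (\<Gamma> x v w)" "Kv = kap x v (\<Gamma> x u w)"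
  have KS: "S * Ku = p\<^sup>2 * (a * (2 * p * b * d - ?n * kv)) + p * (p * b * suw + p * d * suv - kv * a)"
    "S * Kv = p\<^sup>2 * (b * (2 * p * a * d - ?n * ku)) + p * (p * a * svw + p * d * suv - ku * b)"
    unfolding K S_kap tau\<Gamma> sig\<Gamma> by (simp_all flip: defs)
  define Hu Hv where H: "Hu = (- p\<^sup>2 * (suv * d + b * suw) - 2 * p * G) / S"
     "Hv = (- p\<^sup>2 * (suv * d + a * svw) - 2 * p * G) / S"
  have HS: "S * Hu = - p\<^sup>2 * (suv * d + b * suw) - 2 * p * G" "S * Hv = - p\<^sup>2 * (suv * d + a * svw) - 2 * p * G"
    using S_pos by (simp_all add: H)
  have "curvature \<Gamma> x u v w =
    ((- p * suv) *\<^sub>R w + (- p * suw) *\<^sub>R v - (Hu *\<^sub>R x + kv *\<^sub>R u) +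
      ((p * a) *\<^sub>R ((p * b) *\<^sub>R w + (p * d) *\<^sub>R v - kv *\<^sub>R x) + (p * (2 * p * b * d - ?n * kv)) *\<^sub>R u - Ku *\<^sub>R x)) -
    ((- p * suv) *\<^sub>R w + (- p * svw) *\<^sub>R u - (Hv *\<^sub>R x + ku *\<^sub>R v) +
      ((p * b) *\<^sub>R ((p * a) *\<^sub>R w + (p * d) *\<^sub>R u - ku *\<^sub>R x) + (p * (2 * p * a * d - ?n * ku)) *\<^sub>R v - Kv *\<^sub>R x))"
  proof -
    have vw: "\<Gamma> x v w = (p * b) *\<^sub>R w + (p * d) *\<^sub>R v - kv *\<^sub>R x"
      "\<Gamma> x u w = (p * a) *\<^sub>R w + (p * d) *\<^sub>R u - ku *\<^sub>R x"
      by (simp_all add: \<Gamma>_def k flip: defs)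
    have "\<Gamma> x u (\<Gamma> x v w) = (p * a) *\<^sub>R \<Gamma> x v w + (p * (2 * p * b * d - ?n * kv)) *\<^sub>R u - Ku *\<^sub>R x"
      "\<Gamma> x v (\<Gamma> x u w) = (p * b) *\<^sub>R \<Gamma> x u w + (p * (2 * p * a * d - ?n * ku)) *\<^sub>R v - Kv *\<^sub>R x"
      using tau\<Gamma> by (simp_all add: \<Gamma>_def[of x _ "\<Gamma> x _ _"] K flip: defs)
    then show ?thesis
      unfolding curvature_def dir_deriv_eq[OF \<Gamma>_dir[OF x V]] dir_deriv_eq[OF \<Gamma>_dir[OF x V(2,1,3)]]
      by (simp only: vw H sym k defs)
  qed
  also have "\<dots> = (- p * suw + ku + p\<^sup>2 * a * d - p * (2 * p * a * d - ?n * ku)) *\<^sub>R v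
    - (- p * svw + kv + p\<^sup>2 * b * d - p * (2 * p * b * d - ?n * kv)) *\<^sub>R u
    - (Hu - Hv + p * a * kv - p * b * ku + Ku - Kv) *\<^sub>R x"
  proof -
    have "((- p * suv) *\<^sub>R w + (- p * suw) *\<^sub>R v - (Hu *\<^sub>R x + kv *\<^sub>R u) +
      ((p * a) *\<^sub>R ((p * b) *\<^sub>R w + (p * d) *\<^sub>R v - kv *\<^sub>R x) + C1 *\<^sub>R u - Ku *\<^sub>R x)) -
      ((- p * suv) *\<^sub>R w + (- p * svw) *\<^sub>R u - (Hv *\<^sub>R x + ku *\<^sub>R v) +
      ((p * b) *\<^sub>R ((p * a) *\<^sub>R w + (p * d) *\<^sub>R u - ku *\<^sub>R x) + C2 *\<^sub>R v - Kv *\<^sub>R x)) =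
      (- p * suw + ku + p\<^sup>2 * a * d - C2) *\<^sub>R v - (- p * svw + kv + p\<^sup>2 * b * d - C1) *\<^sub>R u
      - (Hu - Hv + p * a * kv - p * b * ku + Ku - Kv) *\<^sub>R x" for C1 C2
      by (simp add: algebra_simps power2_eq_square)
    then show ?thesis .
  qed
  also have "- p * suw + ku + p\<^sup>2 * a * d - p * (2 * p * a * d - ?n * ku) = 0"
    using kS(2) unfolding S_eq by (simp add: algebra_simps power2_eq_square)
  also have "- p * svw + kv + p\<^sup>2 * b * d - p * (2 * p * b * d - ?n * kv) = 0"
    using kS(1) unfolding S_eq by (simp add: algebra_simps power2_eq_square)
  also have "Hu - Hv + p * a * kv - p * b * ku + Ku - Kv = 0"
  proof -
    have "S * (Hu - Hv + p * a * kv - p * b * ku + Ku - Kv) =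
       S * Hu - S * Hv + p * a * (S * kv) - p * b * (S * ku) + S * Ku - S * Kv"
      by (simp add: algebra_simps)
    also have "\<dots> = p * a * (S * kv) - p * b * (S * ku) - p * a * ((1 + ?n * p) * kv) + p * b * ((1 + ?n * p) * ku)"
      unfolding HS KS by (simp add: algebra_simps power2_eq_square)
    also have "\<dots> = 0" unfolding S_eq by simp
    finally show ?thesis using S_pos by simp
  qed
  finally show "curvature \<Gamma> x u v w = 0" by simp
qed

lemma codazzi_\<Gamma>:
  assumes x: "x \<in> U" and V: "u \<in> V" "v \<in> V" "w \<in> V"
  shows "cov_deriv_form \<Gamma> g x u v w = cov_deriv_form \<Gamma> g x v u w"
proof -
  have xV: "x \<in> V" using U_V x by blast
  \<comment> \<open>The position vector is dual to \<open>\<tau>\<close>; the factor \<alpha> + n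
    \<beta> arises because \<tau>(x) = n.\<close>
  have gx: "g x b x = \<alpha> * S\<^sup>2 * \<tau> x b" if "b \<in> V" for b
    using that by (simp add: g_eq[OF x that xV] sigma_comm[OF x that xV] sigma_x[OF x] tau_x[OF x] \<alpha>S algebra_simps)
  have lin: "g x (\<Gamma> x b w') d = p * \<tau> x b * g x w' d + p * \<tau> x w' * g x b d - kap x b w' * g x d x"
    if "b \<in> V" "w' \<in> V" "d \<in> V" for b w' d
    using that by (simp add: g_eq[OF x] \<Gamma>_V[OF x] xV)
      (simp add: \<Gamma>_def sigma_linear tau_linear sigma_comm[OF x _ xV] algebra_simps)
  have "g x d (\<Gamma> x b w') = g x (\<Gamma> x b w') d" if "b \<in> V" "w' \<in> V" "d \<in> V" for b w' d
    using that riem symmetric_form_fieldD(1)[OF _ x] \<Gamma>_V[OF x] by (metis riemannian_def)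
  note lin2 = this
  have kS: "kap x b d * (\<alpha> * S\<^sup>2) = \<alpha> * S * (p\<^sup>2 * (\<tau> x b * \<tau> x d) + p * \<sigma> x b d)" for b d
    using S_kap[of x b d] by (simp add: power2_eq_square mult_ac)
  have kap_comm: "kap x u v = kap x v u" using V x by (simp add: kap_def sigma_comm mult.commute)
  define a b d where ab: "a = \<tau> x u" "b = \<tau> x v" "d = \<tau> x w"
  have 1: "kap x u w * (\<alpha> * S\<^sup>2 * b) = \<alpha> * S * (p\<^sup>2 * (a * d) + p * \<sigma> x u w) * b"
    "kap x v w * (\<alpha> * S\<^sup>2 * a) = \<alpha> * S * (p\<^sup>2 * (b * d) + p * \<sigma> x v w) * a"
    using kS[of u w] kS[of v w] by (simp_all add: ab flip: mult.assoc)
  have \<Gamma>_comm: "\<Gamma> x v u = \<Gamma> x u v" by (simp add: \<Gamma>_def kap_comm add.commute)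
  have sym: "\<sigma> x v u = \<sigma> x u v" "g x v u = g x u v" "gam x v u = gam x u v"
    using V x riem symmetric_form_fieldD(1)[of V U g x u v]
    by (simp_all add: sigma_comm[OF x V(2,1)] gam_comm riemannian_def)
  have R: "g x v (\<Gamma> x u w) = p * a * g x w v + p * d * g x u v - kap x u w * (\<alpha> * S\<^sup>2 * b)"
    "g x u (\<Gamma> x v w) = p * b * g x w u + p * d * g x u v - kap x v w * (\<alpha> * S\<^sup>2 * a)"
    using V by (simp_all add: lin2 lin gx ab sym)
  \<comment> \<open>All that is symmetric in \<open>u\<close> and \<open>v\<close> drops out: the
    \<open>gam\<close> term, the term with \<open>\<sigma> x u v\<close>,
    \<open>g x (\<Gamma> x u v) w\<close> and \<open>p * d * g x u v\<close>.\<close>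
  have "cov_deriv_form \<Gamma> g x u v w - cov_deriv_form \<Gamma> g x v u w =
     - \<beta> * (b * \<sigma> x u w) + \<beta> * (a * \<sigma> x v w) - p * a * g x w v + p * b * g x w u
     + kap x u w * (\<alpha> * S\<^sup>2 * b) - kap x v w * (\<alpha> * S\<^sup>2 * a)"
    unfolding cov_deriv_form_def dir_deriv_eq[OF g_dir[OF x V]] dir_deriv_eq[OF g_dir[OF x V(2,1,3)]]
      \<Gamma>_comm R sym ab[symmetric] by (simp add: algebra_simps)
  also have "\<dots> = 0"
  proof -
    have gw: "g x w v = \<alpha> * \<sigma> x v w + \<beta> * (d * b)" "g x w u = \<alpha> * \<sigma> x u w + \<beta> * (d * a)"
      using V x by (simp_all add: g_eq sigma_comm[OF x V(3)] ab)
    show ?thesis unfolding 1 gw by (rule codazzi_identity[OF \<beta>p])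
  qed
  finally show ?thesis by simp
qed

lemma pre_frobenius_U: "carries_pre_frobenius V U g"
  unfolding carries_pre_frobenius_def
proof (intro exI)
  have s: "symmetric_form_field V U g" using riem by (simp add: riemannian_def)
  have aff: "affine_connection V U \<Gamma>"
    unfolding affine_connection_def
  proof (intro conjI ballI allI)
    show "smooth V U (\<lambda>x. \<Gamma> x u v)" for u v
      unfolding \<Gamma>_def kap_def divide_inverse
      by (intro smooth_add smooth_diff smooth_scaleR smooth_mult smooth_const smooth_id smooth_tau smooth_sigma)
    fix x u v w a b
    have k: "kap x (a *\<^sub>R u + b *\<^sub>R v) w = a * kap x u w + b * kap x v w"
      "kap x w (a *\<^sub>R u + b *\<^sub>R v) = a * kap x w u + b * kap x w v"
      unfolding kap_def tau_linear sigma_linear using S_pos by (simp_all add: field_simps)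
    show "\<Gamma> x (a *\<^sub>R u + b *\<^sub>R v) w = a *\<^sub>R \<Gamma> x u w + b *\<^sub>R \<Gamma> x v w"
      "\<Gamma> x w (a *\<^sub>R u + b *\<^sub>R v) = a *\<^sub>R \<Gamma> x w u + b *\<^sub>R \<Gamma> x w v"
      unfolding \<Gamma>_def k tau_linear by (simp_all add: algebra_simps)
  qed (rule \<Gamma>_V)
  have tl: "torsionless V U \<Gamma>"
    unfolding torsionless_def by (auto simp: \<Gamma>_def kap_def sigma_comm mult.commute add_ac)
  have z: "apply_field Z (\<lambda>_. 0) = (\<lambda>_. 0)" for Z :: "'a \<Rightarrow> 'a"
    by (rule ext) (simp add: apply_field_def dir_deriv_eq[OF has_dir_deriv_const])
  have g0: "g x 0 w = 0" "g x w 0 = 0" if "x \<in> U" "w \<in> V" for x w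
    using symmetric_form_fieldD(6)[OF s that subspace_V]
      symmetric_form_fieldD(1)[OF s that subspace_0[OF subspace_V]] by simp_all
  \<comment> \<open>With zero potential the cubic tensor and the product are zero as well, and (iii)
    to (v) reduce to bilinearity of \<open>g\<close>; the substance lies in flatness and the Codazzi
    equation.\<close>
  show "pre_frobenius V U g \<Gamma> g (\<lambda>_ _ _ _. 0) (\<lambda>_. 0) (\<lambda>_ _ _. 0)"
    unfolding pre_frobenius_def
  proof (intro conjI)
    show "\<forall>x\<in>U. \<forall>u\<in>V. \<forall>v\<in>V. \<forall>w\<in>V. cov_deriv_form \<Gamma> g x u v w = cov_deriv_form \<Gamma> g x v u w"
      by (intro ballI codazzi_\<Gamma>)
    show "symmetric_cubic_field V U (\<lambda>_ _ _ _. 0)" by (simp add: symmetric_cubic_field_def smooth_const)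
    show "\<forall>N X Y Z. N \<subseteq> U \<longrightarrow> openin (top_of_set V) N \<longrightarrow>
        flat_field V N \<Gamma> X \<longrightarrow> flat_field V N \<Gamma> Y \<longrightarrow> flat_field V N \<Gamma> Z \<longrightarrow>
        (\<forall>x\<in>N. 0 = apply_field X (apply_field Y (apply_field Z (\<lambda>_. 0))) x)"
      by (simp only: z) simp
    show "\<forall>x\<in>U. \<forall>u\<in>V. \<forall>v\<in>V. \<forall>w\<in>V. 0 = g x 0 w \<and> 0 = g x u 0"
      by (simp add: g0)
  qed (rule riem aff flat_\<Gamma> tl s riemannian_nondegenerate smooth_const | simp)+
qed

end

theorem (in jordan_cone) invariant_metric_cone:
  assumes "invariant_metric V U G g"
  shows "has_flat_frobenius_torus W T V U G g \<and> homogeneous U G \<and> cartan_hadamard V U g \<and>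
    carries_pre_frobenius V U g"
proof -
  obtain \<alpha> \<beta> where "\<alpha> > 0" "\<alpha> + real CARD('b) * \<beta> > 0"
    "\<And>x u v. x \<in> U \<Longrightarrow> u \<in> V \<Longrightarrow> v \<in> V \<Longrightarrow> g x u v = \<alpha> * \<sigma> x u v + \<beta> * (\<tau> x u * \<tau> x v)"
    using invariant_metric_form[OF assms] by blast
  then interpret jordan_cone_metric V Q c K G g \<alpha> \<beta>
    using assms by unfold_locales (auto simp: invariant_metric_def)
  show ?thesis using flat_frobenius_torus homogeneous cartan_hadamard pre_frobenius_U by blast
qed

section \<open>Matrices over algebras with involution\<close>

text \<open>Unlike associativity, these properties are inherited by the Cayley--Dickson doubling.\<close>

class hermitian_algebra = star_algebra +
  assumes ha_add_mult: "(x + y) * z = x * z + y * z"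
    and ha_mult_add: "x * (y + z) = x * y + x * z"
    and ha_scaleR_mult: "(r *\<^sub>R x) * y = r *\<^sub>R (x * y)"
    and ha_mult_scaleR: "x * (r *\<^sub>R y) = r *\<^sub>R (x * y)"
    and ha_one_mult: "1 * x = x"
    and ha_mult_one: "x * 1 = x"
    and ha_star_add: "star (x + y) = star x + star y"
    and ha_star_scaleR: "star (r *\<^sub>R x) = r *\<^sub>R star x"
    and ha_star_star: "star (star x) = x"
    and ha_star_mult: "star (x * y) = star y * star x"
    and ha_inner_left: "(x * y) \<bullet> z = y \<bullet> (star x * z)"
    and ha_inner_right: "(x * y) \<bullet> z = x \<bullet> (z * star y)"
    and ha_star_self: "star x * x = (x \<bullet> x) *\<^sub>R 1"
    and ha_one_inner: "1 \<bullet> 1 = 1"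

instance real :: hermitian_algebra
  by standard (auto simp: star_real_def algebra_simps)

instance complex :: hermitian_algebra
  by standard (auto simp: star_complex_def inner_complex_def algebra_simps complex_eq_iff)

lemma ha_star_one [simp]: "star 1 = (1::'a::hermitian_algebra)"
  by (metis ha_mult_one ha_one_mult ha_star_mult ha_star_star)

lemma ha_linear_left: "linear (\<lambda>x. x * (y::'a::hermitian_algebra))"
  by (rule linearI) (simp_all add: ha_add_mult ha_scaleR_mult)

lemma ha_linear_right: "linear (\<lambda>y. (x::'a::hermitian_algebra) * y)"
  by (rule linearI) (simp_all add: ha_mult_add ha_mult_scaleR)

lemma ha_linear_star: "linear (star :: 'a::hermitian_algebra \<Rightarrow> 'a)"
  by (rule linearI) (simp_all add: ha_star_add ha_star_scaleR)

lemmas ha_mult_simps =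
  ha_add_mult ha_mult_add ha_scaleR_mult ha_mult_scaleR ha_one_mult ha_mult_one
  linear_0[OF ha_linear_left] linear_0[OF ha_linear_right]
  linear_neg[OF ha_linear_left] linear_neg[OF ha_linear_right]
  linear_diff[OF ha_linear_left] linear_diff[OF ha_linear_right]
  linear_sum[OF ha_linear_left] linear_sum[OF ha_linear_right]

lemmas ha_star_simps =
  ha_star_add ha_star_scaleR ha_star_star linear_0[OF ha_linear_star] linear_neg[OF ha_linear_star]
  linear_diff[OF ha_linear_star] linear_sum[OF ha_linear_star]

lemma ha_inner_star: "star x \<bullet> star y = x \<bullet> (y::'a::hermitian_algebra)"
  using ha_inner_right[of 1 "star x" "star y"] ha_inner_left[of y 1 x]
  by (simp add: ha_mult_simps ha_star_simps inner_commute)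

lemma ha_inner_star': "star x \<bullet> y = x \<bullet> star (y::'a::hermitian_algebra)"
  by (metis ha_inner_star ha_star_star)

lemma ha_star_polar: "star x * y + star y * x = (2 * (x \<bullet> y)) *\<^sub>R (1::'a::hermitian_algebra)"
  using ha_star_self[of "x + y"]
  by (simp add: ha_star_simps ha_mult_simps ha_star_self inner_add_left inner_add_right inner_commute scaleR_add_left
      algebra_simps)

lemma ha_polar_star: "x * star y + y * star x = (2 * (x \<bullet> y)) *\<^sub>R (1::'a::hermitian_algebra)"
  using ha_star_polar[of "star x" "star y"] by (simp add: ha_star_simps ha_inner_star)

lemma ha_self_star: "x * star x = (x \<bullet> x) *\<^sub>R (1::'a::hermitian_algebra)"
  using ha_star_self[of "star x"] by (simp add: ha_star_simps ha_inner_star)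

lemma ha_trace: "star x + x = (2 * (1 \<bullet> x)) *\<^sub>R (1::'a::hermitian_algebra)"
  using ha_star_polar[of x 1] by (simp add: ha_mult_simps inner_commute)

text \<open>Adjointness of a one-sided multiplication in the doubled algebra mixes left and right
  multiplications of the components, so the class carries both \<open>ha_inner_left\<close> and
  \<open>ha_inner_right\<close>.\<close>

instance cd :: (hermitian_algebra) hermitian_algebra
proof
  fix x y z :: "'a cd" and r :: real
  note defs = times_cd_def plus_cd_def scaleR_cd_def star_cd_def one_cd_def inner_cd_def zero_cd_def uminus_cd_def
    ha_mult_simps ha_star_simps ha_star_mult
  show "(x + y) * z = x * z + y * z" "x * (y + z) = x * y + x * z"
    by (simp_all add: defs algebra_simps)
  show "(r *\<^sub>R x) * y = r *\<^sub>R (x * y)" "x * (r *\<^sub>R y) = r *\<^sub>R (x * y)"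
    by (simp_all add: defs scaleR_diff_right scaleR_add_right)
  show "1 * x = x" "x * 1 = x" "star (x + y) = star x + star y" "star (r *\<^sub>R x) = r *\<^sub>R star x"
    "star (star x) = x" "star (x * y) = star y * star x" "(1::'a cd) \<bullet> 1 = 1"
    by (simp_all add: defs ha_one_inner)
  show "star x * x = (x \<bullet> x) *\<^sub>R 1"
    by (simp add: defs ha_star_self scaleR_add_left)
  show "(x * y) \<bullet> z = y \<bullet> (star x * z)"
  proof -
    have "(cd2 x * star (cd1 y)) \<bullet> cd2 z = cd1 y \<bullet> (star (cd2 z) * cd2 x)"
      by (simp add: ha_inner_left ha_inner_star' ha_star_mult ha_star_star)
    moreover have "(star (cd2 y) * cd2 x) \<bullet> cd1 z = cd2 y \<bullet> (cd2 x * star (cd1 z))"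
      by (simp add: ha_inner_right ha_inner_star' ha_star_mult ha_star_star)
    ultimately show ?thesis
      by (simp add: defs inner_add_left inner_diff_left inner_add_right inner_diff_right
        ha_inner_left[of "cd1 x"] ha_inner_right[of "cd2 y" "cd1 x"])
  qed
  show "(x * y) \<bullet> z = x \<bullet> (z * star y)"
    by (simp add: defs inner_add_left inner_diff_left inner_add_right inner_diff_right
        ha_inner_right[of "cd1 x"] ha_inner_right[of "cd2 x"] ha_inner_left[of "cd2 y"] ha_inner_left[of "star (cd2 y)"])
qed

subsection \<open>Self-adjoint matrices\<close>

lemma adjoint_nth [simp]: "adjoint_mat x $ i $ j = star (x $ j $ i)"
  by (simp add: adjoint_mat_def)

lemma mat_times_nth: "mat_times x y $ i $ j = (\<Sum>k\<in>UNIV. x $ i $ k * y $ k $ j)"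
  by (simp add: mat_times_def)

lemma jordan_nth: "jordan x y $ i $ j = (1/2) *\<^sub>R ((\<Sum>k\<in>UNIV. x $ i $ k * y $ k $ j) + (\<Sum>k\<in>UNIV. y $ i $ k * x $ k $ j))"
  by (simp add: jordan_def mat_times_nth)

lemma bilinear_mat_times: "bilinear (mat_times :: 'k::hermitian_algebra^'n^'n \<Rightarrow> _)"
  unfolding bilinear_def
  by (auto intro!: linearI simp: vec_eq_iff mat_times_nth ha_mult_simps sum.distrib scaleR_sum_right)

lemmas mat_times_simps =
  bilinear_ladd[OF bilinear_mat_times] bilinear_radd[OF bilinear_mat_times]
  bilinear_lsub[OF bilinear_mat_times] bilinear_rsub[OF bilinear_mat_times]
  bilinear_lmul[OF bilinear_mat_times] bilinear_rmul[OF bilinear_mat_times]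
  bilinear_lneg[OF bilinear_mat_times] bilinear_rneg[OF bilinear_mat_times]

lemma bilinear_jordan: "bilinear (jordan :: 'k::hermitian_algebra^'n^'n \<Rightarrow> _)"
  unfolding bilinear_def jordan_def
  by (auto intro!: linearI simp: mat_times_simps algebra_simps)

lemma jordan_comm: "jordan x y = jordan y x"
  by (simp add: jordan_def add.commute)

lemma linear_adjoint: "linear (adjoint_mat :: 'k::hermitian_algebra^'n^'n \<Rightarrow> _)"
  by (rule linearI) (simp_all add: vec_eq_iff ha_star_simps)

lemma adjoint_adjoint [simp]: "adjoint_mat (adjoint_mat x) = (x :: 'k::hermitian_algebra^'n^'m)"
  by (simp add: vec_eq_iff ha_star_simps)

lemma adjoint_mat_times: "adjoint_mat (mat_times x y) = mat_times (adjoint_mat y) (adjoint_mat (x :: 'k::hermitian_algebra^'n^'n))"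
  by (simp add: vec_eq_iff mat_times_nth ha_star_simps ha_star_mult)

lemma subspace_selfadjoint: "subspace (selfadjoint :: ('k::hermitian_algebra^'n^'n) set)"
  unfolding selfadjoint_def subspace_def
  by (simp add: linear_0[OF linear_adjoint] linear_add[OF linear_adjoint] linear_scale[OF linear_adjoint])

lemma selfadjointD: "x \<in> selfadjoint \<Longrightarrow> adjoint_mat x = x" by (simp add: selfadjoint_def)

lemma selfadjoint_nth: "x \<in> selfadjoint \<Longrightarrow> star (x $ j $ i) = x $ i $ j"
  by (metis adjoint_nth selfadjointD)

text \<open>A scalar fixed by \<open>star\<close> is half of \<open>star x + x\<close>, hence a real
  multiple of 1.\<close>

lemma selfadjoint_diag:
  fixes x :: "'k::hermitian_algebra^'n^'n"
  assumes "x \<in> selfadjoint" shows "x $ i $ i = (1 \<bullet> x $ i $ i) *\<^sub>R 1"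
  using ha_trace[of "x $ i $ i"] selfadjoint_nth[OF assms, of i i]
  by (metis (no_types, lifting) scaleR_2 scaleR_cancel_left scaleR_scaleR zero_neq_numeral)

lemma jordan_selfadjoint:
  fixes x y :: "'k::hermitian_algebra^'n^'n"
  shows "x \<in> selfadjoint \<Longrightarrow> y \<in> selfadjoint \<Longrightarrow> jordan x y \<in> selfadjoint"
  unfolding selfadjoint_def jordan_def
  by (simp add: linear_scale[OF linear_adjoint] linear_add[OF linear_adjoint] adjoint_mat_times add.commute)

lemma inner_mat: "x \<bullet> y = (\<Sum>i\<in>UNIV. \<Sum>j\<in>UNIV. x $ i $ j \<bullet> y $ i $ j)"
  by (simp add: inner_vec_def)

lemma mat_times_inner_left: "mat_times x y \<bullet> z = y \<bullet> mat_times (adjoint_mat x) (z :: 'k::hermitian_algebra^'n^'n)"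
proof -
  have "mat_times x y \<bullet> z = (\<Sum>i\<in>UNIV. \<Sum>j\<in>UNIV. \<Sum>k\<in>UNIV. y $ k $ j \<bullet> (star (x $ i $ k) * z $ i $ j))"
    by (simp add: inner_mat mat_times_nth inner_sum_left ha_inner_left)
  also have "\<dots> = (\<Sum>j\<in>UNIV. \<Sum>i\<in>UNIV. \<Sum>k\<in>UNIV. y $ k $ j \<bullet> (star (x $ i $ k) * z $ i $ j))"
    by (rule sum.swap)
  also have "\<dots> = (\<Sum>j\<in>UNIV. \<Sum>k\<in>UNIV. \<Sum>i\<in>UNIV. y $ k $ j \<bullet> (star (x $ i $ k) * z $ i $ j))"
    by (intro sum.cong refl sum.swap)
  also have "\<dots> = (\<Sum>k\<in>UNIV. \<Sum>j\<in>UNIV. \<Sum>i\<in>UNIV. y $ k $ j \<bullet> (star (x $ i $ k) * z $ i $ j))"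
    by (rule sum.swap)
  also have "\<dots> = y \<bullet> mat_times (adjoint_mat x) z"
    by (simp add: inner_mat mat_times_nth inner_sum_right)
  finally show ?thesis .
qed

lemma inner_adjoint: "adjoint_mat x \<bullet> adjoint_mat y = x \<bullet> (y :: 'k::hermitian_algebra^'n^'n)"
  unfolding inner_mat adjoint_nth ha_inner_star by (rule sum.swap)

lemma mat_times_inner_right: "mat_times x y \<bullet> z = x \<bullet> mat_times z (adjoint_mat (y :: 'k::hermitian_algebra^'n^'n))"
proof -
  have "mat_times x y \<bullet> z = mat_times (adjoint_mat y) (adjoint_mat x) \<bullet> adjoint_mat z"
    by (metis adjoint_mat_times inner_adjoint)
  also have "\<dots> = x \<bullet> mat_times z (adjoint_mat y)"
    by (metis adjoint_adjoint adjoint_mat_times inner_adjoint mat_times_inner_left)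
  finally show ?thesis .
qed

lemma jordan_inner: "x \<in> selfadjoint \<Longrightarrow> jordan x y \<bullet> z = y \<bullet> jordan x (z :: 'k::hermitian_algebra^'n^'n)"
  by (simp add: jordan_def inner_add_left inner_add_right mat_times_inner_left[of x] mat_times_inner_right[of y] selfadjointD)

subsection \<open>Real diagonal matrices\<close>

definition dgm :: "('n \<Rightarrow> real) \<Rightarrow> 'k::star_algebra^'n^'n" where
  "dgm a = (\<chi> i j. if i = j then a i *\<^sub>R 1 else 0)"

lemma dgm_nth: "dgm a $ i $ j = (if i = j then a i *\<^sub>R 1 else 0)"
  by (simp add: dgm_def)

lemma mat_dgm: "mat 1 = (dgm (\<lambda>_. 1) :: 'k::star_algebra^'n^'n)"
  by (simp add: mat_def dgm_def vec_eq_iff)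

lemma cartan_dgm: "(cartan :: ('k::star_algebra^'n^'n) set) = range dgm"
proof
  show "(cartan :: ('k^'n^'n) set) \<subseteq> range dgm"
    by (auto simp: cartan_def dgm_def)
  have "dgm a \<in> (cartan :: ('k^'n^'n) set)" for a
    unfolding cartan_def mem_Collect_eq by (rule exI[of _ "\<chi> i. a i"]) (simp add: dgm_def vec_eq_iff)
  then show "range dgm \<subseteq> (cartan :: ('k^'n^'n) set)" by blast
qed

lemma dgm_selfadjoint: "(dgm a :: 'k::hermitian_algebra^'n^'n) \<in> selfadjoint"
  by (auto simp: selfadjoint_def vec_eq_iff dgm_nth ha_star_simps)

lemma dgm_times: "mat_times (dgm a) x = (\<chi> i j. a i *\<^sub>R (x :: 'k::hermitian_algebra^'n^'n) $ i $ j)"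
  by (simp add: vec_eq_iff mat_times_nth dgm_nth if_distribR if_distrib[of "\<lambda>z. z * _"] ha_mult_simps cong: if_cong)

lemma times_dgm: "mat_times x (dgm a) = (\<chi> i j. a j *\<^sub>R (x :: 'k::hermitian_algebra^'n^'n) $ i $ j)"
  by (simp add: vec_eq_iff mat_times_nth dgm_nth if_distrib[of "\<lambda>z. _ * z"] ha_mult_simps cong: if_cong)

lemma jordan_dgm: "jordan (dgm a) x = (\<chi> i j. ((a i + a j) / 2) *\<^sub>R (x :: 'k::hermitian_algebra^'n^'n) $ i $ j)"
  by (simp add: jordan_def dgm_times times_dgm vec_eq_iff scaleR_add_left add_divide_distrib scaleR_add_right)

lemma dgm_dgm: "mat_times (dgm a) (dgm b) = (dgm (\<lambda>i. a i * b i) :: 'k::hermitian_algebra^'n^'n)"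
  by (auto simp: dgm_times vec_eq_iff dgm_nth)

lemma jordan_dgm_dgm: "jordan (dgm a) (dgm b) = (dgm (\<lambda>i. a i * b i) :: 'k::hermitian_algebra^'n^'n)"
  by (auto simp: jordan_dgm vec_eq_iff dgm_nth)

lemma dgm_inner: "(dgm a :: 'k::hermitian_algebra^'n^'n) \<bullet> dgm b = (\<Sum>i\<in>UNIV. a i * b i)"
  by (simp add: inner_mat dgm_nth if_distrib[of "\<lambda>z. z \<bullet> _"] if_distrib[of "\<lambda>z. _ \<bullet> z"] ha_one_inner mult.commute cong: if_cong)

text \<open>Multiplication by a diagonal matrix scales each entry by the mean of two diagonal
  values, so the form is a positively weighted sum of squares.\<close>

lemma jordan_dgm_pos:
  assumes "\<And>i. a i > 0" "(x :: 'k::hermitian_algebra^'n^'n) \<noteq> 0"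
  shows "jordan (dgm a) x \<bullet> x > 0"
proof -
  have nn: "(a i + a j) / 2 * (x $ i $ j \<bullet> x $ i $ j) \<ge> 0" for i j
    using assms(1)[of i] assms(1)[of j] by (intro mult_nonneg_nonneg) auto
  obtain i j where "x $ i $ j \<noteq> 0" using assms(2) by (auto simp: vec_eq_iff)
  then have "(a i + a j) / 2 * (x $ i $ j \<bullet> x $ i $ j) > 0"
    using assms(1)[of i] assms(1)[of j] by (intro mult_pos_pos) auto
  then have "(\<Sum>j\<in>UNIV. (a i + a j) / 2 * (x $ i $ j \<bullet> x $ i $ j)) > 0"
    by (rule sum_pos2[OF finite UNIV_I _ nn])
  then have "(\<Sum>i\<in>UNIV. \<Sum>j\<in>UNIV. (a i + a j) / 2 * (x $ i $ j \<bullet> x $ i $ j)) > 0"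
    by (rule sum_pos2[OF finite UNIV_I _ sum_nonneg[OF nn]])
  then show ?thesis by (simp add: inner_mat jordan_dgm)
qed

subsection \<open>Conjugation by real orthogonal matrices\<close>

text \<open>A real matrix acts through scalar multiplication, which associates with every product of
  scalars. Conjugation by a real orthogonal matrix is thus an automorphism even over the
  octonions.\<close>

definition lmul :: "real^'n^'n \<Rightarrow> 'k::hermitian_algebra^'n^'n \<Rightarrow> 'k^'n^'n" where
  "lmul o1 x = (\<chi> i j. \<Sum>p\<in>UNIV. o1 $ i $ p *\<^sub>R x $ p $ j)"

definition rmul :: "real^'n^'n \<Rightarrow> 'k::hermitian_algebra^'n^'n \<Rightarrow> 'k^'n^'n" where
  "rmul o1 x = (\<chi> i j. \<Sum>q\<in>UNIV. o1 $ j $ q *\<^sub>R x $ i $ q)"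

definition conj_real :: "real^'n^'n \<Rightarrow> 'k::hermitian_algebra^'n^'n \<Rightarrow> 'k^'n^'n" where
  "conj_real o1 x = lmul o1 (rmul o1 x)"

lemma lmul_nth: "lmul o1 x $ i $ j = (\<Sum>p\<in>UNIV. o1 $ i $ p *\<^sub>R x $ p $ j)" by (simp add: lmul_def)
lemma rmul_nth: "rmul o1 x $ i $ j = (\<Sum>q\<in>UNIV. o1 $ j $ q *\<^sub>R x $ i $ q)" by (simp add: rmul_def)

lemma linear_lmul: "linear (lmul o1)"
  by (rule linearI) (simp_all add: vec_eq_iff lmul_nth scaleR_add_right sum.distrib scaleR_sum_right mult.commute)

lemma adjoint_lmul: "adjoint_mat (lmul o1 x) = rmul o1 (adjoint_mat x)"
  by (simp add: vec_eq_iff lmul_nth rmul_nth ha_star_simps)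

lemma rmul_adjoint: "rmul o1 x = adjoint_mat (lmul o1 (adjoint_mat x))"
  by (simp add: adjoint_lmul)

lemma adjoint_rmul: "adjoint_mat (rmul o1 x) = lmul o1 (adjoint_mat x)"
  by (simp add: rmul_adjoint)

lemma linear_rmul: "linear (rmul o1)"
  by (rule linearI) (simp_all add: vec_eq_iff rmul_nth scaleR_add_right sum.distrib scaleR_sum_right mult.commute)

lemma linear_conj_real: "linear (conj_real o1)"
  unfolding conj_real_def using linear_compose[OF linear_rmul linear_lmul] by (simp add: o_def)

lemma lmul_rmul: "lmul o1 (rmul o2 x) = rmul o2 (lmul o1 x)"
proof -
  have "(\<Sum>p\<in>UNIV. o1 $ i $ p *\<^sub>R (\<Sum>q\<in>UNIV. o2 $ j $ q *\<^sub>R x $ p $ q)) =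
      (\<Sum>q\<in>UNIV. o2 $ j $ q *\<^sub>R (\<Sum>p\<in>UNIV. o1 $ i $ p *\<^sub>R x $ p $ q))" for i j
    unfolding scaleR_sum_right by (subst sum.swap) (simp add: mult.commute)
  then show ?thesis by (simp add: vec_eq_iff lmul_nth rmul_nth)
qed

lemma lmul_lmul: "lmul o1 (lmul o2 x) = lmul (o1 ** o2) x"
proof -
  have "(\<Sum>p\<in>UNIV. o1 $ i $ p *\<^sub>R (\<Sum>q\<in>UNIV. o2 $ p $ q *\<^sub>R x $ q $ j)) =
      (\<Sum>q\<in>UNIV. (\<Sum>p\<in>UNIV. o1 $ i $ p * o2 $ p $ q) *\<^sub>R x $ q $ j)" for i j
    unfolding scaleR_sum_right scaleR_sum_left scaleR_scaleR by (rule sum.swap)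
  then show ?thesis by (simp add: vec_eq_iff lmul_nth matrix_matrix_mult_def)
qed

lemma lmul_1: "lmul (mat 1) x = x"
  by (simp add: vec_eq_iff lmul_nth mat_def if_distrib[of "\<lambda>z. z *\<^sub>R _"] cong: if_cong)

lemma rmul_rmul: "rmul o1 (rmul o2 x) = rmul (o1 ** o2) x" by (simp add: rmul_adjoint lmul_lmul)
lemma rmul_1: "rmul (mat 1) x = x" by (simp add: rmul_adjoint lmul_1)

lemma lmul_inner: "lmul o1 x \<bullet> y = x \<bullet> lmul (transpose o1) y"
proof -
  have "lmul o1 x \<bullet> y = (\<Sum>i\<in>UNIV. \<Sum>j\<in>UNIV. \<Sum>p\<in>UNIV. o1 $ i $ p * (x $ p $ j \<bullet> y $ i $ j))"
    by (simp add: inner_mat lmul_nth inner_sum_left)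
  also have "\<dots> = (\<Sum>j\<in>UNIV. \<Sum>i\<in>UNIV. \<Sum>p\<in>UNIV. o1 $ i $ p * (x $ p $ j \<bullet> y $ i $ j))" by (rule sum.swap)
  also have "\<dots> = (\<Sum>j\<in>UNIV. \<Sum>p\<in>UNIV. \<Sum>i\<in>UNIV. o1 $ i $ p * (x $ p $ j \<bullet> y $ i $ j))"
    by (intro sum.cong refl sum.swap)
  also have "\<dots> = (\<Sum>p\<in>UNIV. \<Sum>j\<in>UNIV. \<Sum>i\<in>UNIV. o1 $ i $ p * (x $ p $ j \<bullet> y $ i $ j))" by (rule sum.swap)
  also have "\<dots> = x \<bullet> lmul (transpose o1) y"
    by (simp add: inner_mat lmul_nth inner_sum_right transpose_def)
  finally show ?thesis .
qed

lemma rmul_inner: "rmul o1 x \<bullet> y = x \<bullet> rmul (transpose o1) y"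
proof -
  have "rmul o1 x \<bullet> y = lmul o1 (adjoint_mat x) \<bullet> adjoint_mat y"
    using inner_adjoint[of "lmul o1 (adjoint_mat x)" "adjoint_mat y"] by (simp add: adjoint_lmul)
  also have "\<dots> = x \<bullet> rmul (transpose o1) y"
    using inner_adjoint[of x "rmul (transpose o1) y"] by (simp add: lmul_inner adjoint_rmul)
  finally show ?thesis .
qed

lemma lmul_times: "lmul o1 (mat_times x y) = mat_times (lmul o1 x) y"
proof -
  have "(\<Sum>p\<in>UNIV. o1 $ i $ p *\<^sub>R (\<Sum>k\<in>UNIV. x $ p $ k * y $ k $ j)) =
      (\<Sum>k\<in>UNIV. (\<Sum>p\<in>UNIV. o1 $ i $ p *\<^sub>R x $ p $ k) * y $ k $ j)" for i j
    unfolding scaleR_sum_right ha_mult_simps by (rule sum.swap)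
  then show ?thesis by (simp add: vec_eq_iff lmul_nth mat_times_nth)
qed

lemma rmul_times: "rmul o1 (mat_times x y) = mat_times x (rmul o1 y)"
  by (simp add: rmul_adjoint adjoint_mat_times lmul_times)

lemma rmul_lmul_times: "mat_times (rmul o1 x) y = mat_times x (lmul (transpose o1) y)"
proof -
  have "(\<Sum>k\<in>UNIV. (\<Sum>q\<in>UNIV. o1 $ k $ q *\<^sub>R x $ i $ q) * y $ k $ j) =
      (\<Sum>q\<in>UNIV. x $ i $ q * (\<Sum>k\<in>UNIV. o1 $ k $ q *\<^sub>R y $ k $ j))" for i j
    unfolding ha_mult_simps by (rule sum.swap)
  then show ?thesis by (simp add: vec_eq_iff mat_times_nth lmul_nth rmul_nth transpose_def)
qed

lemma conj_real_times: "orthogonal_matrix o1 \<Longrightarrow> mat_times (conj_real o1 x) (conj_real o1 y) = conj_real o1 (mat_times x y)"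
proof -
  assume "orthogonal_matrix o1"
  then have o1: "transpose o1 ** o1 = mat 1" by (simp add: orthogonal_matrix)
  have "mat_times (conj_real o1 x) (conj_real o1 y) = lmul o1 (rmul o1 (mat_times (rmul o1 x) (lmul o1 y)))"
    unfolding conj_real_def lmul_rmul[of o1 o1 y] lmul_times rmul_times ..
  also have "mat_times (rmul o1 x) (lmul o1 y) = mat_times x y"
    by (simp add: rmul_lmul_times lmul_lmul o1 lmul_1)
  finally show ?thesis by (simp add: conj_real_def)
qed

lemma conj_real_jordan: "orthogonal_matrix o1 \<Longrightarrow> jordan (conj_real o1 x) (conj_real o1 y) = conj_real o1 (jordan x y)"
  by (simp add: jordan_def conj_real_times linear_scale[OF linear_conj_real] linear_add[OF linear_conj_real])

lemma conj_real_inner: "orthogonal_matrix o1 \<Longrightarrow> conj_real o1 x \<bullet> conj_real o1 y = x \<bullet> y"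
  by (simp add: conj_real_def lmul_inner rmul_inner lmul_lmul rmul_rmul orthogonal_matrix lmul_1 rmul_1)

lemma conj_real_selfadjoint: "x \<in> selfadjoint \<Longrightarrow> conj_real o1 x \<in> selfadjoint"
  by (simp add: selfadjoint_def conj_real_def adjoint_lmul adjoint_rmul lmul_rmul)

lemma conj_real_nth: "conj_real o1 x $ i $ j = (\<Sum>p\<in>UNIV. o1 $ i $ p *\<^sub>R (\<Sum>q\<in>UNIV. o1 $ j $ q *\<^sub>R x $ p $ q))"
  by (simp add: conj_real_def lmul_nth rmul_nth)

lemma conj_real_dgm: "conj_real o1 (dgm a) $ i $ j = (\<Sum>p\<in>UNIV. o1 $ i $ p * o1 $ j $ p * a p) *\<^sub>R 1"
proof -
  have "(\<Sum>q\<in>UNIV. o1 $ j $ q *\<^sub>R (dgm a $ p $ q :: 'a)) = (o1 $ j $ p * a p) *\<^sub>R 1" for p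
    by (simp add: dgm_nth if_distrib[of "\<lambda>z. _ *\<^sub>R z"] cong: if_cong)
  then show ?thesis by (simp add: conj_real_nth scaleR_sum_left mult.assoc)
qed

section \<open>Plane rotations and Jacobi's method\<close>

definition rot :: "'n \<Rightarrow> 'n \<Rightarrow> real \<Rightarrow> real \<Rightarrow> real^'n^'n" where
  "rot i j c s = (\<chi> k l.
     if k = i then (if l = i then c else if l = j then s else 0)
     else if k = j then (if l = i then - s else if l = j then c else 0)
     else if k = l then 1 else 0)"

lemma rot_sum:
  fixes f :: "'n::finite \<Rightarrow> 'v::real_vector"
  assumes "i \<noteq> j"
  shows "(\<Sum>p\<in>UNIV. rot i j c s $ k $ p *\<^sub>R f p) =
    (if k = i then c *\<^sub>R f i + s *\<^sub>R f j else if k = j then - s *\<^sub>R f i + c *\<^sub>R f j else f k)"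
proof -
  have *: "(\<Sum>p\<in>UNIV. (if p = i then a else if p = j then b else 0) *\<^sub>R f p) = a *\<^sub>R f i + b *\<^sub>R f j" for a b
  proof -
    have "(\<Sum>p\<in>UNIV. (if p = i then a else if p = j then b else 0) *\<^sub>R f p) =
        (\<Sum>p\<in>UNIV. (if p = i then a *\<^sub>R f p else 0) + (if p = j then b *\<^sub>R f p else 0))"
      using assms by (intro sum.cong) auto
    then show ?thesis by (simp add: sum.distrib)
  qed
  moreover have "(\<Sum>p\<in>UNIV. (if k = p then 1 else 0) *\<^sub>R f p) = f k"
    by (simp add: if_distrib[of "\<lambda>z. z *\<^sub>R _"] cong: if_cong)
  ultimately show ?thesis
    using assms by (simp add: rot_def)
qed

lemma orthogonal_rot:
  assumes "i \<noteq> j" "c\<^sup>2 + s\<^sup>2 = 1" shows "orthogonal_matrix (rot i j c s)"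
proof -
  have "rot i j c s ** transpose (rot i j c s) = mat 1"
    using rot_sum[OF assms(1), of c s _ "\<lambda>p. rot i j c s $ _ $ p"] assms
    by (simp add: vec_eq_iff matrix_matrix_mult_def transpose_def)
      (auto simp: rot_def mat_def power2_eq_square algebra_simps)
  then show ?thesis by (simp add: orthogonal_matrix_def matrix_left_right_inverse)
qed

text \<open>A quarter turn realizes the transposition; its sign disappears because it enters twice
  in the conjugation.\<close>

lemma conj_real_rot_swap:
  assumes "i \<noteq> j"
  shows "conj_real (rot i j 0 1) (dgm (\<lambda>k. if k = l then 1 else 0)) =
    (dgm (\<lambda>k. if k = Transposition.transpose i j l then 1 else 0) :: 'k::hermitian_algebra^'n^'n)"
  using assms
  by (auto simp: vec_eq_iff conj_real_dgm dgm_nth if_distrib[of "\<lambda>z. _ * z"] rot_def transpose_eq_iff Transposition.transpose_def cong: if_cong)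

lemma conj_real_rot_diag:
  assumes "i \<noteq> j" and x: "x $ i $ i = \<xi> *\<^sub>R 1" "x $ j $ j = \<eta> *\<^sub>R 1" "x $ i $ j = r *\<^sub>R 1" "x $ j $ i = r *\<^sub>R 1"
  shows "conj_real (rot i j c s) x $ k $ k =
    (if k = i then (c\<^sup>2 * \<xi> + 2 * c * s * r + s\<^sup>2 * \<eta>) *\<^sub>R 1
     else if k = j then (s\<^sup>2 * \<xi> - 2 * c * s * r + c\<^sup>2 * \<eta>) *\<^sub>R 1 else x $ k $ k)"
  using assms by (auto simp: conj_real_nth rot_sum power2_eq_square simp flip: scaleR_add_left scaleR_diff_left intro!: arg_cong[of _ _ "\<lambda>z. z *\<^sub>R 1"])
    (simp_all add: algebra_simps)

text \<open>Jacobi's method: a matrix with maximal diagonal part within a compact set of this kind has no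
  off-diagonal entries, as otherwise a rotation would increase the diagonal part.\<close>

lemma jacobi_diagonalization:
  fixes S :: "('k::hermitian_algebra^'n^'n) set"
  assumes S: "compact S" "S \<noteq> {}" "S \<subseteq> selfadjoint"
    and phase: "\<And>x i j. x \<in> S \<Longrightarrow> i \<noteq> j \<Longrightarrow> x $ i $ j \<noteq> 0 \<Longrightarrow>
      \<exists>y\<in>S. \<exists>r. r \<noteq> 0 \<and> y $ i $ j = r *\<^sub>R 1 \<and> (\<forall>k. y $ k $ k = x $ k $ k)"
    and rot: "\<And>x i j c s. x \<in> S \<Longrightarrow> i \<noteq> j \<Longrightarrow> c\<^sup>2 + s\<^sup>2 = 1 \<Longrightarrow> conj_real (rot i j c s) x \<in> S"
  shows "\<exists>a. dgm a \<in> S"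
proof -
  define f where "f x = (\<Sum>k\<in>UNIV. x $ k $ k \<bullet> x $ k $ k)" for x :: "'k^'n^'n"
  have "continuous_on S f" unfolding f_def by (intro continuous_intros)
  then obtain d where d: "d \<in> S" "\<And>x. x \<in> S \<Longrightarrow> f x \<le> f d"
    using continuous_attains_sup[OF S(1,2)] by blast
  have off: "d $ i $ j = 0" if ij: "i \<noteq> j" for i j
  proof (rule ccontr)
    assume "d $ i $ j \<noteq> 0"
    then obtain y r where y: "y \<in> S" "r \<noteq> 0" "y $ i $ j = r *\<^sub>R 1" "\<forall>k. y $ k $ k = d $ k $ k"
      using phase[OF d(1) ij] by blast
    have yV: "y \<in> selfadjoint" using y S by blast
    define \<xi> \<eta> where "\<xi> = 1 \<bullet> y $ i $ i" and "\<eta> = 1 \<bullet> y $ j $ j"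
    have ent: "y $ i $ i = \<xi> *\<^sub>R 1" "y $ j $ j = \<eta> *\<^sub>R 1" "y $ j $ i = r *\<^sub>R 1"
      using selfadjoint_diag[OF yV] selfadjoint_nth[OF yV, of i j] y(3)
      by (auto simp: \<xi>_def \<eta>_def ha_star_simps)
    \<comment> \<open>\<open>R\<close> is the difference of the eigenvalues of the real symmetric
      block with diagonal \<open>\<xi>\<close>, \<open>\<eta>\<close> and off-diagonal entry
      \<open>r\<close>; rotation by half the angle \<open>\<phi>\<close> diagonalizes this
      block.\<close>
    define R where "R = sqrt ((\<xi> - \<eta>)\<^sup>2 + (2 * r)\<^sup>2)"
    have R2: "R\<^sup>2 = (\<xi> - \<eta>)\<^sup>2 + (2 * r)\<^sup>2" by (simp add: R_def)
    have R: "R > 0" using y(2) by (simp add: R_def add_nonneg_pos)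
    have "((\<xi> - \<eta>) / R)\<^sup>2 + (2 * r / R)\<^sup>2 = 1"
    proof -
      have "((\<xi> - \<eta>) / R)\<^sup>2 + (2 * r / R)\<^sup>2 = ((\<xi> - \<eta>)\<^sup>2 + (2 * r)\<^sup>2) / R\<^sup>2"
        by (simp add: power_divide add_divide_distrib)
      also have "\<dots> = 1" unfolding R2[symmetric] using R by simp
      finally show ?thesis .
    qed
    then obtain \<phi> where \<phi>: "(\<xi> - \<eta>) / R = cos \<phi>" "2 * r / R = sin \<phi>"
      using sincos_total_2pi by metis
    define c s where "c = cos (\<phi> / 2)" and "s = sin (\<phi> / 2)"
    have cs: "c\<^sup>2 + s\<^sup>2 = 1" "c\<^sup>2 - s\<^sup>2 = cos \<phi>" "2 * s * c = sin \<phi>"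
      using cos_double[of "\<phi> / 2"] sin_double[of "\<phi> / 2"] by (simp_all add: c_def s_def)
    define z where "z = conj_real (rot i j c s) y"
    have z: "z \<in> S" unfolding z_def by (rule rot[OF y(1) ij cs(1)])
    define \<xi>' \<eta>' where "\<xi>' = c\<^sup>2 * \<xi> + 2 * c * s * r + s\<^sup>2 * \<eta>" and "\<eta>' = s\<^sup>2 * \<xi> - 2 * c * s * r + c\<^sup>2 * \<eta>"
    have zz: "z $ k $ k = (if k = i then \<xi>' *\<^sub>R 1 else if k = j then \<eta>' *\<^sub>R 1 else y $ k $ k)" for k
      unfolding z_def \<xi>'_def \<eta>'_def by (rule conj_real_rot_diag[OF ij ent(1,2) y(3) ent(3)])
    have sum2: "(\<Sum>k\<in>UNIV. h k) = h i + h j + (\<Sum>k\<in>UNIV - {i, j}. h k)" for h :: "'n \<Rightarrow> real"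
      using ij by (subst sum.subset_diff[of "{i, j}"]) (auto simp: add_ac)
    have "f z = \<xi>' * \<xi>' + \<eta>' * \<eta>' + (\<Sum>k\<in>UNIV - {i, j}. y $ k $ k \<bullet> y $ k $ k)"
      unfolding f_def sum2 using ij by (simp add: zz ha_one_inner)
    moreover have "f y = \<xi> * \<xi> + \<eta> * \<eta> + (\<Sum>k\<in>UNIV - {i, j}. y $ k $ k \<bullet> y $ k $ k)"
      unfolding f_def sum2 by (simp add: ent ha_one_inner)
    moreover have "f y = f d" using y(4) by (simp add: f_def)
    \<comment> \<open>The sum of the two diagonal entries is preserved while their difference
      becomes \<open>R\<close>, so the sum of squares grows by \<open>2 * r^2\<close>.\<close>
    moreover have "\<xi>' * \<xi>' + \<eta>' * \<eta>' = \<xi> * \<xi> + \<eta> * \<eta> + 2 * r\<^sup>2"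
    proof -
      have p: "\<xi>' + \<eta>' = \<xi> + \<eta>"
      proof -
        have "\<xi>' + \<eta>' = (c\<^sup>2 + s\<^sup>2) * (\<xi> + \<eta>)" by (simp add: \<xi>'_def \<eta>'_def algebra_simps)
        then show ?thesis using cs(1) by simp
      qed
      have "\<xi>' - \<eta>' = (c\<^sup>2 - s\<^sup>2) * (\<xi> - \<eta>) + (2 * s * c) * (2 * r)"
        by (simp add: \<xi>'_def \<eta>'_def algebra_simps)
      also have "\<dots> = R\<^sup>2 / R" unfolding cs \<phi>[symmetric] R2 by (simp add: power2_eq_square add_divide_distrib)
      finally have q: "\<xi>' - \<eta>' = R" using R by (simp add: power2_eq_square)
      have "2 * (\<xi>' * \<xi>' + \<eta>' * \<eta>') = (\<xi>' + \<eta>')\<^sup>2 + (\<xi>' - \<eta>')\<^sup>2" by (simp add: power2_eq_square algebra_simps)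
      also have "\<dots> = 2 * (\<xi> * \<xi> + \<eta> * \<eta> + 2 * r\<^sup>2)"
        unfolding p q R2 by (simp add: power2_eq_square algebra_simps)
      finally show ?thesis by simp
    qed
    ultimately have "f z > f d" using y(2) by simp
    then show False using d(2)[OF z] by simp
  qed
  have "d = dgm (\<lambda>i. 1 \<bullet> d $ i $ i)"
    using selfadjoint_diag[of d] S(3) d(1) off by (auto simp: vec_eq_iff dgm_nth)
  then show ?thesis using d(1) by metis
qed

section \<open>Exponentials of diagonal matrices and the torus\<close>

lemma jordan_power_dgm: "jordan_power (dgm a) m = (dgm (\<lambda>i. a i ^ m) :: 'k::hermitian_algebra^'n^'n)"
  by (induction m) (simp_all add: mat_dgm jordan_dgm_dgm)

lemma mat_exp_dgm: "mat_exp (dgm a) = (dgm (\<lambda>i. exp (a i)) :: 'k::hermitian_algebra^'n^'n)"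
proof -
  have lin: "dgm b = (\<Sum>i\<in>UNIV. b i *\<^sub>R (dgm (\<lambda>j. if j = i then 1 else 0) :: 'k^'n^'n))" for b
    by (simp add: vec_eq_iff dgm_nth if_distrib[of "\<lambda>z. _ *\<^sub>R z"] if_distrib[of "\<lambda>z. z *\<^sub>R _"] cong: if_cong)
  have "(\<lambda>m. (a i ^ m /\<^sub>R fact m) *\<^sub>R (dgm (\<lambda>j. if j = i then 1 else 0) :: 'k^'n^'n)) sums
      (exp (a i) *\<^sub>R dgm (\<lambda>j. if j = i then 1 else 0))" for i
    by (rule sums_scaleR_left[OF exp_converges])
  then have "(\<lambda>m. \<Sum>i\<in>UNIV. (a i ^ m /\<^sub>R fact m) *\<^sub>R (dgm (\<lambda>j. if j = i then 1 else 0) :: 'k^'n^'n)) sums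
      (\<Sum>i\<in>UNIV. exp (a i) *\<^sub>R dgm (\<lambda>j. if j = i then 1 else 0))"
    by (intro sums_sum) auto
  moreover have "(1 / fact m) *\<^sub>R jordan_power (dgm a) m =
      (\<Sum>i\<in>UNIV. (a i ^ m /\<^sub>R fact m) *\<^sub>R (dgm (\<lambda>j. if j = i then 1 else 0) :: 'k^'n^'n))" for m
    unfolding jordan_power_dgm lin[of "\<lambda>i. a i ^ m"] by (simp add: scaleR_sum_right divide_inverse mult.commute)
  ultimately show ?thesis
    unfolding mat_exp_def lin[of "\<lambda>i. exp (a i)"] by (simp add: sums_iff)
qed

lemma torus_dgm: "(torus :: ('k::hermitian_algebra^'n^'n) set) = {dgm a | a. \<forall>i. a i > 0}"
proof
  show "(torus :: ('k^'n^'n) set) \<subseteq> {dgm a | a. \<forall>i. a i > 0}"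
    by (auto simp: torus_def cartan_dgm mat_exp_dgm)
  have "dgm a \<in> (torus :: ('k^'n^'n) set)" if "\<forall>i. a i > 0" for a
  proof -
    have "dgm a = mat_exp (dgm (\<lambda>i. ln (a i)) :: 'k^'n^'n)" using that by (simp add: mat_exp_dgm)
    then show ?thesis by (simp add: torus_def cartan_dgm)
  qed
  then show "{dgm a | a. \<forall>i. a i > 0} \<subseteq> (torus :: ('k^'n^'n) set)" by blast
qed

definition unit_dgm :: "'n \<Rightarrow> 'k::hermitian_algebra^'n^'n" where
  "unit_dgm i = dgm (\<lambda>j. if j = i then 1 else 0)"

lemma sum_unit_dgm: "(\<Sum>i\<in>UNIV. a i *\<^sub>R unit_dgm i) = dgm a"
  by (simp add: unit_dgm_def vec_eq_iff dgm_nth if_distrib[of "\<lambda>z. _ *\<^sub>R z"] if_distrib[of "\<lambda>z. z *\<^sub>R _"] cong: if_cong)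

lemma unit_dgm_inner: "unit_dgm i \<bullet> unit_dgm j = (if i = j then 1 else 0)"
  by (simp add: unit_dgm_def dgm_inner if_distrib[of "\<lambda>z. z * _"] cong: if_cong)

section \<open>Real, complex and quaternionic matrices\<close>

lemma mat_times_one: "mat_times (mat 1) x = x" "mat_times x (mat 1) = (x :: 'k::hermitian_algebra^'n^'n)"
  by (simp_all add: mat_dgm dgm_times times_dgm vec_eq_iff)

lemma adjoint_one [simp]: "adjoint_mat (mat 1) = (mat 1 :: 'k::hermitian_algebra^'n^'n)"
  using dgm_selfadjoint[of "\<lambda>_. 1"] by (simp add: selfadjoint_def mat_dgm)

lemma rmul_one: "rmul o1 (mat 1) = (lmul (transpose o1) (mat 1) :: 'k::hermitian_algebra^'n^'n)"
  using rmul_lmul_times[of o1 "mat 1 :: 'k^'n^'n" "mat 1"] by (simp add: mat_times_one)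

lemma conj_real_one: "orthogonal_matrix o1 \<Longrightarrow> conj_real o1 (mat 1) = (mat 1 :: 'k::hermitian_algebra^'n^'n)"
  by (simp add: conj_real_def rmul_one lmul_lmul orthogonal_matrix_def lmul_1)

lemma mat_times_matrix: "mat_times x y = x ** (y :: 'k::{hermitian_algebra,ring_1}^'n^'n)"
  by (simp add: mat_times_def matrix_matrix_mult_def)

lemmas matrix_mult_simps = mat_times_simps[where 'k = "'k::{hermitian_algebra,ring_1}", unfolded mat_times_matrix]

lemmas adjoint_matrix_mult = adjoint_mat_times[where 'k = "'k::{hermitian_algebra,ring_1}", unfolded mat_times_matrix]

lemmas matrix_inner_left = mat_times_inner_left[where 'k = "'k::{hermitian_algebra,ring_1}", unfolded mat_times_matrix]
lemmas matrix_inner_right = mat_times_inner_right[where 'k = "'k::{hermitian_algebra,ring_1}", unfolded mat_times_matrix]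

lemma jordan_matrix: "jordan x y = (1/2) *\<^sub>R (x ** y + y ** (x :: 'k::{hermitian_algebra,ring_1}^'n^'n))"
  by (simp add: jordan_def mat_times_matrix)

lemmas dgm_matrix_mult = dgm_dgm[where 'k = "'k::{hermitian_algebra,ring_1}", unfolded mat_times_matrix]

lemma adjoint_dgm [simp]: "adjoint_mat (dgm a) = (dgm a :: 'k::hermitian_algebra^'n^'n)"
  using dgm_selfadjoint selfadjointD by blast

text \<open>The polarization of P(x) z = x z x.\<close>

definition Q_assoc :: "'k::{hermitian_algebra,ring_1}^'n^'n \<Rightarrow> 'k^'n^'n \<Rightarrow> 'k^'n^'n \<Rightarrow> 'k^'n^'n" where
  "Q_assoc x y z = (1/2) *\<^sub>R (x ** z ** y + y ** z ** x)"

section \<open>Unitary conjugation and diagonalization\<close>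

definition unitary :: "('k::{hermitian_algebra,ring_1}^'n^'n) set" where
  "unitary = {a. a ** adjoint_mat a = mat 1 \<and> adjoint_mat a ** a = mat 1}"

definition K_assoc :: "('k::{hermitian_algebra,ring_1}^'n^'n \<Rightarrow> 'k^'n^'n) set" where
  "K_assoc = {(\<lambda>x. a ** x ** adjoint_mat a) | a. a \<in> unitary}"

lemma unitary_adjoint: "a \<in> unitary \<Longrightarrow> adjoint_mat a \<in> unitary"
  by (simp add: unitary_def)

lemma unitary_cancel:
  assumes "a \<in> unitary" shows "adjoint_mat a ** (a ** x) = x" "a ** (adjoint_mat a ** x) = x"
  using assms by (simp_all add: unitary_def matrix_mul_assoc)

lemma unitary_mult: "a \<in> unitary \<Longrightarrow> b \<in> unitary \<Longrightarrow> a ** b \<in> unitary"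
  by (simp add: unitary_def adjoint_matrix_mult) (metis matrix_mul_assoc matrix_mul_rid)

lemma Q_assoc_linear: "linear (\<lambda>x. Q_assoc x y z)" "linear (Q_assoc x y)"
  by (rule linearI; simp add: Q_assoc_def matrix_mult_simps algebra_simps scaleR_add_right)+

lemma Q_assoc_selfadjoint: "x \<in> selfadjoint \<Longrightarrow> y \<in> selfadjoint \<Longrightarrow> z \<in> selfadjoint \<Longrightarrow> Q_assoc x y z \<in> selfadjoint"
  by (simp add: selfadjoint_def Q_assoc_def linear_scale[OF linear_adjoint] linear_add[OF linear_adjoint]
      adjoint_matrix_mult matrix_mul_assoc add.commute)

lemma Q_assoc_one: "Q_assoc (mat 1) x y = jordan x y" "Q_assoc x y (mat 1) = jordan x y"
  by (simp_all add: Q_assoc_def jordan_matrix add.commute)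

lemma conj_selfadjoint: "x \<in> selfadjoint \<Longrightarrow> a ** x ** adjoint_mat a \<in> selfadjoint"
  for a x :: "'k::{hermitian_algebra,ring_1}^'n^'n"
  by (simp add: selfadjoint_def adjoint_matrix_mult matrix_mul_assoc)

lemma linear_conj: "linear (\<lambda>x. a ** x ** adjoint_mat (a :: 'k::{hermitian_algebra,ring_1}^'n^'n))"
  by (rule linearI) (simp_all add: matrix_mult_simps)

lemma conj_inner:
  fixes a x y :: "'k::{hermitian_algebra,ring_1}^'n^'n"
  assumes a: "a \<in> unitary"
  shows "(a ** x ** adjoint_mat a) \<bullet> (a ** y ** adjoint_mat a) = x \<bullet> y"
proof -
  have "(a ** x ** adjoint_mat a) \<bullet> (a ** y ** adjoint_mat a) =
      (x ** adjoint_mat a) \<bullet> (adjoint_mat a ** (a ** (y ** adjoint_mat a)))"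
    by (simp add: matrix_inner_left[of a] flip: matrix_mul_assoc)
  also have "\<dots> = x \<bullet> (y ** (adjoint_mat a ** a))"
    unfolding unitary_cancel(1)[OF a] by (simp add: matrix_inner_right matrix_mul_assoc)
  finally show ?thesis using a by (simp add: unitary_def)
qed

text \<open>Each unitary matrix has the norm of the unit matrix, and the defining equations are
  closed. The conjugation orbit of a matrix is then compact, as Jacobi's method demands.\<close>

lemma compact_unitary: "compact (unitary :: ('k::{hermitian_algebra,ring_1}^'n^'n) set)"
proof (unfold compact_eq_bounded_closed, intro conjI)
  have "norm a = norm (mat 1 :: 'k^'n^'n)" if "a \<in> unitary" for a :: "'k^'n^'n"
  proof -
    have "a \<bullet> a = (a ** mat 1) \<bullet> a" by simp
    also have "\<dots> = mat 1 \<bullet> (mat 1 :: 'k^'n^'n)"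
      unfolding matrix_inner_left using that by (simp add: unitary_def)
    finally show ?thesis by (simp add: norm_eq_sqrt_inner)
  qed
  then show "bounded (unitary :: ('k^'n^'n) set)" unfolding bounded_iff by (metis order_refl)
  have ca: "continuous_on UNIV (adjoint_mat :: 'k^'n^'n \<Rightarrow> _)"
    using linear_adjoint by (intro linear_continuous_on) (simp add: linear_conv_bounded_linear)
  have cm: "continuous_on UNIV f \<Longrightarrow> continuous_on UNIV h \<Longrightarrow> continuous_on UNIV (\<lambda>a. f a ** h a)" for f h :: "'k^'n^'n \<Rightarrow> 'k^'n^'n"
    using bounded_bilinear.continuous_on[of "mat_times :: 'k^'n^'n \<Rightarrow> _"] bilinear_mat_times
    by (auto simp: mat_times_matrix bilinear_conv_bounded_bilinear)
  show "closed (unitary :: ('k^'n^'n) set)"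
    unfolding unitary_def by (intro closed_Collect_conj closed_Collect_eq cm ca continuous_on_id continuous_on_const)
qed

text \<open>\<open>lmul o1 (mat 1)\<close> is \<open>o1\<close> read as a matrix over the larger
  scalars, so the rotations of Jacobi's method stay within unitary conjugation.\<close>

lemma real_orthogonal_unitary:
  fixes o1 :: "real^'n^'n" and x :: "'k::{hermitian_algebra,ring_1}^'n^'n"
  assumes "orthogonal_matrix o1"
  defines "a \<equiv> lmul o1 (mat 1) :: 'k^'n^'n"
  shows "a \<in> unitary" "conj_real o1 x = a ** x ** adjoint_mat a"
proof -
  have L: "a ** y = lmul o1 y" for y
    using lmul_times[of o1 "mat 1" y] mat_times_one(1)[of y] by (simp add: a_def mat_times_matrix)
  have ad: "adjoint_mat a = rmul o1 (mat 1)" by (simp add: a_def adjoint_lmul)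
  have R: "y ** adjoint_mat a = rmul o1 y" for y
    using rmul_times[of o1 y "mat 1"] mat_times_one(2)[of y] by (simp add: ad mat_times_matrix)
  have L': "adjoint_mat a ** y = lmul (transpose o1) y" for y
    using rmul_lmul_times[of o1 "mat 1" y] mat_times_one(1)[of "lmul (transpose o1) y"]
    by (simp add: ad mat_times_matrix)
  show "conj_real o1 x = a ** x ** adjoint_mat a" by (simp add: conj_real_def L R lmul_rmul)
  have "a ** adjoint_mat a = mat 1"
    unfolding L ad using conj_real_one[OF assms(1)] by (simp add: conj_real_def)
  then show "a \<in> unitary" unfolding unitary_def L' mem_Collect_eq
    using assms(1) by (simp add: a_def lmul_lmul orthogonal_matrix lmul_1)
qed

lemma spectral_matrix:
  fixes x :: "'k::{hermitian_algebra,ring_1}^'n^'n"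
  assumes x: "x \<in> selfadjoint"
  obtains a d where "a \<in> unitary" "x = a ** dgm d ** adjoint_mat a"
proof -
  define S where "S = (\<lambda>a. a ** x ** adjoint_mat a) ` unitary"
  have step: "b ** z ** adjoint_mat b \<in> S" if zb: "z \<in> S" "b \<in> unitary" for z b
  proof -
    obtain a where a: "a \<in> unitary" "z = a ** x ** adjoint_mat a" using zb by (auto simp: S_def)
    have "b ** z ** adjoint_mat b = (b ** a) ** x ** adjoint_mat (b ** a)"
      by (simp add: a adjoint_matrix_mult matrix_mul_assoc)
    then show ?thesis using unitary_mult[OF zb(2) a(1)] by (auto simp: S_def)
  qed
  have "\<exists>d. dgm d \<in> S"
  proof (rule jacobi_diagonalization)
    have ca: "continuous_on unitary (adjoint_mat :: 'k^'n^'n \<Rightarrow> _)"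
      using linear_adjoint by (intro linear_continuous_on) (simp add: linear_conv_bounded_linear)
    have cm: "continuous_on unitary f \<Longrightarrow> continuous_on unitary h \<Longrightarrow> continuous_on unitary (\<lambda>a. f a ** h a)"
      for f h :: "'k^'n^'n \<Rightarrow> 'k^'n^'n"
      using bounded_bilinear.continuous_on[of "mat_times :: 'k^'n^'n \<Rightarrow> _"] bilinear_mat_times
      by (auto simp: mat_times_matrix bilinear_conv_bounded_bilinear)
    show "compact S" unfolding S_def
      by (intro compact_continuous_image cm ca continuous_on_id continuous_on_const compact_unitary)
    have "mat 1 \<in> (unitary :: ('k^'n^'n) set)" by (simp add: unitary_def)
    then show "S \<noteq> {}" by (auto simp: S_def)
    show "S \<subseteq> selfadjoint" using x by (auto simp: S_def conj_selfadjoint)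
    show "conj_real (rot i j c s) z \<in> S" if "z \<in> S" "i \<noteq> j" "c\<^sup>2 + s\<^sup>2 = 1" for z i j c s
      using step[OF that(1) real_orthogonal_unitary(1)[OF orthogonal_rot[OF that(2,3)]]]
      by (simp add: real_orthogonal_unitary(2)[OF orthogonal_rot[OF that(2,3)]])
    fix z i j assume z: "z \<in> S" "i \<noteq> j" "z $ i $ j \<noteq> 0"
    \<comment> \<open>Multiplying row \<open>i\<close> by this unit turns the entry at (i, j) into
      its norm. The diagonal is unchanged: its entries are real and commute past the unit, which
      then meets its conjugate.\<close>
    define \<alpha> where "\<alpha> = (1 / norm (z $ i $ j)) *\<^sub>R star (z $ i $ j)"
    define u where "u k = (if k = i then \<alpha> else 1)" for k
    define b :: "'k^'n^'n" where "b = (\<chi> k l. if k = l then u k else 0)"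
    have nz: "norm (z $ i $ j) > 0" "z $ i $ j \<bullet> z $ i $ j = (norm (z $ i $ j))\<^sup>2"
      using z(3) by (auto simp: power2_norm_eq_inner)
    have uu: "u k * star (u k) = 1" "star (u k) * u k = 1" for k
      using nz by (auto simp: u_def \<alpha>_def ha_star_simps ha_mult_simps ha_star_self ha_self_star ha_inner_star ha_one_inner power2_eq_square)
    have bz: "(b ** y) $ k $ l = u k * y $ k $ l" for y k l
      by (simp add: matrix_matrix_mult_def b_def if_distrib[of "\<lambda>z. z * _"] cong: if_cong)
    have bn: "b $ k $ l = (if k = l then u k else 0)" for k l by (simp add: b_def)
    have ab: "adjoint_mat b = (\<chi> k l. if k = l then star (u k) else 0)"
      by (auto simp: vec_eq_iff bn ha_star_simps)
    have zb: "(y ** adjoint_mat b) $ k $ l = y $ k $ l * star (u l)" for y k l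
      by (simp add: matrix_matrix_mult_def ab if_distrib[of "\<lambda>z. _ * z"] cong: if_cong)
    have abz: "(adjoint_mat b ** y) $ k $ l = star (u k) * y $ k $ l" for y k l
      by (simp add: matrix_matrix_mult_def ab if_distrib[of "\<lambda>z. z * _"] cong: if_cong)
    have ba: "adjoint_mat b ** b = mat 1" "b ** adjoint_mat b = mat 1"
      unfolding vec_eq_iff abz zb by (auto simp: bn mat_def uu)
    then have bu: "b \<in> unitary" by (simp add: unitary_def)
    define y where "y = b ** z ** adjoint_mat b"
    have ynth: "y $ k $ l = u k * z $ k $ l * star (u l)" for k l by (simp add: y_def zb bz)
    have zs: "z \<in> selfadjoint" using z(1) x by (auto simp: S_def conj_selfadjoint)
    have "y $ i $ j = norm (z $ i $ j) *\<^sub>R 1"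
      using z(2) nz by (simp add: ynth u_def \<alpha>_def ha_mult_simps ha_star_self power2_eq_square)
    moreover have "y $ k $ k = z $ k $ k" for k
    proof -
      obtain r where "z $ k $ k = r *\<^sub>R 1" using selfadjoint_diag[OF zs, of k] by metis
      then show ?thesis by (simp add: ynth ha_mult_simps uu)
    qed
    ultimately show "\<exists>y\<in>S. \<exists>r. r \<noteq> 0 \<and> y $ i $ j = r *\<^sub>R 1 \<and> (\<forall>k. y $ k $ k = z $ k $ k)"
      using step[OF z(1) bu] nz(1) unfolding y_def[symmetric] by (intro bexI[of _ y] exI[of _ "norm (z $ i $ j)"]) auto
  qed
  then obtain d a where d: "dgm d = a ** x ** adjoint_mat a" "a \<in> unitary" by (auto simp: S_def)
  have "adjoint_mat a ** dgm d ** adjoint_mat (adjoint_mat a) = adjoint_mat a ** (a ** (x ** (adjoint_mat a ** a)))"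
    by (simp add: d(1) matrix_mul_assoc)
  also have "\<dots> = x" using d(2) by (simp add: unitary_cancel) (simp add: unitary_def)
  finally show ?thesis using that[OF unitary_adjoint[OF d(2)]] by metis
qed

subsection \<open>The cones over associative scalars\<close>

lemma matrix_vector_inner:
  fixes a :: "'k::{hermitian_algebra,ring_1}^'n^'n"
  shows "\<xi> \<bullet> (a *v \<eta>) = (adjoint_mat a *v \<xi>) \<bullet> \<eta>"
proof -
  have "\<xi> \<bullet> (a *v \<eta>) = (\<Sum>i\<in>UNIV. \<Sum>j\<in>UNIV. (star (a $ i $ j) * \<xi> $ i) \<bullet> \<eta> $ j)"
    by (simp add: inner_vec_def matrix_vector_mult_def inner_sum_right ha_inner_left ha_star_simps)
  also have "\<dots> = (\<Sum>j\<in>UNIV. \<Sum>i\<in>UNIV. (star (a $ i $ j) * \<xi> $ i) \<bullet> \<eta> $ j)" by (rule sum.swap)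
  finally show ?thesis by (simp add: inner_vec_def matrix_vector_mult_def inner_sum_left)
qed

lemma invertible_adjoint_inj:
  fixes a :: "'k::{hermitian_algebra,ring_1}^'n^'n"
  assumes "invertible a" "adjoint_mat a *v \<xi> = 0" shows "\<xi> = 0"
proof -
  obtain b where "a ** b = mat 1" using assms(1) by (auto simp: invertible_def)
  then have "adjoint_mat b ** adjoint_mat a = mat 1" by (metis adjoint_matrix_mult adjoint_one)
  then have "\<xi> = adjoint_mat b *v (adjoint_mat a *v \<xi>)" by (simp add: matrix_vector_mul_assoc)
  then show ?thesis using assms(2) by simp
qed

lemma congruence_posdef:
  fixes a :: "'k::{hermitian_algebra,ring_1}^'n^'n"
  assumes "invertible a" "x \<in> posdef" shows "a ** x ** adjoint_mat a \<in> posdef"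
  unfolding posdef_def mem_Collect_eq
proof (intro conjI allI impI)
  show "a ** x ** adjoint_mat a \<in> selfadjoint" using assms by (simp add: posdef_def conj_selfadjoint)
  fix \<xi> :: "'k^'n" assume "\<xi> \<noteq> 0"
  then have "adjoint_mat a *v \<xi> \<noteq> 0" using invertible_adjoint_inj[OF assms(1)] by blast
  then have "(adjoint_mat a *v \<xi>) \<bullet> (x *v (adjoint_mat a *v \<xi>)) > 0" using assms(2) by (simp add: posdef_def)
  then show "\<xi> \<bullet> (a ** x ** adjoint_mat a *v \<xi>) > 0"
    using matrix_vector_inner[of \<xi> a] by (simp add: matrix_vector_mul_assoc[symmetric])
qed

lemma invertible_comp: "invertible a \<Longrightarrow> invertible b \<Longrightarrow> invertible (a ** (b :: 'k::ring_1^'n^'n))"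
  unfolding invertible_def by (metis matrix_mul_assoc matrix_mul_rid)

lemma unitary_invertible: "a \<in> unitary \<Longrightarrow> invertible a"
  unfolding unitary_def invertible_def by blast

lemma dgm_invertible: "(\<And>i. a i \<noteq> 0) \<Longrightarrow> invertible (dgm a :: 'k::{hermitian_algebra,ring_1}^'n^'n)"
  unfolding invertible_def
  by (rule exI[of _ "dgm (\<lambda>i. inverse (a i))"]) (simp add: dgm_matrix_mult mat_dgm)

lemma congruences_image:
  assumes "k \<in> (congruences :: ('k::{hermitian_algebra,ring_1}^'n^'n \<Rightarrow> _) set)"
  shows "k ` posdef = posdef"
proof -
  obtain a where a: "invertible a" "k = (\<lambda>x. a ** x ** adjoint_mat a)" using assms by (auto simp: congruences_def)
  obtain b where b: "a ** b = mat 1" "b ** a = mat 1" using a(1) by (auto simp: invertible_def)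
  have ib: "invertible b" using b by (auto simp: invertible_def)
  have "k (b ** x ** adjoint_mat b) = x" for x
  proof -
    have "k (b ** x ** adjoint_mat b) = (a ** b) ** x ** adjoint_mat (a ** b)"
      by (simp add: a adjoint_matrix_mult matrix_mul_assoc)
    then show ?thesis by (simp add: b)
  qed
  then have "posdef \<subseteq> k ` posdef" using congruence_posdef[OF ib] by (metis image_eqI subsetI)
  then show ?thesis using congruence_posdef[OF a(1)] by (auto simp: a)
qed

lemma dgm_posdef: "(dgm a :: 'k::{hermitian_algebra,ring_1}^'n^'n) \<in> posdef \<longleftrightarrow> (\<forall>i. a i > 0)"
proof -
  have q: "\<xi> \<bullet> (dgm a *v \<xi>) = (\<Sum>i\<in>UNIV. a i * (\<xi> $ i \<bullet> \<xi> $ i))" for \<xi> :: "'k^'n"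
    by (simp add: inner_vec_def matrix_vector_mult_def dgm_nth if_distrib[of "\<lambda>z. z * _"] ha_mult_simps cong: if_cong)
  show ?thesis
  proof
    assume pd: "(dgm a :: 'k^'n^'n) \<in> posdef"
    show "\<forall>i. a i > 0"
    proof
      fix i
      let ?\<xi> = "axis i 1 :: 'k^'n"
      have "?\<xi> \<noteq> 0" using ha_one_inner[where 'a = 'k] by (metis axis_eq_0_iff inner_zero_left zero_neq_one)
      then have "(\<Sum>k\<in>UNIV. a k * (?\<xi> $ k \<bullet> ?\<xi> $ k)) > 0" using pd by (auto simp: posdef_def q)
      then show "a i > 0"
        by (simp add: axis_def if_distrib[of "\<lambda>z. z \<bullet> _"] if_distrib[of "\<lambda>z. _ \<bullet> z"] if_distrib[of "\<lambda>z. _ * z"] ha_one_inner cong: if_cong)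
    qed
  next
    assume a: "\<forall>i. a i > 0"
    have "(\<Sum>i\<in>UNIV. a i * (\<xi> $ i \<bullet> \<xi> $ i)) > 0" if nz: "\<xi> \<noteq> 0" for \<xi> :: "'k^'n"
    proof -
      obtain i where "\<xi> $ i \<noteq> 0" using nz by (auto simp: vec_eq_iff)
      then show ?thesis using a by (intro sum_pos2[of _ i]) (auto simp: less_imp_le)
    qed
    then show "(dgm a :: 'k^'n^'n) \<in> posdef" by (simp add: posdef_def dgm_selfadjoint q)
  qed
qed

section \<open>Diagonal matrix units as a Jordan frame; the associative cones\<close>

lemma frame_dg: "frame_data.dg (unit_dgm :: _ \<Rightarrow> 'k::hermitian_algebra^'n^'n) = dgm"
  by (rule ext) (simp add: frame_data.dg_def sum_unit_dgm)

lemma frame_e: "frame_data.e (unit_dgm :: _ \<Rightarrow> 'k::hermitian_algebra^'n^'n) = mat 1"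
  by (simp add: frame_data.e_def frame_dg mat_dgm)

lemma frame_W: "frame_data.W (unit_dgm :: _ \<Rightarrow> 'k::hermitian_algebra^'n^'n) = cartan"
  by (simp add: frame_data.W_def frame_dg cartan_dgm)

lemma frame_T: "frame_data.T (unit_dgm :: _ \<Rightarrow> 'k::hermitian_algebra^'n^'n) = torus"
  by (simp add: frame_data.T_def frame_dg torus_dgm)

lemma frame_jmul_a: "frame_data.jmul Q_assoc unit_dgm = jordan"
  by (intro ext) (simp add: frame_data.jmul_def frame_e Q_assoc_one)

lemma frame_D_a: "frame_data.D Q_assoc unit_dgm a = (\<lambda>x. dgm a ** x ** dgm a)"
  by (intro ext) (simp add: frame_data.D_def frame_dg Q_assoc_def flip: scaleR_2)

lemma jordan_frame_matrix:
  "jordan_frame (selfadjoint :: ('k::{hermitian_algebra,ring_1}^'n^'n) set) Q_assoc unit_dgm K_assoc"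
proof (rule jordan_frame.intro)
  show "subspace (selfadjoint :: ('k^'n^'n) set)" by (rule subspace_selfadjoint)
  show "unit_dgm i \<in> (selfadjoint :: ('k^'n^'n) set)" for i by (simp add: unit_dgm_def dgm_selfadjoint)
  show "(unit_dgm i :: 'k^'n^'n) \<bullet> unit_dgm j = (if i = j then 1 else 0)" for i j by (rule unit_dgm_inner)
  show "linear (\<lambda>x. Q_assoc x y z)" for y z :: "'k^'n^'n" by (rule Q_assoc_linear)
  show "linear (Q_assoc x y)" for x y :: "'k^'n^'n" by (rule Q_assoc_linear)
  show "Q_assoc x y z = Q_assoc y x z" for x y z :: "'k^'n^'n" by (simp add: Q_assoc_def add.commute)
  show "Q_assoc x y z \<in> selfadjoint" if "x \<in> selfadjoint" "y \<in> selfadjoint" "z \<in> selfadjoint" for x y z :: "'k^'n^'n"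
    using that by (rule Q_assoc_selfadjoint)
  show "Q_assoc x y z \<bullet> w = z \<bullet> Q_assoc x y w" if "x \<in> selfadjoint" "y \<in> selfadjoint" for x y z w :: "'k^'n^'n"
  proof -
    have "(a ** z ** b) \<bullet> w = z \<bullet> (a ** w ** b)" if "a \<in> selfadjoint" "b \<in> selfadjoint" for a b :: "'k^'n^'n"
      using that matrix_inner_right[of "a ** z" b w] matrix_inner_left[of a z "w ** b"]
      by (simp add: selfadjointD matrix_mul_assoc)
    then show ?thesis using that by (simp add: Q_assoc_def inner_add_left inner_add_right)
  qed
  show "Q_assoc (frame_data.e unit_dgm) (frame_data.e unit_dgm) x = x" for x :: "'k^'n^'n"
    by (simp add: frame_e Q_assoc_def flip: scaleR_2)
  show "Q_assoc x y (frame_data.e unit_dgm) = frame_data.jmul Q_assoc unit_dgm x y" for x y :: "'k^'n^'n"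
    by (simp add: frame_e frame_jmul_a Q_assoc_one)
  show "Q_assoc (frame_data.dg unit_dgm a) (frame_data.dg unit_dgm b) (frame_data.dg unit_dgm d) =
      (frame_data.dg unit_dgm (\<lambda>i. a i * b i * d i) :: 'k^'n^'n)" for a b d
    by (simp add: frame_dg Q_assoc_def dgm_matrix_mult mult_ac flip: scaleR_2)
  show "frame_data.jmul Q_assoc unit_dgm (frame_data.dg unit_dgm a) x \<bullet> x > 0"
    if "\<And>i. a i > 0" "x \<noteq> 0" for a and x :: "'k^'n^'n"
    unfolding frame_jmul_a frame_dg using that by (rule jordan_dgm_pos)
  show "Q_assoc (frame_data.D Q_assoc unit_dgm a x) (frame_data.D Q_assoc unit_dgm a y) z =
      frame_data.D Q_assoc unit_dgm a (Q_assoc x y (frame_data.D Q_assoc unit_dgm a z))" for a and x y z :: "'k^'n^'n"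
    unfolding frame_D_a Q_assoc_def by (simp add: matrix_mult_simps matrix_mul_assoc)
  show "frame_data.D Q_assoc unit_dgm a (frame_data.D Q_assoc unit_dgm b x) = frame_data.D Q_assoc unit_dgm (\<lambda>i. a i * b i) x"
    for a b and x :: "'k^'n^'n"
  proof -
    have "dgm a ** (dgm b ** x ** dgm b) ** dgm a = (dgm a ** dgm b) ** x ** (dgm b ** dgm a)"
      by (simp only: matrix_mul_assoc)
    then show ?thesis by (simp add: frame_D_a dgm_matrix_mult mult.commute)
  qed
  show "Q_assoc (frame_data.dg unit_dgm a) z (frame_data.dg unit_dgm a) =
      frame_data.jmul Q_assoc unit_dgm (frame_data.dg unit_dgm (\<lambda>i. (a i)\<^sup>2)) z" for a and z :: "'k^'n^'n"
  proof -
    have "dgm (\<lambda>i. (a i)\<^sup>2) = (dgm a ** dgm a :: 'k^'n^'n)" by (simp add: dgm_matrix_mult power2_eq_square)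
    then show ?thesis by (simp add: frame_dg frame_jmul_a Q_assoc_def jordan_matrix matrix_mul_assoc)
  qed
  show "Q_assoc v v (frame_data.dg unit_dgm a) \<bullet> frame_data.dg unit_dgm a \<le>
      frame_data.jmul Q_assoc unit_dgm (frame_data.dg unit_dgm a) v \<bullet> frame_data.jmul Q_assoc unit_dgm (frame_data.dg unit_dgm a) v"
    if v: "v \<in> selfadjoint" for a and v :: "'k^'n^'n"
  proof -
    have "Q_assoc v v (dgm a) \<bullet> dgm a = (v ** dgm a) \<bullet> (dgm a ** v)"
      using v by (simp add: Q_assoc_def matrix_inner_right[of "v ** dgm a" v] selfadjointD flip: scaleR_2)
    also have "\<dots> = (\<Sum>i\<in>UNIV. \<Sum>j\<in>UNIV. (a i * a j) * (v $ i $ j \<bullet> v $ i $ j))"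
      by (simp add: inner_mat dgm_times times_dgm mult_ac flip: mat_times_matrix)
    \<comment> \<open>Entry by entry this is the inequality of arithmetic and geometric means, in
      the form valid for all real numbers.\<close>
    also have "\<dots> \<le> (\<Sum>i\<in>UNIV. \<Sum>j\<in>UNIV. ((a i + a j) / 2)\<^sup>2 * (v $ i $ j \<bullet> v $ i $ j))"
    proof (intro sum_mono mult_right_mono inner_ge_zero)
      show "a i * a j \<le> ((a i + a j) / 2)\<^sup>2" for i j
        using zero_le_power2[of "a i - a j"] by (simp add: power2_eq_square field_simps)
    qed
    also have "\<dots> = jordan (dgm a) v \<bullet> jordan (dgm a) v"
      by (simp add: inner_mat jordan_dgm power2_eq_square mult_ac)
    finally show ?thesis by (simp add: frame_dg frame_jmul_a)
  qed
  show "linear k" if "k \<in> K_assoc" for k :: "'k^'n^'n \<Rightarrow> 'k^'n^'n" using that linear_conj by (auto simp: K_assoc_def)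
  show "k x \<in> selfadjoint" if "k \<in> K_assoc" "x \<in> selfadjoint" for k and x :: "'k^'n^'n"
    using that by (auto simp: K_assoc_def conj_selfadjoint)
  show "k x \<bullet> k y = x \<bullet> y" if "k \<in> K_assoc" for k and x y :: "'k^'n^'n"
    using that by (auto simp: K_assoc_def conj_inner)
  show "k (frame_data.e unit_dgm) = frame_data.e unit_dgm" if "k \<in> K_assoc" for k :: "'k^'n^'n \<Rightarrow> _"
    using that by (auto simp: K_assoc_def frame_e unitary_def)
  show "Q_assoc (k x) (k y) (k z) = k (Q_assoc x y z)" if "k \<in> K_assoc" for k and x y z :: "'k^'n^'n"
    using that by (auto simp: K_assoc_def Q_assoc_def matrix_mult_simps unitary_cancel simp flip: matrix_mul_assoc)
  show "(\<lambda>x. x) \<in> (K_assoc :: ('k^'n^'n \<Rightarrow> _) set)"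
    unfolding K_assoc_def mem_Collect_eq by (rule exI[of _ "mat 1"]) (simp add: unitary_def)
  show "\<exists>k'\<in>K_assoc. \<forall>x\<in>selfadjoint. k' (k x) = x \<and> k (k' x) = x" if k: "k \<in> K_assoc" for k :: "'k^'n^'n \<Rightarrow> _"
  proof -
    obtain a where a: "a \<in> unitary" "k = (\<lambda>x. a ** x ** adjoint_mat a)" using k by (auto simp: K_assoc_def)
    let ?k' = "\<lambda>x. adjoint_mat a ** x ** adjoint_mat (adjoint_mat a)"
    have "?k' \<in> K_assoc" using unitary_adjoint[OF a(1)] unfolding K_assoc_def by blast
    moreover have "?k' (k x) = x \<and> k (?k' x) = x" for x
      using a(1) by (simp add: a(2) unitary_cancel flip: matrix_mul_assoc) (simp add: unitary_def)
    ultimately show ?thesis by (intro bexI[of _ ?k']) auto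
  qed
  show "\<exists>k\<in>K_assoc. \<exists>a. x = k (frame_data.dg unit_dgm a)" if x: "x \<in> selfadjoint" for x :: "'k^'n^'n"
  proof -
    obtain a d where a: "a \<in> unitary" "x = a ** dgm d ** adjoint_mat a" using spectral_matrix[OF x] .
    then have "(\<lambda>x. a ** x ** adjoint_mat a) \<in> K_assoc" by (auto simp: K_assoc_def)
    then show ?thesis using a(2) by (auto simp: frame_dg)
  qed
  show "\<exists>k\<in>K_assoc. \<forall>l. k (unit_dgm l :: 'k^'n^'n) = unit_dgm (Transposition.transpose i j l)" for i j
  proof (cases "i = j")
    case True
    then show ?thesis
      by (intro bexI[of _ "\<lambda>x. x"] \<open>(\<lambda>x. x) \<in> K_assoc\<close>) simp
  next
    case False
    have o1: "orthogonal_matrix (rot i j 0 1)" by (rule orthogonal_rot[OF False]) simp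
    have "(conj_real (rot i j 0 1) :: 'k^'n^'n \<Rightarrow> _) \<in> K_assoc"
      unfolding K_assoc_def mem_Collect_eq
      by (rule exI[of _ "lmul (rot i j 0 1) (mat 1)"]) (auto simp: fun_eq_iff real_orthogonal_unitary[OF o1])
    then show ?thesis using conj_real_rot_swap[OF False] unfolding unit_dgm_def by blast
  qed
qed

text \<open>Positivity of the form on column vectors and positivity of Jordan multiplication agree
  on diagonal matrices, and both are invariant under unitary conjugation; the spectral theorem does
  the rest.\<close>

lemma posdef_eq: "frame_data.U selfadjoint Q_assoc unit_dgm = (posdef :: ('k::{hermitian_algebra,ring_1}^'n^'n) set)"
proof -
  interpret jordan_frame "selfadjoint :: ('k^'n^'n) set" Q_assoc unit_dgm K_assoc by (rule jordan_frame_matrix)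
  have "x \<in> U \<longleftrightarrow> x \<in> posdef" if x: "x \<in> selfadjoint" for x
  proof -
    obtain a d where a: "a \<in> unitary" "x = a ** dgm d ** adjoint_mat a" using spectral_matrix[OF x] .
    have "x \<in> U \<longleftrightarrow> dgm d \<in> U"
      using K_U[of "\<lambda>x. a ** x ** adjoint_mat a" "dgm d"] a by (auto simp: K_assoc_def dgm_selfadjoint)
    also have "\<dots> \<longleftrightarrow> dgm d \<in> (posdef :: ('k^'n^'n) set)" using dg_U[of d] by (simp add: frame_dg dgm_posdef)
    also have "\<dots> \<longleftrightarrow> x \<in> posdef"
    proof
      assume "x \<in> posdef"
      then have "adjoint_mat a ** x ** adjoint_mat (adjoint_mat a) \<in> posdef"
        using congruence_posdef unitary_invertible unitary_adjoint a(1) by blast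
      moreover have "adjoint_mat a ** x ** adjoint_mat (adjoint_mat a) = dgm d"
        using a(1) by (simp add: a(2) unitary_cancel flip: matrix_mul_assoc) (simp add: unitary_def)
      ultimately show "dgm d \<in> (posdef :: ('k^'n^'n) set)" by simp
    qed (use a congruence_posdef unitary_invertible in blast)
    finally show ?thesis .
  qed
  moreover have "posdef \<subseteq> (selfadjoint :: ('k^'n^'n) set)" by (auto simp: posdef_def)
  ultimately show ?thesis using U_V by blast
qed

theorem matrix_cone:
  assumes "invariant_metric selfadjoint (posdef :: ('k::{hermitian_algebra,ring_1}^'n^'n) set) congruences g"
  shows "has_flat_frobenius_torus (cartan :: ('k^'n^'n) set) torus selfadjoint posdef congruences g \<and>
    homogeneous (posdef :: ('k^'n^'n) set) congruences \<and>
    cartan_hadamard selfadjoint (posdef :: ('k^'n^'n) set) g \<and>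
    carries_pre_frobenius selfadjoint (posdef :: ('k^'n^'n) set) g"
proof -
  interpret jordan_frame "selfadjoint :: ('k^'n^'n) set" Q_assoc unit_dgm K_assoc by (rule jordan_frame_matrix)
  interpret jordan_cone "selfadjoint :: ('k^'n^'n) set" Q_assoc unit_dgm K_assoc congruences
  proof
    show "K_assoc \<subseteq> (congruences :: ('k^'n^'n \<Rightarrow> _) set)"
      using unitary_invertible by (auto simp: K_assoc_def congruences_def)
    show "D a \<in> (congruences :: ('k^'n^'n \<Rightarrow> _) set)" if "\<And>i. a i > 0" for a
    proof -
      have "invertible (dgm a :: 'k^'n^'n)" using that by (intro dgm_invertible) (simp add: less_imp_neq[symmetric])
      then show ?thesis unfolding frame_D_a congruences_def mem_Collect_eq by (intro exI[of _ "dgm a"]) simp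
    qed
    show "(\<lambda>x. k (l x)) \<in> congruences" if kl: "k \<in> congruences" "l \<in> congruences" for k l :: "'k^'n^'n \<Rightarrow> _"
    proof -
      obtain a b where a: "invertible a" "k = (\<lambda>x. a ** x ** adjoint_mat a)"
        and b: "invertible b" "l = (\<lambda>x. b ** x ** adjoint_mat b)" using kl by (auto simp: congruences_def)
      have "(\<lambda>x. k (l x)) = (\<lambda>x. (a ** b) ** x ** adjoint_mat (a ** b))"
        by (simp add: a b adjoint_matrix_mult matrix_mul_assoc)
      then show ?thesis using invertible_comp[OF a(1) b(1)] unfolding congruences_def by blast
    qed
    show "k ` U = U" if "k \<in> congruences" for k using congruences_image[OF that] by (simp add: posdef_eq)
  qed
  show ?thesis using invariant_metric_cone[of g] assms by (simp add: posdef_eq frame_W frame_T)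
qed

section \<open>The Albert algebra\<close>

subsection \<open>Alternative laws\<close>

text \<open>Over associative \<open>'q\<close> the doubling \<open>'q cd\<close> is alternative, hence it satisfies the Moufang identities.
  In this generality it stands for the octonions.\<close>

lemma cd_star_left:
  fixes a x :: "'q::{hermitian_algebra,ring_1} cd"
  shows "star a * (a * x) = (a \<bullet> a) *\<^sub>R x"
proof -
  have q: "star p * (p * r) = (p \<bullet> p) *\<^sub>R r" "p * (star p * r) = (p \<bullet> p) *\<^sub>R r"
    "r * p * star p = (p \<bullet> p) *\<^sub>R r" "r * star p * p = (p \<bullet> p) *\<^sub>R r" for p r :: 'q
    by (simp_all add: ha_star_self ha_self_star ha_mult_simps mult.assoc flip: mult.assoc[of _ p] mult.assoc[of _ "star p"])
  show ?thesis
    by (simp add: times_cd_def star_cd_def scaleR_cd_def inner_cd_def ha_star_simps ha_star_mult ha_mult_simps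
      algebra_simps q scaleR_add_left ha_star_self ha_self_star)
qed

lemma cd_star_right: "(x * a) * star a = (a \<bullet> a) *\<^sub>R (x :: 'q::{hermitian_algebra,ring_1} cd)"
  using arg_cong[OF cd_star_left[of "star a" "star x"], of star]
  by (simp add: ha_star_simps ha_star_mult ha_inner_star)

lemma cd_star_real: "star a = (2 * (1 \<bullet> a)) *\<^sub>R 1 - (a :: 'q::{hermitian_algebra,ring_1} cd)"
  using ha_trace[of a] by (simp add: algebra_simps)

lemma cd_alt_left: "a * (a * x) = (a * a) * (x :: 'q::{hermitian_algebra,ring_1} cd)"
proof -
  have "(star a * a) * x = star a * (a * x)" by (simp add: cd_star_left ha_star_self ha_mult_simps)
  then show ?thesis by (simp add: cd_star_real ha_mult_simps)
qed

lemma cd_alt_right: "(x * a) * a = x * (a * (a :: 'q::{hermitian_algebra,ring_1} cd))"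
proof -
  have "(x * a) * star a = x * (a * star a)" by (simp add: cd_star_right ha_self_star ha_mult_simps)
  then show ?thesis by (simp add: cd_star_real ha_mult_simps)
qed

definition assoc :: "'q::{hermitian_algebra,ring_1} cd \<Rightarrow> 'q::{hermitian_algebra,ring_1} cd \<Rightarrow> 'q::{hermitian_algebra,ring_1} cd \<Rightarrow> 'q::{hermitian_algebra,ring_1} cd" where
  "assoc a b x = (a * b) * x - a * (b * x)"

text \<open>Linearization of the left alternative law in \<open>a + b\<close>. With the analogous
  swap of the last two arguments the associator is alternating.\<close>

lemma assoc_swap12: "assoc a b x = - assoc b a x"
  using cd_alt_left[of "a + b" x] by (simp add: assoc_def ha_mult_simps cd_alt_left algebra_simps)

lemma assoc_swap23: "assoc a b x = - assoc a x b"
  using cd_alt_right[of a "b + x"] by (simp add: assoc_def ha_mult_simps cd_alt_right algebra_simps)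

lemma cd_flexible: "(a * x) * a = a * (x * (a :: 'q::{hermitian_algebra,ring_1} cd))"
proof -
  have "assoc a x a = - assoc a a x" by (rule assoc_swap23)
  then show ?thesis by (simp add: assoc_def cd_alt_left)
qed

text \<open>The difference of the two sides is a sum of two associators; skew symmetry brings
  \<open>a\<close> to the front in both, after which the alternative law and its linearization make
  everything cancel.\<close>

lemma moufang_left: "((a * x) * a) * y = a * (x * (a * (y :: 'q::{hermitian_algebra,ring_1} cd)))"
proof -
  have "((a * x) * a) * y - a * (x * (a * y)) = assoc (a * x) a y + assoc a x (a * y)"
    by (simp add: assoc_def)
  also have "\<dots> = - assoc a (a * x) y - assoc a (a * y) x"
    using assoc_swap12[of "a * x" a y] assoc_swap23[of a x "a * y"] by simp
  also have "\<dots> = a * ((a * x) * y + (a * y) * x) - ((a * a) * x) * y - ((a * a) * y) * x"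
    by (simp add: assoc_def cd_alt_left ha_mult_simps)
  also have "(a * x) * y + (a * y) * x = a * (x * y + y * x)"
    using assoc_swap23[of a x y] by (simp add: assoc_def ha_mult_simps algebra_simps)
  also have "a * (a * (x * y + y * x)) = (a * a) * (x * y + y * x)" by (rule cd_alt_left)
  also have "\<dots> = ((a * a) * x) * y + ((a * a) * y) * x"
    using assoc_swap23[of "a * a" x y] by (simp add: assoc_def ha_mult_simps algebra_simps)
  finally show ?thesis by simp
qed

text \<open>Mirror image of \<open>moufang_left\<close>: the involution reverses the order of
  products.\<close>

lemma moufang_right: "((x * a) * y) * a = x * ((a * y) * (a :: 'q::{hermitian_algebra,ring_1} cd))"
  using arg_cong[OF moufang_left[of "star a" "star y" "star x"], of star]
  by (simp add: ha_star_simps ha_star_mult cd_flexible)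

text \<open>Read as an identity between associators, \<open>moufang_left\<close> pulls a factor
  \<open>a\<close> out of \<open>assoc a (y * a) x\<close>; skew symmetry rearranges the arguments
  into the required order.\<close>

lemma moufang_middle: "(a * x) * (y * a) = (a * (x * y)) * (a :: 'q::{hermitian_algebra,ring_1} cd)"
proof -
  have "assoc a (y * a) x = - (a * assoc y a x)"
    using moufang_left[of a y x] by (simp add: assoc_def ha_mult_simps cd_flexible)
  then have "assoc a x (y * a) = a * assoc y a x" using assoc_swap23[of a x "y * a"] by simp
  also have "assoc y a x = assoc x y a" using assoc_swap23[of y a x] assoc_swap12[of y x a] by simp
  finally have "(a * x) * (y * a) - a * (x * (y * a)) = a * ((x * y) * a) - a * (x * (y * a))"
    by (simp add: assoc_def ha_mult_simps)
  then show ?thesis by (simp add: cd_flexible)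
qed

subsection \<open>Self-adjoint matrices of size three\<close>

text \<open>The off-diagonal parameters sit at (2,3), (3,1) and (1,2), so that product formulas are
  invariant under cyclic permutation.\<close>

definition herm3 :: "real \<Rightarrow> real \<Rightarrow> real \<Rightarrow> 'k \<Rightarrow> 'k \<Rightarrow> 'k \<Rightarrow> 'k::hermitian_algebra^3^3" where
  "herm3 \<xi> \<eta> \<zeta> p q r = vector [vector [\<xi> *\<^sub>R 1, r, star q], vector [star r, \<eta> *\<^sub>R 1, p], vector [q, star p, \<zeta> *\<^sub>R 1]]"

lemma herm3_nth [simp]:
  "herm3 \<xi> \<eta> \<zeta> p q r $ 1 $ 1 = \<xi> *\<^sub>R 1" "herm3 \<xi> \<eta> \<zeta> p q r $ 2 $ 2 = \<eta> *\<^sub>R 1" "herm3 \<xi> \<eta> \<zeta> p q r $ 3 $ 3 = \<zeta> *\<^sub>R 1"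
  "herm3 \<xi> \<eta> \<zeta> p q r $ 1 $ 2 = r" "herm3 \<xi> \<eta> \<zeta> p q r $ 2 $ 1 = star r"
  "herm3 \<xi> \<eta> \<zeta> p q r $ 2 $ 3 = p" "herm3 \<xi> \<eta> \<zeta> p q r $ 3 $ 2 = star p"
  "herm3 \<xi> \<eta> \<zeta> p q r $ 3 $ 1 = q" "herm3 \<xi> \<eta> \<zeta> p q r $ 1 $ 3 = star q"
  by (simp_all add: herm3_def)

lemma herm3_selfadjoint: "herm3 \<xi> \<eta> \<zeta> p q r \<in> selfadjoint"
  by (simp add: selfadjoint_def vec_eq_iff forall_3 ha_star_simps)

lemma selfadjoint_herm3:
  fixes x :: "'k::hermitian_algebra^3^3"
  assumes "x \<in> selfadjoint" obtains \<xi> \<eta> \<zeta> p q r where "x = herm3 \<xi> \<eta> \<zeta> p q r"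
proof
  show "x = herm3 (1 \<bullet> x $ 1 $ 1) (1 \<bullet> x $ 2 $ 2) (1 \<bullet> x $ 3 $ 3) (x $ 2 $ 3) (x $ 3 $ 1) (x $ 1 $ 2)"
    by (simp add: vec_eq_iff forall_3 selfadjoint_nth[OF assms] flip: selfadjoint_diag[OF assms])
qed

lemma herm3_eq_iff: "herm3 \<xi> \<eta> \<zeta> p q r = herm3 \<xi>' \<eta>' \<zeta>' p' q' r' \<longleftrightarrow>
    \<xi> = \<xi>' \<and> \<eta> = \<eta>' \<and> \<zeta> = \<zeta>' \<and> p = p' \<and> q = q' \<and> r = (r' :: 'k::hermitian_algebra)"
proof
  assume eq: "herm3 \<xi> \<eta> \<zeta> p q r = herm3 \<xi>' \<eta>' \<zeta>' p' q' r'"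
  have "(1::'k) \<noteq> 0" using ha_one_inner[where 'a = 'k] by auto
  then show "\<xi> = \<xi>' \<and> \<eta> = \<eta>' \<and> \<zeta> = \<zeta>' \<and> p = p' \<and> q = q' \<and> r = r'"
    using arg_cong[OF eq, of "\<lambda>x. x $ 1 $ 1"] arg_cong[OF eq, of "\<lambda>x. x $ 2 $ 2"] arg_cong[OF eq, of "\<lambda>x. x $ 3 $ 3"]
      arg_cong[OF eq, of "\<lambda>x. x $ 2 $ 3"] arg_cong[OF eq, of "\<lambda>x. x $ 3 $ 1"] arg_cong[OF eq, of "\<lambda>x. x $ 1 $ 2"]
    by simp
qed simp

lemma herm3_linear:
  "herm3 \<xi> \<eta> \<zeta> p q r + herm3 \<xi>' \<eta>' \<zeta>' p' q' r' = herm3 (\<xi> + \<xi>') (\<eta> + \<eta>') (\<zeta> + \<zeta>') (p + p') (q + q') (r + r')"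
  "herm3 \<xi> \<eta> \<zeta> p q r - herm3 \<xi>' \<eta>' \<zeta>' p' q' r' = herm3 (\<xi> - \<xi>') (\<eta> - \<eta>') (\<zeta> - \<zeta>') (p - p') (q - q') (r - r')"
  "c *\<^sub>R herm3 \<xi> \<eta> \<zeta> p q r = herm3 (c * \<xi>) (c * \<eta>) (c * \<zeta>) (c *\<^sub>R p) (c *\<^sub>R q) (c *\<^sub>R r)"
  by (simp_all add: vec_eq_iff forall_3 ha_star_simps scaleR_add_left scaleR_diff_left)

lemma herm3_inner: "herm3 \<xi> \<eta> \<zeta> p q r \<bullet> herm3 \<xi>' \<eta>' \<zeta>' p' q' r' =
    \<xi> * \<xi>' + \<eta> * \<eta>' + \<zeta> * \<zeta>' + 2 * (p \<bullet> p') + 2 * (q \<bullet> q') + 2 * (r \<bullet> (r' :: 'k::hermitian_algebra))"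
  by (simp add: inner_mat sum_3 ha_one_inner ha_inner_star)

lemma dgm_herm3: "dgm a = herm3 (a 1) (a 2) (a 3) 0 0 (0 :: 'k::hermitian_algebra)"
  by (simp add: vec_eq_iff forall_3 dgm_nth ha_star_simps)

lemma one_herm3: "mat 1 = herm3 1 1 1 0 0 (0 :: 'k::hermitian_algebra)"
  by (simp add: mat_dgm dgm_herm3)

lemma jordan_herm3:
  "jordan (herm3 \<xi> \<eta> \<zeta> p q r) (herm3 \<xi>' \<eta>' \<zeta>' p' q' r') =
   herm3 (\<xi> * \<xi>' + q \<bullet> q' + r \<bullet> r') (\<eta> * \<eta>' + p \<bullet> p' + r \<bullet> r') (\<zeta> * \<zeta>' + p \<bullet> p' + q \<bullet> q')
     ((1/2) *\<^sub>R ((\<eta> + \<zeta>) *\<^sub>R p' + (\<eta>' + \<zeta>') *\<^sub>R p + star (q * r') + star (q' * r)))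
     ((1/2) *\<^sub>R ((\<zeta> + \<xi>) *\<^sub>R q' + (\<zeta>' + \<xi>') *\<^sub>R q + star (r * p') + star (r' * p)))
     ((1/2) *\<^sub>R ((\<xi> + \<eta>) *\<^sub>R r' + (\<xi>' + \<eta>') *\<^sub>R r + star (p * q') + star (p' * (q :: 'k::hermitian_algebra))))"
  (is "?L = ?R")
proof -
  have polar: "(1/2) *\<^sub>R (a + b + c + (a + b' + c')) = (\<xi> + \<eta> + \<zeta>) *\<^sub>R (1::'k)"
    if "a = \<xi> *\<^sub>R 1" "b + b' = (2 * \<eta>) *\<^sub>R 1" "c + c' = (2 * \<zeta>) *\<^sub>R 1" for a b b' c c' :: 'k and \<xi> \<eta> \<zeta>
  proof -
    have "(1/2) *\<^sub>R (a + b + c + (a + b' + c')) = (1/2) *\<^sub>R (2 *\<^sub>R a + (b + b') + (c + c'))"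
      by (simp add: scaleR_2 add_ac)
    then show ?thesis unfolding that by (simp add: scaleR_add_right scaleR_add_left)
  qed
  have d1: "?L $ 1 $ 1 = ?R $ 1 $ 1"
    using polar[of "(\<xi> * \<xi>') *\<^sub>R 1" "\<xi> * \<xi>'" "r * star r'" "r' * star r" "r \<bullet> r'" "star q * q'" "star q' * q" "q \<bullet> q'"]
      ha_polar_star[of r r'] ha_star_polar[of q q']
    by (simp add: jordan_nth sum_3 ha_mult_simps ha_star_simps add_ac mult.commute)
  have d2: "?L $ 2 $ 2 = ?R $ 2 $ 2"
    using polar[of "(\<eta> * \<eta>') *\<^sub>R 1" "\<eta> * \<eta>'" "star r * r'" "star r' * r" "r \<bullet> r'" "p * star p'" "p' * star p" "p \<bullet> p'"]
      ha_polar_star[of p p'] ha_star_polar[of r r']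
    by (simp add: jordan_nth sum_3 ha_mult_simps ha_star_simps add_ac mult.commute)
  have d3: "?L $ 3 $ 3 = ?R $ 3 $ 3"
    using polar[of "(\<zeta> * \<zeta>') *\<^sub>R 1" "\<zeta> * \<zeta>'" "q * star q'" "q' * star q" "q \<bullet> q'" "star p * p'" "star p' * p" "p \<bullet> p'"]
      ha_polar_star[of q q'] ha_star_polar[of p p']
    by (simp add: jordan_nth sum_3 ha_mult_simps ha_star_simps add_ac mult.commute)
  have o: "?L $ 2 $ 3 = ?R $ 2 $ 3" "?L $ 3 $ 1 = ?R $ 3 $ 1" "?L $ 1 $ 2 = ?R $ 1 $ 2"
    by (simp_all add: jordan_nth sum_3 ha_mult_simps ha_star_simps ha_star_mult algebra_simps)
  \<comment> \<open>Only one entry of each transposed pair was compared; self-adjointness supplies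
    the other.\<close>
  have "?L \<in> selfadjoint" "?R \<in> selfadjoint" by (intro jordan_selfadjoint herm3_selfadjoint)+
  then have "?L $ j $ i = ?R $ j $ i" if "?L $ i $ j = ?R $ i $ j" for i j
    using that selfadjoint_nth by metis
  then show ?thesis using d1 d2 d3 o by (simp add: vec_eq_iff forall_3)
qed

subsection \<open>The Freudenthal product\<close>

definition freud :: "'k::hermitian_algebra^'n^'n \<Rightarrow> 'k^'n^'n \<Rightarrow> 'k^'n^'n" where
  "freud x y = 2 *\<^sub>R jordan x y - (mat 1 \<bullet> x) *\<^sub>R y - (mat 1 \<bullet> y) *\<^sub>R x + ((mat 1 \<bullet> x) * (mat 1 \<bullet> y) - x \<bullet> y) *\<^sub>R mat 1"

text \<open>On the Albert algebra this is the polarization of the quadratic representation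
  \<open>P(x) z = 2 x (x z) - x\<^sup>2 z\<close>, in Freudenthal's form \<open>P(x) z = (x \<bullet> z) x - x\<^sup># \<times> z\<close>, where
  \<open>freud x y = x \<times> y\<close> and \<open>x \<times> x = 2 x\<^sup>#\<close>.\<close>

definition Q_oct :: "'k::hermitian_algebra^'n^'n \<Rightarrow> 'k^'n^'n \<Rightarrow> 'k^'n^'n \<Rightarrow> 'k^'n^'n" where
  "Q_oct x y z = (1/2) *\<^sub>R ((x \<bullet> z) *\<^sub>R y + (y \<bullet> z) *\<^sub>R x - freud (freud x y) z)"

lemma freud_comm: "freud x y = freud y x"
  by (simp add: freud_def jordan_comm[of x y] inner_commute[of x y] mult.commute)

lemma linear_freud: "linear (freud x)"
proof (rule linearI)
  show "freud x (y + z) = freud x y + freud x z" for y z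
    by (simp add: freud_def bilinear_radd[OF bilinear_jordan] inner_add_right algebra_simps)
  show "freud x (c *\<^sub>R y) = c *\<^sub>R freud x y" for c y
    by (simp add: freud_def bilinear_rmul[OF bilinear_jordan] inner_add_right algebra_simps)
qed

lemma freud_linear:
  "freud x (y + z) = freud x y + freud x z" "freud (y + z) x = freud y x + freud z x"
  "freud x (c *\<^sub>R y) = c *\<^sub>R freud x y" "freud (c *\<^sub>R y) x = c *\<^sub>R freud y x"
  "freud x (y - z) = freud x y - freud x z" "freud (y - z) x = freud y x - freud z x"
  using linear_add[OF linear_freud] linear_scale[OF linear_freud] linear_diff[OF linear_freud] freud_comm by metis+

lemma freud_selfadjoint: "x \<in> selfadjoint \<Longrightarrow> y \<in> selfadjoint \<Longrightarrow> freud x y \<in> selfadjoint"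
  unfolding freud_def mat_dgm
  by (intro subspace_add subspace_diff subspace_scale subspace_selfadjoint jordan_selfadjoint dgm_selfadjoint)

lemma Q_oct_selfadjoint: "x \<in> selfadjoint \<Longrightarrow> y \<in> selfadjoint \<Longrightarrow> z \<in> selfadjoint \<Longrightarrow> Q_oct x y z \<in> selfadjoint"
  unfolding Q_oct_def
  by (intro subspace_add subspace_diff subspace_scale subspace_selfadjoint freud_selfadjoint)

lemma Q_oct_linear: "linear (\<lambda>x. Q_oct x y z)" "linear (Q_oct x y)"
  by (rule linearI; simp add: Q_oct_def freud_linear inner_add_left inner_add_right algebra_simps)+

lemma freud_inner: "x \<in> selfadjoint \<Longrightarrow> freud x y \<bullet> z = y \<bullet> freud x z"
  by (simp add: freud_def inner_add_left inner_add_right inner_diff_left inner_diff_right jordan_inner)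
     (simp add: inner_commute mult.commute algebra_simps)

lemma Q_oct_inner: "x \<in> selfadjoint \<Longrightarrow> y \<in> selfadjoint \<Longrightarrow> Q_oct x y z \<bullet> w = z \<bullet> Q_oct x y w"
  by (simp add: Q_oct_def inner_add_left inner_add_right inner_diff_left inner_diff_right freud_inner freud_selfadjoint)
     (simp add: inner_commute mult.commute algebra_simps)

lemma trace_one: "mat 1 \<bullet> (mat 1 :: 'k::hermitian_algebra^3^3) = 3"
  by (simp add: one_herm3 herm3_inner)

lemma jordan_one: "jordan (mat 1) x = x" "jordan x (mat 1) = (x :: 'k::hermitian_algebra^'n^'n)"
  by (simp_all add: jordan_def mat_times_one flip: scaleR_2)

lemma freud_one: "freud (mat 1) x = (mat 1 \<bullet> x) *\<^sub>R mat 1 - (x :: 'k::hermitian_algebra^3^3)"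
proof -
  have "freud (mat 1) x = 2 *\<^sub>R x - 3 *\<^sub>R x - (mat 1 \<bullet> x) *\<^sub>R mat 1 + (3 * (mat 1 \<bullet> x) - mat 1 \<bullet> x) *\<^sub>R mat 1"
    by (simp add: freud_def jordan_one trace_one)
  also have "\<dots> = (2 - 3) *\<^sub>R x + (- (mat 1 \<bullet> x) + (3 * (mat 1 \<bullet> x) - mat 1 \<bullet> x)) *\<^sub>R mat 1"
    by (simp only: scaleR_diff_left scaleR_add_left scaleR_minus_left) (simp add: algebra_simps)
  finally show ?thesis by simp
qed

lemma trace_jordan: "x \<in> selfadjoint \<Longrightarrow> mat 1 \<bullet> jordan x y = x \<bullet> (y :: 'k::hermitian_algebra^'n^'n)"
  using jordan_inner[of x y "mat 1"] by (simp add: jordan_one inner_commute)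

lemma Q_oct_one: "Q_oct (mat 1) x y = jordan x (y :: 'k::hermitian_algebra^3^3)"
  by (simp add: Q_oct_def freud_one freud_linear) (simp add: freud_def algebra_simps flip: scaleR_2)

lemma Q_oct_one_right:
  assumes "x \<in> selfadjoint" shows "Q_oct x y (mat 1) = jordan x (y :: 'k::hermitian_algebra^3^3)"
proof -
  have "mat 1 \<bullet> freud x y = (mat 1 \<bullet> x) * (mat 1 \<bullet> y) - x \<bullet> y"
    using assms by (simp add: freud_def inner_add_right inner_diff_right trace_jordan trace_one algebra_simps)
  then have "freud (freud x y) (mat 1) = ((mat 1 \<bullet> x) * (mat 1 \<bullet> y) - x \<bullet> y) *\<^sub>R mat 1 - freud x y"
    by (simp add: freud_comm[of "freud x y" "mat 1"] freud_one)
  then show ?thesis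
    by (simp add: Q_oct_def inner_commute[of _ "mat 1"]) (simp add: freud_def algebra_simps flip: scaleR_2)
qed

lemma freud_herm3:
  "freud (herm3 \<xi> \<eta> \<zeta> p q r) (herm3 \<xi>' \<eta>' \<zeta>' p' q' r') =
   herm3 (\<eta> * \<zeta>' + \<zeta> * \<eta>' - 2 * (p \<bullet> p')) (\<zeta> * \<xi>' + \<xi> * \<zeta>' - 2 * (q \<bullet> q')) (\<xi> * \<eta>' + \<eta> * \<xi>' - 2 * (r \<bullet> r'))
     (star (q * r') + star (q' * r) - \<xi> *\<^sub>R p' - \<xi>' *\<^sub>R p)
     (star (r * p') + star (r' * p) - \<eta> *\<^sub>R q' - \<eta>' *\<^sub>R q)
     (star (p * q') + star (p' * q) - \<zeta> *\<^sub>R r' - \<zeta>' *\<^sub>R (r :: 'k::hermitian_algebra))"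
  unfolding freud_def jordan_herm3 one_herm3 herm3_inner herm3_linear herm3_eq_iff
  by (simp add: algebra_simps)

text \<open>The entrywise form of P(a) for a diagonal element, as \<open>Q_oct_dgm\<close>
  confirms.\<close>

definition dscale :: "(3 \<Rightarrow> real) \<Rightarrow> 'k::hermitian_algebra^3^3 \<Rightarrow> 'k^3^3" where
  "dscale a x = (\<chi> i j. (a i * a j) *\<^sub>R x $ i $ j)"

lemma dscale_herm3: "dscale a (herm3 \<xi> \<eta> \<zeta> p q r) =
    herm3 ((a 1)\<^sup>2 * \<xi>) ((a 2)\<^sup>2 * \<eta>) ((a 3)\<^sup>2 * \<zeta>) ((a 2 * a 3) *\<^sub>R p) ((a 3 * a 1) *\<^sub>R q) ((a 1 * a 2) *\<^sub>R r)"
  by (simp add: vec_eq_iff forall_3 dscale_def ha_star_simps power2_eq_square mult.commute)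

lemma Q_oct_dgm:
  assumes "x \<in> selfadjoint" shows "Q_oct (dgm a) (dgm a) x = dscale a x"
proof -
  obtain \<xi> \<eta> \<zeta> p q r where x: "x = herm3 \<xi> \<eta> \<zeta> p q r" using selfadjoint_herm3[OF assms] .
  show ?thesis
    unfolding x Q_oct_def dgm_herm3 freud_herm3 herm3_inner herm3_linear dscale_herm3 herm3_eq_iff
    by (simp add: algebra_simps power2_eq_square ha_mult_simps ha_star_simps)
qed

text \<open>The diagonal function on the right is the adjugate of the diagonal matrix of
  \<open>a\<close>: the Freudenthal product turns P(a) into P of the adjugate.\<close>

lemma freud_dscale:
  assumes "x \<in> selfadjoint" "y \<in> selfadjoint"
  shows "freud (dscale a x) (dscale a y) = dscale (\<lambda>i. if i = 1 then a 2 * a 3 else if i = 2 then a 3 * a 1 else a 1 * a 2) (freud x y)"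
proof -
  obtain \<xi> \<eta> \<zeta> p q r where x: "x = herm3 \<xi> \<eta> \<zeta> p q r" using selfadjoint_herm3[OF assms(1)] .
  obtain \<xi>' \<eta>' \<zeta>' p' q' r' where y: "y = herm3 \<xi>' \<eta>' \<zeta>' p' q' r'" using selfadjoint_herm3[OF assms(2)] .
  show ?thesis
    unfolding x y dscale_herm3 freud_herm3 herm3_eq_iff
    by (simp add: algebra_simps power2_eq_square ha_mult_simps ha_star_simps)
qed

lemma freud_dscale':
  assumes "x \<in> selfadjoint" "y \<in> selfadjoint"
  shows "freud (dscale (\<lambda>i. if i = 1 then a 2 * a 3 else if i = 2 then a 3 * a 1 else a 1 * a 2) x) y = dscale a (freud x (dscale a y))"
proof -
  obtain \<xi> \<eta> \<zeta> p q r where x: "x = herm3 \<xi> \<eta> \<zeta> p q r" using selfadjoint_herm3[OF assms(1)] .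
  obtain \<xi>' \<eta>' \<zeta>' p' q' r' where y: "y = herm3 \<xi>' \<eta>' \<zeta>' p' q' r'" using selfadjoint_herm3[OF assms(2)] .
  show ?thesis
    unfolding x y dscale_herm3 freud_herm3 herm3_eq_iff
    by (simp add: algebra_simps power2_eq_square ha_mult_simps ha_star_simps)
qed

lemma dscale_linear: "linear (dscale a)"
  by (rule linearI) (simp_all add: vec_eq_iff dscale_def algebra_simps)

lemma dscale_selfadjoint: "x \<in> selfadjoint \<Longrightarrow> dscale a x \<in> selfadjoint"
  by (metis dscale_herm3 herm3_selfadjoint selfadjoint_herm3)

lemma dscale_inner: "dscale a x \<bullet> y = x \<bullet> dscale a y"
  by (simp add: inner_mat dscale_def)

text \<open>The fundamental formula for a diagonal element. The inner Freudenthal product converts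
  the scaling by \<open>a\<close> into that by the adjugate (\<open>freud_dscale\<close>), and the
  outer one converts it back (\<open>freud_dscale'\<close>).\<close>

lemma Q_oct_dscale:
  assumes "x \<in> selfadjoint" "y \<in> selfadjoint" "z \<in> selfadjoint"
  shows "Q_oct (dscale a x) (dscale a y) z = dscale a (Q_oct x y (dscale a z))"
  using assms
  by (simp add: Q_oct_def freud_dscale freud_dscale' freud_selfadjoint dscale_inner linear_scale[OF dscale_linear]
      linear_add[OF dscale_linear] linear_diff[OF dscale_linear])

lemma Q_oct_shift_dgm:
  fixes z :: "'k::hermitian_algebra^3^3"
  assumes "z \<in> selfadjoint" shows "Q_oct (dgm a) z (dgm a) = jordan (dgm (\<lambda>i. (a i)\<^sup>2)) z"
proof -
  obtain \<xi> \<eta> \<zeta> p q r where z: "z = herm3 \<xi> \<eta> \<zeta> p q r" using selfadjoint_herm3[OF assms] .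
  show ?thesis
    unfolding z Q_oct_def dgm_herm3 freud_herm3 herm3_inner herm3_linear jordan_herm3 herm3_eq_iff
    by (simp add: algebra_simps power2_eq_square ha_mult_simps ha_star_simps)
qed

text \<open>In coordinates the two sides differ only in the weights of the three off-diagonal square
  norms: products of two diagonal values on the left, squares of their means on the right.\<close>

lemma Q_oct_curv_dgm:
  fixes v :: "'k::hermitian_algebra^3^3"
  assumes "v \<in> selfadjoint"
  shows "Q_oct v v (dgm a) \<bullet> dgm a \<le> jordan (dgm a) v \<bullet> jordan (dgm a) v"
proof -
  obtain \<xi> \<eta> \<zeta> p q r where v: "v = herm3 \<xi> \<eta> \<zeta> p q r" using selfadjoint_herm3[OF assms] .
  have e: "Q_oct v v (dgm a) \<bullet> dgm a = (a 1 * \<xi>)\<^sup>2 + (a 2 * \<eta>)\<^sup>2 + (a 3 * \<zeta>)\<^sup>2 +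
      2 * ((a 2 * a 3) * (p \<bullet> p)) + 2 * ((a 3 * a 1) * (q \<bullet> q)) + 2 * ((a 1 * a 2) * (r \<bullet> r))"
    unfolding v Q_oct_def dgm_herm3 freud_herm3 herm3_inner herm3_linear
    by (simp add: field_simps power2_eq_square)
  have j: "jordan (dgm a) v \<bullet> jordan (dgm a) v = (a 1 * \<xi>)\<^sup>2 + (a 2 * \<eta>)\<^sup>2 + (a 3 * \<zeta>)\<^sup>2 +
      2 * (((a 2 + a 3) / 2)\<^sup>2 * (p \<bullet> p)) + 2 * (((a 3 + a 1) / 2)\<^sup>2 * (q \<bullet> q)) + 2 * (((a 1 + a 2) / 2)\<^sup>2 * (r \<bullet> r))"
    unfolding v dgm_herm3 jordan_herm3 herm3_inner
    by (simp add: ha_mult_simps ha_star_simps power2_eq_square) (simp add: field_simps)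
  have am: "x * y * (t \<bullet> t) \<le> ((x + y) / 2)\<^sup>2 * (t \<bullet> t)" for x y :: real and t :: 'k
  proof (intro mult_right_mono inner_ge_zero)
    show "x * y \<le> ((x + y) / 2)\<^sup>2"
      using zero_le_power2[of "x - y"] by (simp add: power2_eq_square field_simps)
  qed
  show ?thesis unfolding e j using am[of "a 2" "a 3" p] am[of "a 3" "a 1" q] am[of "a 1" "a 2" r] by linarith
qed

subsection \<open>Automorphisms and the spectral theorem\<close>

text \<open>Automorphisms of the Jordan product. Orthogonality on the whole matrix space is included
  because it bounds the maps and makes them invertible, which gives compact orbits and inverses
  within the set.\<close>

definition K_oct :: "('k::hermitian_algebra^'n^'n \<Rightarrow> 'k^'n^'n) set" where
  "K_oct = {k. orthogonal_transformation k \<and> (\<forall>x\<in>selfadjoint. k x \<in> selfadjoint) \<and>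
     (\<forall>x\<in>selfadjoint. \<forall>y\<in>selfadjoint. k (jordan x y) = jordan (k x) (k y)) \<and> k (mat 1) = mat 1}"

lemma K_octD:
  assumes "k \<in> K_oct"
  shows "linear k" "x \<in> selfadjoint \<Longrightarrow> k x \<in> selfadjoint" "k x \<bullet> k y = x \<bullet> y" "k (mat 1) = mat 1"
    "x \<in> selfadjoint \<Longrightarrow> y \<in> selfadjoint \<Longrightarrow> k (jordan x y) = jordan (k x) (k y)"
  using assms by (auto simp: K_oct_def orthogonal_transformation_def)

lemma K_oct_id: "(\<lambda>x. x) \<in> K_oct"
  by (simp add: K_oct_def orthogonal_transformation_id)

lemma K_oct_comp: "k \<in> K_oct \<Longrightarrow> l \<in> K_oct \<Longrightarrow> (\<lambda>x. k (l x)) \<in> K_oct"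
  unfolding K_oct_def using orthogonal_transformation_compose[of k l] by (auto simp: o_def)

lemma conj_real_K_oct: "orthogonal_matrix o1 \<Longrightarrow> conj_real o1 \<in> K_oct"
  by (simp add: K_oct_def orthogonal_transformation_def linear_conj_real conj_real_inner conj_real_selfadjoint conj_real_jordan conj_real_one)

text \<open>\<open>k\<close> maps the self-adjoint matrices injectively into themselves, hence onto
  them by dimension, so the inverse preserves them too.\<close>

lemma K_oct_inverse:
  fixes k :: "'k::hermitian_algebra^'n^'n \<Rightarrow> 'k^'n^'n"
  assumes k: "k \<in> K_oct"
  shows "\<exists>k'\<in>K_oct. \<forall>x\<in>selfadjoint. k' (k x) = x \<and> k (k' x) = x"
proof
  have ot: "orthogonal_transformation k" using k by (simp add: K_oct_def)
  have inj: "inj k" and bij: "bij k"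
    using orthogonal_transformation_inj[OF ot] orthogonal_transformation_bij[OF ot] by simp_all
  have inv: "inv k (k x) = x" "k (inv k x) = x" for x
    using inj bij by (simp_all add: bij_is_surj surj_f_inv_f)
  have "k ` selfadjoint = selfadjoint"
  proof (rule subspace_dim_equal)
    show "subspace (k ` selfadjoint)" using linear_subspace_image[OF K_octD(1)[OF k] subspace_selfadjoint] .
    show "k ` selfadjoint \<subseteq> selfadjoint" using K_octD(2)[OF k] by blast
    have "dim (k ` selfadjoint) = dim (selfadjoint :: ('k^'n^'n) set)"
      by (rule dim_image_eq[OF K_octD(1)[OF k]]) (use inj in \<open>auto intro: inj_on_subset\<close>)
    then show "dim (selfadjoint :: ('k^'n^'n) set) \<le> dim (k ` selfadjoint)" by simp
  qed (rule subspace_selfadjoint)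
  then have sa: "inv k x \<in> selfadjoint" if "x \<in> selfadjoint" for x using that inv(1) by (metis imageE)
  have "inv k (jordan x y) = jordan (inv k x) (inv k y)" if "x \<in> selfadjoint" "y \<in> selfadjoint" for x y
    using K_octD(5)[OF k sa[OF that(1)] sa[OF that(2)]] inv by metis
  moreover have "inv k (mat 1) = mat 1" using K_octD(4)[OF k] inv by metis
  ultimately show "inv k \<in> K_oct" using orthogonal_transformation_inv[OF ot] sa by (simp add: K_oct_def)
  show "\<forall>x\<in>selfadjoint. inv k (k x) = x \<and> k (inv k x) = x" using inv by simp
qed

text \<open>In the space of bounded linear maps the automorphisms are cut out by closed conditions
  on values at fixed vectors and are bounded by isometry; the orbit is the image of this compact set
  under evaluation.\<close>

lemma compact_K_oct_orbit: "compact ((\<lambda>k. k x) ` (K_oct :: ('k::hermitian_algebra^'n^'n \<Rightarrow> _) set))"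
proof -
  define KB :: "(('k^'n^'n) \<Rightarrow>\<^sub>L ('k^'n^'n)) set" where "KB = {f. blinfun_apply f \<in> K_oct}"
  have cont: "continuous_on UNIV (\<lambda>f :: ('k^'n^'n) \<Rightarrow>\<^sub>L ('k^'n^'n). blinfun_apply f y)" for y
    by (intro continuous_intros)
  have KB: "KB = {f. (\<forall>y. norm (blinfun_apply f y) = norm y) \<and>
      (\<forall>y. y \<in> selfadjoint \<longrightarrow> adjoint_mat (blinfun_apply f y) = blinfun_apply f y) \<and>
      (\<forall>y z. y \<in> selfadjoint \<longrightarrow> z \<in> selfadjoint \<longrightarrow>
        blinfun_apply f (jordan y z) = jordan (blinfun_apply f y) (blinfun_apply f z)) \<and>
      blinfun_apply f (mat 1) = mat 1}"
    by (auto simp: KB_def K_oct_def orthogonal_transformation selfadjoint_def blinfun.bounded_linear_right bounded_linear.linear)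
  have bj: "bounded_bilinear (jordan :: 'k^'n^'n \<Rightarrow> _)"
    using bilinear_jordan by (simp add: bilinear_conv_bounded_bilinear)
  have ba: "bounded_linear (adjoint_mat :: 'k^'n^'n \<Rightarrow> _)"
    using linear_adjoint by (simp add: linear_conv_bounded_linear)
  have "closed KB" unfolding KB
    by (intro closed_Collect_conj closed_Collect_all closed_Collect_imp open_Collect_const closed_Collect_eq
        continuous_on_const continuous_on_norm cont bounded_bilinear.continuous_on[OF bj] bounded_linear.continuous_on[OF ba])
  moreover have "bounded KB"
  proof (rule boundedI)
    fix f assume "f \<in> KB"
    then have "norm (blinfun_apply f y) = norm y" for y by (auto simp: KB)
    then show "norm f \<le> 1" by (intro norm_blinfun_bound) auto
  qed
  ultimately have "compact KB" by (simp add: compact_eq_bounded_closed)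
  then have "compact ((\<lambda>f. blinfun_apply f x) ` KB)"
    using cont by (intro compact_continuous_image) (auto intro: continuous_on_subset)
  moreover have "(\<lambda>f. blinfun_apply f x) ` KB = (\<lambda>k. k x) ` K_oct"
  proof
    show "(\<lambda>f. blinfun_apply f x) ` KB \<subseteq> (\<lambda>k. k x) ` K_oct" by (auto simp: KB_def)
    have "k x \<in> (\<lambda>f. blinfun_apply f x) ` KB" if "k \<in> K_oct" for k
    proof -
      have "blinfun_apply (Blinfun k) = k"
        using K_octD(1)[OF that] by (intro bounded_linear_Blinfun_apply) (simp add: linear_conv_bounded_linear)
      then show ?thesis using that by (intro image_eqI[of _ _ "Blinfun k"]) (simp_all add: KB_def)
    qed
    then show "(\<lambda>k. k x) ` K_oct \<subseteq> (\<lambda>f. blinfun_apply f x) ` KB" by blast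
  qed
  ultimately show ?thesis by simp
qed

text \<open>The triality automorphism given by a unit scalar. It makes it possible to turn an off-diagonal
  entry into a real one.\<close>

definition phase :: "'k \<Rightarrow> 'k::hermitian_algebra^3^3 \<Rightarrow> 'k^3^3" where
  "phase a x = vector [vector [x $ 1 $ 1, (star a * x $ 1 $ 2) * star a, star a * x $ 1 $ 3],
    vector [(a * x $ 2 $ 1) * a, x $ 2 $ 2, a * x $ 2 $ 3],
    vector [x $ 3 $ 1 * a, x $ 3 $ 2 * star a, x $ 3 $ 3]]"

text \<open>On the parameters of \<open>herm3\<close> the map is p -> a p, q -> q a, r -> star a r
  star a. Compatibility with the products q r, r p and p q is, in this order, the right, left and
  middle Moufang identity.\<close>

lemma phase_K_oct:
  fixes a :: "'q::{hermitian_algebra,ring_1} cd"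
  assumes "a \<bullet> a = 1"
  shows "phase a \<in> K_oct"
proof -
  have a': "star a \<bullet> star a = 1" using assms by (simp add: ha_inner_star)
  have c: "star a * (a * x) = x" "a * (star a * x) = x" "(x * a) * star a = x" "(x * star a) * a = x" for x
    using cd_star_left[of a x] cd_star_left[of "star a" x] cd_star_right[of x a] cd_star_right[of x "star a"] assms a'
    by (simp_all add: ha_star_star)
  have i: "(a * x) \<bullet> (a * y) = x \<bullet> y" "(star a * x) \<bullet> (star a * y) = x \<bullet> y"
    "(x * a) \<bullet> (y * a) = x \<bullet> y" "(x * star a) \<bullet> (y * star a) = x \<bullet> y" for x y
    by (simp_all add: ha_inner_left[of _ x] ha_inner_right[of x] c ha_star_star)
  have lin: "linear (phase a)"
    by (rule linearI) (simp_all add: vec_eq_iff forall_3 phase_def ha_mult_simps)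
  have inn: "phase a x \<bullet> phase a y = x \<bullet> y" for x y
    by (simp add: inner_mat sum_3 phase_def i)
  have pH: "phase a (herm3 \<xi> \<eta> \<zeta> p q r) = herm3 \<xi> \<eta> \<zeta> (a * p) (q * a) ((star a * r) * star a)" for \<xi> \<eta> \<zeta> p q r
    by (simp add: vec_eq_iff forall_3 phase_def ha_star_mult ha_star_star cd_flexible)
  have m: "star ((q * a) * ((star a * r) * star a)) = a * star (q * r)"
    "star (((star a * r) * star a) * (a * p)) = star (r * p) * a"
    "star ((a * p) * (q * a)) = (star a * star (p * q)) * star a" for p q r
  proof -
    show "star ((q * a) * ((star a * r) * star a)) = a * star (q * r)"
      unfolding moufang_right[symmetric] c by (simp add: ha_star_mult[of _ "star a"] ha_star_star)
    show "star (((star a * r) * star a) * (a * p)) = star (r * p) * a"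
      unfolding moufang_left c by (simp add: ha_star_mult[of "star a"] ha_star_star)
    show "star ((a * p) * (q * a)) = (star a * star (p * q)) * star a"
      unfolding moufang_middle by (simp only: ha_star_mult[of _ a] ha_star_mult[of a] cd_flexible)
  qed
  have "phase a (jordan x y) = jordan (phase a x) (phase a y)" if xy: "x \<in> selfadjoint" "y \<in> selfadjoint" for x y
  proof -
    obtain \<xi> \<eta> \<zeta> p q r where x: "x = herm3 \<xi> \<eta> \<zeta> p q r" using selfadjoint_herm3[OF xy(1)] .
    obtain \<xi>' \<eta>' \<zeta>' p' q' r' where y: "y = herm3 \<xi>' \<eta>' \<zeta>' p' q' r'" using selfadjoint_herm3[OF xy(2)] .
    show ?thesis unfolding x y pH jordan_herm3 herm3_eq_iff m
      by (simp add: i ha_mult_simps)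
  qed
  moreover have "phase a x \<in> selfadjoint" if "x \<in> selfadjoint" for x
    using selfadjoint_herm3[OF that] pH herm3_selfadjoint by metis
  moreover have "phase a (mat 1) = mat 1" by (simp add: one_herm3 pH ha_mult_simps)
  ultimately show ?thesis using lin inn by (simp add: K_oct_def orthogonal_transformation_def)
qed

lemma norm_star: "norm (star z) = norm (z :: 'k::hermitian_algebra)"
  by (simp add: norm_eq_sqrt_inner ha_inner_star)

lemma phase_real:
  fixes x :: "'q::{hermitian_algebra,ring_1} cd^3^3"
  assumes x: "x \<in> selfadjoint" and ij: "i \<noteq> j" "x $ i $ j \<noteq> 0"
  shows "\<exists>k\<in>K_oct. \<exists>r. r \<noteq> 0 \<and> k x $ i $ j = r *\<^sub>R 1 \<and> (\<forall>l. k x $ l $ l = x $ l $ l)"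
proof -
  have u: "((1 / norm z) *\<^sub>R star z) \<bullet> ((1 / norm z) *\<^sub>R star z) = 1" "norm z \<noteq> 0"
    "((1 / norm z) *\<^sub>R star z) * z = norm z *\<^sub>R 1" "z * ((1 / norm z) *\<^sub>R star z) = norm z *\<^sub>R 1"
    if "z \<noteq> 0" for z :: "'q cd"
    using that norm_star[of z] by (simp_all add: ha_mult_simps ha_star_self ha_self_star dot_square_norm power2_eq_square)
  have p23: "\<exists>k\<in>K_oct. \<exists>r. r \<noteq> 0 \<and> k y $ 2 $ 3 = r *\<^sub>R 1 \<and> (\<forall>l. k y $ l $ l = y $ l $ l)"
    if "y $ 2 $ 3 \<noteq> 0" for y :: "'q cd^3^3"
    by (rule bexI[OF _ phase_K_oct[OF u(1)[OF that]]], rule exI[of _ "norm (y $ 2 $ 3)"])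
      (simp add: phase_def forall_3 u[OF that] that)
  have p31: "\<exists>k\<in>K_oct. \<exists>r. r \<noteq> 0 \<and> k y $ 3 $ 1 = r *\<^sub>R 1 \<and> (\<forall>l. k y $ l $ l = y $ l $ l)"
    if "y $ 3 $ 1 \<noteq> 0" for y :: "'q cd^3^3"
    by (rule bexI[OF _ phase_K_oct[OF u(1)[OF that]]], rule exI[of _ "norm (y $ 3 $ 1)"])
      (simp add: phase_def forall_3 u[OF that] that)
  \<comment> \<open>On this entry \<open>phase\<close> multiplies from both sides, so the entry is
    first moved to (2,3) by a quarter turn in the 1-3 plane and moved back afterwards.\<close>
  have p21: "\<exists>k\<in>K_oct. \<exists>r. r \<noteq> 0 \<and> k y $ 2 $ 1 = r *\<^sub>R 1 \<and> (\<forall>l. k y $ l $ l = y $ l $ l)"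
    if y: "y $ 2 $ 1 \<noteq> 0" for y :: "'q cd^3^3"
  proof -
    have rn: "conj_real (rot 1 3 0 s) z $ 2 $ 3 = - s *\<^sub>R z $ 2 $ 1" "conj_real (rot 1 3 0 s) z $ 2 $ 1 = s *\<^sub>R z $ 2 $ 3"
      "conj_real (rot 1 3 0 s) z $ 1 $ 1 = (s * s) *\<^sub>R z $ 3 $ 3" "conj_real (rot 1 3 0 s) z $ 2 $ 2 = z $ 2 $ 2"
      "conj_real (rot 1 3 0 s) z $ 3 $ 3 = (s * s) *\<^sub>R z $ 1 $ 1" for s :: real and z :: "'q cd^3^3"
      by (simp_all add: conj_real_nth sum_3 rot_def)
    have nz: "conj_real (rot 1 3 0 1) y $ 2 $ 3 \<noteq> 0" using y by (simp add: rn)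
    obtain k r where k: "k \<in> K_oct" "r \<noteq> 0" "k (conj_real (rot 1 3 0 1) y) $ 2 $ 3 = r *\<^sub>R 1"
      "\<forall>l. k (conj_real (rot 1 3 0 1) y) $ l $ l = conj_real (rot 1 3 0 1) y $ l $ l" using p23[OF nz] by blast
    have o: "orthogonal_matrix (rot (1::3) 3 0 1)" "orthogonal_matrix (rot (1::3) 3 0 (- 1))"
      by (rule orthogonal_rot; simp)+
    have "(\<lambda>x. conj_real (rot 1 3 0 (- 1)) (k (conj_real (rot 1 3 0 1) x))) \<in> K_oct"
      by (rule K_oct_comp[OF conj_real_K_oct[OF o(2)] K_oct_comp[OF k(1) conj_real_K_oct[OF o(1)]]])
    then show ?thesis
      by (rule rev_bexI) (use k in \<open>auto simp: rn forall_3 intro!: exI[of _ "- r"]\<close>)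
  qed
  have sym: "k x $ j $ i = r *\<^sub>R 1" if "k \<in> K_oct" "k x $ i $ j = r *\<^sub>R 1" for k r i j
    using selfadjoint_nth[OF K_octD(2)[OF that(1) x], of i j] that(2) by (simp add: ha_star_simps)
  have nz: "x $ j $ i \<noteq> 0" if "x $ i $ j \<noteq> 0" for i j
    using selfadjoint_nth[OF x, of j i] that by (auto simp: ha_star_simps)
  have rev: "\<exists>k\<in>K_oct. \<exists>r. r \<noteq> 0 \<and> k x $ j $ i = r *\<^sub>R 1 \<and> (\<forall>l. k x $ l $ l = x $ l $ l)"
    if "\<exists>k\<in>K_oct. \<exists>r. r \<noteq> 0 \<and> k x $ i $ j = r *\<^sub>R 1 \<and> (\<forall>l. k x $ l $ l = x $ l $ l)" for i j
    using that sym by blast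
  consider "i = 2" "j = 3" | "i = 3" "j = 2" | "i = 3" "j = 1" | "i = 1" "j = 3" | "i = 2" "j = 1" | "i = 1" "j = 2"
    using ij(1) exhaust_3[of i] exhaust_3[of j] by auto
  then show ?thesis
  proof cases
    case 1 then show ?thesis using p23[of x] ij by simp
  next
    case 2 then show ?thesis using rev[OF p23[OF nz]] ij by simp
  next
    case 3 then show ?thesis using p31[of x] ij by simp
  next
    case 4 then show ?thesis using rev[OF p31[OF nz]] ij by simp
  next
    case 5 then show ?thesis using p21[of x] ij by simp
  next
    case 6 then show ?thesis using rev[OF p21[OF nz]] ij by simp
  qed
qed

lemma spectral_K_oct:
  fixes x :: "'q::{hermitian_algebra,ring_1} cd^3^3"
  assumes x: "x \<in> selfadjoint"
  shows "\<exists>k\<in>K_oct. \<exists>a. x = k (dgm a)"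
proof -
  define S where "S = (\<lambda>k. k x) ` K_oct"
  have step: "k y \<in> S" if ky: "k \<in> K_oct" "y \<in> S" for k y
  proof -
    obtain l where "l \<in> K_oct" "y = l x" using ky by (auto simp: S_def)
    then show ?thesis using K_oct_comp[OF ky(1), of l] by (auto simp: S_def intro: image_eqI[of _ _ "\<lambda>z. k (l z)"])
  qed
  have "\<exists>a. dgm a \<in> S"
  proof (rule jacobi_diagonalization)
    show "compact S" unfolding S_def by (rule compact_K_oct_orbit)
    show "S \<noteq> {}" using K_oct_id by (auto simp: S_def)
    show sa: "S \<subseteq> selfadjoint" using K_octD(2) x by (auto simp: S_def)
    show "conj_real (rot i j c s) y \<in> S" if "y \<in> S" "i \<noteq> j" "c\<^sup>2 + s\<^sup>2 = 1" for y i j c s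
      by (rule step[OF conj_real_K_oct[OF orthogonal_rot[OF that(2,3)]] that(1)])
    show "\<exists>y\<in>S. \<exists>r. r \<noteq> 0 \<and> y $ i $ j = r *\<^sub>R 1 \<and> (\<forall>k. y $ k $ k = z $ k $ k)"
      if z: "z \<in> S" "i \<noteq> j" "z $ i $ j \<noteq> 0" for z i j
      using phase_real[of z i j] z sa step[OF _ z(1)] by (meson subsetD)
  qed
  then obtain k a where k: "k \<in> K_oct" "dgm a = k x" by (auto simp: S_def)
  obtain k' where "k' \<in> K_oct" "k' (k x) = x" using K_oct_inverse[OF k(1)] x by blast
  then show ?thesis using k(2) by (intro bexI[of _ k'] exI[of _ a]) simp_all
qed

lemma K_oct_freud:
  assumes "k \<in> K_oct" "x \<in> selfadjoint" "y \<in> selfadjoint" shows "freud (k x) (k y) = k (freud x y)"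
proof -
  have "mat 1 \<bullet> k z = mat 1 \<bullet> z" for z using K_octD(3,4)[OF assms(1)] by metis
  then show ?thesis
    by (simp add: freud_def linear_add[OF K_octD(1)[OF assms(1)]] linear_diff[OF K_octD(1)[OF assms(1)]]
      linear_scale[OF K_octD(1)[OF assms(1)]] K_octD[OF assms(1)] assms)
qed

lemma K_oct_Q_oct:
  assumes "k \<in> K_oct" "x \<in> selfadjoint" "y \<in> selfadjoint" "z \<in> selfadjoint"
  shows "Q_oct (k x) (k y) (k z) = k (Q_oct x y z)"
  using assms
  by (simp add: Q_oct_def K_oct_freud freud_selfadjoint K_octD(3) linear_add[OF K_octD(1)] linear_diff[OF K_octD(1)] linear_scale[OF K_octD(1)])

section \<open>The Albert algebra as a Jordan frame; the octonionic cone\<close>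

lemma frame_jmul_o: "frame_data.jmul Q_oct (unit_dgm :: 3 \<Rightarrow> 'k::hermitian_algebra^3^3) = jordan"
  by (intro ext) (simp add: frame_data.jmul_def frame_e Q_oct_one)

lemma frame_D_o: "x \<in> selfadjoint \<Longrightarrow> frame_data.D Q_oct (unit_dgm :: 3 \<Rightarrow> 'k::hermitian_algebra^3^3) a x = dscale a x"
  by (simp add: frame_data.D_def frame_dg Q_oct_dgm)

lemma jordan_frame_octonion:
  "jordan_frame (selfadjoint :: ('q::{hermitian_algebra,ring_1} cd^3^3) set) Q_oct unit_dgm K_oct"
proof (rule jordan_frame.intro)
  show "subspace (selfadjoint :: ('q cd^3^3) set)" by (rule subspace_selfadjoint)
  show "unit_dgm i \<in> (selfadjoint :: ('q cd^3^3) set)" for i by (simp add: unit_dgm_def dgm_selfadjoint)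
  show "(unit_dgm i :: 'q cd^3^3) \<bullet> unit_dgm j = (if i = j then 1 else 0)" for i j by (rule unit_dgm_inner)
  show "linear (\<lambda>x. Q_oct x y z)" for y z :: "'q cd^3^3" by (rule Q_oct_linear)
  show "linear (Q_oct x y)" for x y :: "'q cd^3^3" by (rule Q_oct_linear)
  show "Q_oct x y z = Q_oct y x z" for x y z :: "'q cd^3^3" by (simp add: Q_oct_def freud_comm[of x y] add.commute)
  show "Q_oct x y z \<in> selfadjoint" if "x \<in> selfadjoint" "y \<in> selfadjoint" "z \<in> selfadjoint" for x y z :: "'q cd^3^3"
    using that by (rule Q_oct_selfadjoint)
  show "Q_oct x y z \<bullet> w = z \<bullet> Q_oct x y w" if "x \<in> selfadjoint" "y \<in> selfadjoint" for x y z w :: "'q cd^3^3"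
    using that by (rule Q_oct_inner)
  show "Q_oct (frame_data.e unit_dgm) (frame_data.e unit_dgm) x = x" for x :: "'q cd^3^3"
    by (simp add: frame_e Q_oct_one jordan_one)
  show "Q_oct x y (frame_data.e unit_dgm) = frame_data.jmul Q_oct unit_dgm x y" if "x \<in> selfadjoint" for x y :: "'q cd^3^3"
    using that by (simp add: frame_e frame_jmul_o Q_oct_one_right)
  show "Q_oct (frame_data.dg unit_dgm a) (frame_data.dg unit_dgm b) (frame_data.dg unit_dgm d) =
      (frame_data.dg unit_dgm (\<lambda>i. a i * b i * d i) :: 'q cd^3^3)" for a b d
    unfolding frame_dg Q_oct_def dgm_herm3 freud_herm3 herm3_inner herm3_linear herm3_eq_iff
    by (simp add: field_simps ha_star_simps ha_mult_simps)
  show "frame_data.jmul Q_oct unit_dgm (frame_data.dg unit_dgm a) x \<bullet> x > 0"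
    if "\<And>i. a i > 0" "x \<noteq> 0" for a and x :: "'q cd^3^3"
    unfolding frame_jmul_o frame_dg using that by (rule jordan_dgm_pos)
  show "Q_oct (frame_data.D Q_oct unit_dgm a x) (frame_data.D Q_oct unit_dgm a y) z =
      frame_data.D Q_oct unit_dgm a (Q_oct x y (frame_data.D Q_oct unit_dgm a z))"
    if "x \<in> selfadjoint" "y \<in> selfadjoint" "z \<in> selfadjoint" for a and x y z :: "'q cd^3^3"
    using that by (simp add: frame_D_o Q_oct_dscale Q_oct_selfadjoint dscale_selfadjoint)
  show "frame_data.D Q_oct unit_dgm a (frame_data.D Q_oct unit_dgm b x) = frame_data.D Q_oct unit_dgm (\<lambda>i. a i * b i) x"
    if "x \<in> selfadjoint" for a b and x :: "'q cd^3^3"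
    using that by (simp add: frame_D_o dscale_selfadjoint) (simp add: dscale_def vec_eq_iff mult_ac)
  show "Q_oct (frame_data.dg unit_dgm a) z (frame_data.dg unit_dgm a) =
      frame_data.jmul Q_oct unit_dgm (frame_data.dg unit_dgm (\<lambda>i. (a i)\<^sup>2)) z" if "z \<in> selfadjoint" for a and z :: "'q cd^3^3"
    using that by (simp add: frame_dg frame_jmul_o Q_oct_shift_dgm)
  show "Q_oct v v (frame_data.dg unit_dgm a) \<bullet> frame_data.dg unit_dgm a \<le>
      frame_data.jmul Q_oct unit_dgm (frame_data.dg unit_dgm a) v \<bullet> frame_data.jmul Q_oct unit_dgm (frame_data.dg unit_dgm a) v"
    if "v \<in> selfadjoint" for a and v :: "'q cd^3^3"
    using that by (simp add: frame_dg frame_jmul_o Q_oct_curv_dgm)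
  show "linear k" if "k \<in> K_oct" for k :: "'q cd^3^3 \<Rightarrow> 'q cd^3^3" by (rule K_octD[OF that])
  show "k x \<in> selfadjoint" if "k \<in> K_oct" "x \<in> selfadjoint" for k and x :: "'q cd^3^3" using K_octD(2) that .
  show "k x \<bullet> k y = x \<bullet> y" if "k \<in> K_oct" for k and x y :: "'q cd^3^3" by (rule K_octD(3)[OF that])
  show "k (frame_data.e unit_dgm) = frame_data.e unit_dgm" if "k \<in> K_oct" for k :: "'q cd^3^3 \<Rightarrow> _"
    unfolding frame_e by (rule K_octD(4)[OF that])
  show "Q_oct (k x) (k y) (k z) = k (Q_oct x y z)" if "k \<in> K_oct" "x \<in> selfadjoint" "y \<in> selfadjoint" "z \<in> selfadjoint"
    for k and x y z :: "'q cd^3^3" using that by (rule K_oct_Q_oct)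
  show "(\<lambda>x. x) \<in> (K_oct :: ('q cd^3^3 \<Rightarrow> _) set)" by (rule K_oct_id)
  show "\<exists>k'\<in>K_oct. \<forall>x\<in>selfadjoint. k' (k x) = x \<and> k (k' x) = x" if "k \<in> K_oct" for k :: "'q cd^3^3 \<Rightarrow> _"
    by (rule K_oct_inverse[OF that])
  show "\<exists>k\<in>K_oct. \<exists>a. x = k (frame_data.dg unit_dgm a)" if "x \<in> selfadjoint" for x :: "'q cd^3^3"
    unfolding frame_dg by (rule spectral_K_oct[OF that])
  show "\<exists>k\<in>K_oct. \<forall>l. k (unit_dgm l :: 'q cd^3^3) = unit_dgm (Transposition.transpose i j l)" for i j
  proof (cases "i = j")
    case True then show ?thesis by (intro bexI[of _ "\<lambda>x. x"] K_oct_id) simp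
  next
    case False
    have "orthogonal_matrix (rot i j 0 1)" by (rule orthogonal_rot[OF False]) simp
    from conj_real_K_oct[OF this] show ?thesis using conj_real_rot_swap[OF False] unfolding unit_dgm_def by blast
  qed
qed

lemma posdef_oct_eq: "frame_data.U selfadjoint Q_oct unit_dgm = posdef_oct"
  by (simp add: frame_data.U_def posdef_oct_def frame_jmul_o)

theorem octonion_cone:
  assumes "invariant_metric selfadjoint posdef_oct cone_automorphisms g"
  shows "has_flat_frobenius_torus (cartan :: (octonion^3^3) set) torus selfadjoint posdef_oct cone_automorphisms g \<and>
    homogeneous posdef_oct cone_automorphisms \<and> cartan_hadamard selfadjoint posdef_oct g \<and>
    carries_pre_frobenius selfadjoint posdef_oct g"
proof -
  interpret jordan_frame "selfadjoint :: (octonion^3^3) set" Q_oct unit_dgm K_oct by (rule jordan_frame_octonion)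
  have U: "U = posdef_oct" by (rule posdef_oct_eq)
  interpret jordan_cone "selfadjoint :: (octonion^3^3) set" Q_oct unit_dgm K_oct cone_automorphisms
  proof
    have "k ` U = U" if k: "k \<in> K_oct" for k :: "octonion^3^3 \<Rightarrow> octonion^3^3"
    proof -
      obtain k' where k': "k' \<in> K_oct" "\<forall>x\<in>selfadjoint. k' (k x) = x \<and> k (k' x) = x" using K_inv[OF k] by blast
      show ?thesis
      proof
        show "k ` U \<subseteq> U" using K_U[OF k] U_V by blast
        show "U \<subseteq> k ` U"
        proof
          fix x assume x: "x \<in> U"
          then have "k' x \<in> U" "k (k' x) = x" using K_U[OF k'(1)] k'(2) U_V by blast+
          then show "x \<in> k ` U" by (metis image_eqI)
        qed
      qed
    qed
    then show "K_oct \<subseteq> (cone_automorphisms :: (octonion^3^3 \<Rightarrow> _) set)"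
      using K_linear by (auto simp: cone_automorphisms_def U)
    show "D a \<in> cone_automorphisms" if a: "\<And>i. a i > 0" for a
    proof -
      have b: "inverse (a i) > 0" for i using a by simp
      have a0: "a i \<noteq> 0" for i using a[of i] by simp
      \<comment> \<open>Surjectivity of the scaling on the cone: the preimage is found with the
        reciprocal scaling, which also preserves the cone by \<open>D_U\<close>.\<close>
      have "x \<in> D a ` U" if "x \<in> U" for x
        using D_inverse(2)[where a = a, OF a0 U_V[OF that]] D_U[where a = "\<lambda>i. inverse (a i)", OF that b]
        by (intro image_eqI[where f = "D a" and x = "D (\<lambda>i. inverse (a i)) x"]) simp_all
      moreover have "D a x \<in> U" if "x \<in> U" for x by (rule D_U[where a = a, OF that a])
      ultimately have "D a ` U = U" by blast
      then show ?thesis using D_linear by (simp add: cone_automorphisms_def U)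
    qed
    show "(\<lambda>x. k (l x)) \<in> cone_automorphisms" if "k \<in> cone_automorphisms" "l \<in> cone_automorphisms" for k l
    proof -
      have "linear (\<lambda>x. k (l x))"
        using that linear_compose[of l k] by (simp add: cone_automorphisms_def o_def)
      moreover have "(\<lambda>x. k (l x)) ` posdef_oct = k ` l ` posdef_oct" by (simp add: image_image)
      ultimately show ?thesis using that by (simp add: cone_automorphisms_def)
    qed
    show "k ` U = U" if "k \<in> cone_automorphisms" for k using that by (simp add: cone_automorphisms_def U)
  qed
  show ?thesis using invariant_metric_cone[of g] assms by (simp add: U frame_W frame_T)
qed

section \<open>The four families of cones\<close>

theorem corollary7p7p1:
  shows
    "(\<forall>g. invariant_metric selfadjoint (posdef :: (real^'n^'n) set) congruences g \<longrightarrow>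
        has_flat_frobenius_torus (cartan :: (real^'n^'n) set) torus
          selfadjoint (posdef :: (real^'n^'n) set) congruences g \<and>
        homogeneous (posdef :: (real^'n^'n) set) congruences \<and>
        cartan_hadamard selfadjoint (posdef :: (real^'n^'n) set) g \<and>
        carries_pre_frobenius selfadjoint (posdef :: (real^'n^'n) set) g) \<and>
     (\<forall>g. invariant_metric selfadjoint (posdef :: (complex^'n^'n) set) congruences g \<longrightarrow>
        has_flat_frobenius_torus (cartan :: (complex^'n^'n) set) torus
          selfadjoint (posdef :: (complex^'n^'n) set) congruences g \<and>
        homogeneous (posdef :: (complex^'n^'n) set) congruences \<and>
        cartan_hadamard selfadjoint (posdef :: (complex^'n^'n) set) g \<and>
        carries_pre_frobenius selfadjoint (posdef :: (complex^'n^'n) set) g) \<and>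
     (\<forall>g. invariant_metric selfadjoint (posdef :: (quaternion^'n^'n) set) congruences g \<longrightarrow>
        has_flat_frobenius_torus (cartan :: (quaternion^'n^'n) set) torus
          selfadjoint (posdef :: (quaternion^'n^'n) set) congruences g \<and>
        homogeneous (posdef :: (quaternion^'n^'n) set) congruences \<and>
        cartan_hadamard selfadjoint (posdef :: (quaternion^'n^'n) set) g \<and>
        carries_pre_frobenius selfadjoint (posdef :: (quaternion^'n^'n) set) g) \<and>
     (\<forall>g. invariant_metric selfadjoint posdef_oct cone_automorphisms g \<longrightarrow>
        has_flat_frobenius_torus (cartan :: (octonion^3^3) set) torus
          selfadjoint posdef_oct cone_automorphisms g \<and>
        homogeneous posdef_oct cone_automorphisms \<and>
        cartan_hadamard selfadjoint posdef_oct g \<and>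
        carries_pre_frobenius selfadjoint posdef_oct g)"
  by (rule conjI[OF _ conjI[OF _ conjI]]; intro allI impI) (erule matrix_cone octonion_cone)+

end
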